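(* Let $d\ge2$ be an integer, $\alpha>\frac{j_{d/2-1,1}}{\pi}$, and let $\mathcal{X}=\{x_k\}_{k=1}^s\subseteq[-\frac12,\frac12)^d$ be a set of $s$ distinct points. Suppose $m\ge4s\sqrt d$ (real), there is $0<\tau\le\frac{1}{4\sqrt d}$ such that $\frac{2\alpha\nu}{\tau}\le m$, where $\nu:=\nu_2(\tau,\mathcal{X})$, and $\mathcal{X}$ locally consists of hyperplanes with parameters $(2,\frac{\nu}{m},r,\eta)$ such that $\eta\le\frac{r+1}{2m}$. Then $$\sigma_{\min}(\mathcal{F}_{B_m,\mathcal{X}})\ge\frac{1}{\sqrt{2^{\nu-1}s}}\Big(\frac{c(\alpha)}{|B_1|}\Big)^{\nu/2}\Big(\frac{|B_{\alpha/\tau}|}{|B_{\alpha/\tau}|_*}\Big)^{\nu/2}\sqrt{|B_{m/(2r+2)}|}\ \frac{1}{2^{r/2}}\Big(\frac{2m\eta}{r+1}\Big)^r.$$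
   Context: $B_m=\{x\in\mathbb{R}^d:|x|_2\le m\}$. For compact $\Omega\subset\mathbb{R}^d$, $|\Omega|$ is its Lebesgue measure and $|\Omega|_*=|\Omega\cap\mathbb{Z}^d|$ is the number of integer points in $\Omega$. $\mathcal{F}_{\Omega,\mathcal{X}}:\mathbb{C}^s\to L^2(\Omega)$ is $(\mathcal{F}_{\Omega,\mathcal{X}}u)(\omega)=\sum_{k=1}^s u_ke^{-2\pi i\omega\cdot x_k}$, and $\sigma_{\min}(\mathcal{F}_{\Omega,\mathcal{X}})$ is the minimum of $\|\mathcal{F}_{\Omega,\mathcal{X}}u\|_{L^2(\Omega)}$ over $u\in\mathbb{C}^s$ with $|u|_2=1$. $\mathcal{N}_p(x,\tau,\mathcal{X})=\{x'\in\mathcal{X}:|x'-x|_p\le\tau\}$ with $|\cdot|_p$ the $\ell^p$ norm on $\mathbb{R}^d$, and the local sparsity is $\nu_p(\tau,\mathcal{X})=\max_{x\in\mathcal{X}}|\mathcal{N}_p(x,\tau,\mathcal{X})|$. A finite set $\mathcal{U}$ consists of $r$ hyperplanes relative to $x\in\mathcal{U}$ if there are (affine) hyperplanes $\mathcal{H}_1,\dots,\mathcal{H}_r\subset\mathbb{R}^d$, none containing $x$, with $\mathcal{U}\setminus\{x\}\subseteq\mathcal{H}_1\cup\cdots\cup\mathcal{H}_r$. $\mathcal{X}$ locally consists of hyperplanes with parameters $(p,\rho,r,\eta)$, $\eta>0$, if for each $x\in\mathcal{X}$ the set $\mathcal{N}_p(x,\rho,\mathcal{X})$ consists of at most $r$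 hyperplanes relative to $x$, and the $\ell^2$ distance between $x$ and each of these hyperplanes is at least $\eta$. $J_\nu$ is the Bessel function of the first kind of order $\nu$, and $j_{\nu,k}$ is its $k$-th positive zero. $|\mathbb{S}^{d-1}|$ is the surface measure of the unit sphere in $\mathbb{R}^d$. For $\alpha\in(\frac{j_{d/2-1,1}}{\pi},\frac{j_{d/2,1}}{\pi})$, $$c(\alpha)=\frac{1}{|\mathbb{S}^{d-1}|}\Big(\frac{2}{\alpha}\Big)^d\frac{\gamma(\alpha)}{1+\gamma(\alpha)/d},\qquad \gamma(\alpha)=\frac{-\pi\alpha J_{d/2-1}(\pi\alpha)}{J_{d/2}(\pi\alpha)},$$ and for $\alpha\ge\frac{j_{d/2,1}}{\pi}$, $c(\alpha)=\frac{1}{|\mathbb{S}^{d-1}|}\big(\frac{2\pi}{j_{d/2,1}}\big)^d$. *)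

theory Defs
  imports "HOL-Analysis.Analysis"
begin

subsection \<open>Fourier operator and its smallest singular value\<close>

text \<open>
  The points \<open>x\<^sub>1, \<dots>, x\<^sub>s\<close> are indexed by a finite type \<open>'s\<close> with \<open>s = CARD('s)\<close>, so that
  \<open>\<complex>\<^sup>s\<close> is \<open>complex ^ 's\<close>, whose \<open>norm\<close> is the Euclidean norm.
\<close>

definition fourier_op :: "('s::finite \<Rightarrow> real ^ 'n) \<Rightarrow> complex ^ 's \<Rightarrow> real ^ 'n \<Rightarrow> complex" where
  "fourier_op x u \<omega> = (\<Sum>k\<in>UNIV. u $ k * exp (- 2 * complex_of_real pi * \<i> * complex_of_real (\<omega> \<bullet> x k)))"

definition L2_norm_on :: "'a::euclidean_space set \<Rightarrow> ('a \<Rightarrow> complex) \<Rightarrow> real" where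
  "L2_norm_on \<Omega> f = sqrt (LINT \<omega>:\<Omega>|lebesgue. (cmod (f \<omega>))\<^sup>2)"

text \<open>
  For compact \<open>\<Omega>\<close> the infimum is a minimum, because the unit sphere of \<open>complex ^ 's\<close> is compact and
  nonempty and the map \<open>u \<mapsto> L2_norm_on \<Omega> (fourier_op x u)\<close> is a seminorm.
\<close>

definition sigma_min :: "(real ^ 'n) set \<Rightarrow> ('s::finite \<Rightarrow> real ^ 'n) \<Rightarrow> real" where
  "sigma_min \<Omega> x = (INF u\<in>{u :: complex ^ 's. norm u = 1}. L2_norm_on \<Omega> (fourier_op x u))"

definition lebesgue_vol :: "(real ^ 'n) set \<Rightarrow> real" where
  "lebesgue_vol \<Omega> = measure lebesgue \<Omega>"

definition lattice_count :: "(real ^ 'n) set \<Rightarrow> nat" where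
  "lattice_count \<Omega> = card (\<Omega> \<inter> {z. \<forall>i. z $ i \<in> \<int>})"


subsection \<open>Local geometry of a finite set\<close>

definition lp_norm :: "real \<Rightarrow> real ^ 'n \<Rightarrow> real" where
  "lp_norm p x = (\<Sum>i\<in>UNIV. \<bar>x $ i\<bar> powr p) powr (1 / p)"

lemma lp_norm_2: "lp_norm 2 x = norm x"
  by (simp add: lp_norm_def norm_vec_def L2_set_def powr_half_sqrt sum_nonneg)

definition neighborhood :: "real \<Rightarrow> real ^ 'n \<Rightarrow> real \<Rightarrow> (real ^ 'n) set \<Rightarrow> (real ^ 'n) set" where
  "neighborhood p x \<tau> X = {x' \<in> X. lp_norm p (x' - x) \<le> \<tau>}"

definition local_sparsity :: "real \<Rightarrow> real \<Rightarrow> (real ^ 'n) set \<Rightarrow> nat" where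
  "local_sparsity p \<tau> X = Max ((\<lambda>x. card (neighborhood p x \<tau> X)) ` X)"

definition affine_hyperplane :: "'a::euclidean_space set \<Rightarrow> bool" where
  "affine_hyperplane H \<longleftrightarrow> (\<exists>a b. a \<noteq> 0 \<and> H = {y. a \<bullet> y = b})"

text \<open>\<open>U\<close> consists of \<open>q\<close> hyperplanes relative to \<open>x\<close>, with \<open>H 0, \<dots>, H (q - 1)\<close> as witnesses.\<close>

definition consists_of_hyperplanes ::
    "'a::euclidean_space set \<Rightarrow> 'a \<Rightarrow> nat \<Rightarrow> (nat \<Rightarrow> 'a set) \<Rightarrow> bool" where
  "consists_of_hyperplanes U x q H \<longleftrightarrow>
     finite U \<and> x \<in> U \<and> (\<forall>i<q. affine_hyperplane (H i) \<and> x \<notin> H i) \<and> U - {x} \<subseteq> (\<Union>i<q. H i)"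

definition locally_consists_of_hyperplanes ::
    "(real ^ 'n) set \<Rightarrow> real \<Rightarrow> real \<Rightarrow> nat \<Rightarrow> real \<Rightarrow> bool" where
  "locally_consists_of_hyperplanes X p \<rho> r \<eta> \<longleftrightarrow>
     \<eta> > 0 \<and>
     (\<forall>x\<in>X. \<exists>q\<le>r. \<exists>H. consists_of_hyperplanes (neighborhood p x \<rho> X) x q H \<and>
                     (\<forall>i<q. infdist x (H i) \<ge> \<eta>))"


subsection \<open>Bessel functions and the constant \<open>c(\<alpha>)\<close>\<close>

text \<open>
  Power series of \<open>J\<^sub>\<nu>\<close> for real order; because of \<open>powr\<close> it is the Bessel function on \<open>z > 0\<close> only.
\<close>

definition bessel_J :: "real \<Rightarrow> real \<Rightarrow> real" where
  "bessel_J \<nu> z = (\<Sum>k. (-1) ^ k / (fact k * Gamma (\<nu> + real k + 1)) * (z / 2) powr (\<nu> + 2 * real k))"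

text \<open>The \<open>k\<close>-th positive zero is the zero with exactly \<open>k\<close> zeros in \<open>(0, z]\<close>; meant for \<open>k \<ge> 1\<close>.\<close>

definition bessel_zero :: "real \<Rightarrow> nat \<Rightarrow> real" where
  "bessel_zero \<nu> k =
     (THE z. z > 0 \<and> bessel_J \<nu> z = 0 \<and> card {y. 0 < y \<and> y \<le> z \<and> bessel_J \<nu> y = 0} = k)"

text \<open>
  Surface measure on the unit sphere as given by polar coordinates: \<open>A\<close> has \<open>d\<close> times the volume of
  the cone \<open>{t y | 0 < t \<le> 1, y \<in> A}\<close>.
\<close>

definition sphere_measure :: "(real ^ 'n) set \<Rightarrow> real" where
  "sphere_measure A = real CARD('n) * lebesgue_vol {t *\<^sub>R y | t y. 0 < t \<and> t \<le> 1 \<and> y \<in> A}"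

definition bessel_gamma :: "nat \<Rightarrow> real \<Rightarrow> real" where
  "bessel_gamma d \<alpha> =
     - pi * \<alpha> * bessel_J (real d / 2 - 1) (pi * \<alpha>) / bessel_J (real d / 2) (pi * \<alpha>)"

text \<open>
  \<open>c(\<alpha>)\<close> in dimension \<open>d = CARD('n)\<close>; only meaningful for \<open>\<alpha> > bessel_zero (d / 2 - 1) 1 / pi\<close>.
\<close>

definition c_const :: "'n::finite itself \<Rightarrow> real \<Rightarrow> real" where
  "c_const _ \<alpha> =
     (let d = CARD('n);
          S = sphere_measure (sphere (0 :: real ^ 'n) 1);
          j = bessel_zero (real d / 2) 1
      in if \<alpha> < j / pi
         then 1 / S * (2 / \<alpha>) ^ d * (bessel_gamma d \<alpha> / (1 + bessel_gamma d \<alpha> / real d))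
         else 1 / S * (2 * pi / j) ^ d)"

end

theory Submission
  imports Defs "HOL-Probability.Probability"
begin

text \<open>
Write \<open>F(\<xi>) = \<Sum>\<^sub>k u\<^sub>k exp(-2\<pi>i \<xi>\<bullet>x\<^sub>k)\<close>. Since some \<open>|u\<^sub>k|\<^sup>2 \<ge> 1/s\<close>, it is enough to bound a single coefficient
\<open>u\<^sub>k\<close> by the \<open>L\<^sup>2\<close> norm of \<open>F\<close> over the ball of radius \<open>m\<close>. To isolate \<open>u\<^sub>k\<close>, operators are applied to
\<open>F\<close> that commute with translations, hence multiply each \<open>u\<^sub>j\<close> by a number \<open>\<mu>\<^sub>j\<close>; they read \<open>F\<close> on a
slightly larger set than the one on which their result is measured, and the chain must end inside the ball of
radius \<open>m\<close>. If all \<open>\<mu>\<^sub>j\<close> with \<open>j \<noteq> k\<close> vanish, what is left has constant modulus \<open>|\<mu>\<^sub>k u\<^sub>k|\<close> on a set \<open>E\<close>,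
and \<open>|\<mu>\<^sub>k u\<^sub>k|\<^sup>2 |E|\<close> is bounded by the energy of \<open>F\<close>. This is the dual form of interpolating the
values \<open>\<delta>\<^sub>j\<^sub>k\<close> at the points \<open>x\<^sub>j\<close> by a function whose spectrum lies in that ball.

How a point is annihilated depends on its distance from \<open>x\<^sub>k\<close>.

\<^item> Points farther than \<open>\<tau>\<close>: colour the points with \<open>\<nu>\<close> colours so that points within distance \<open>\<tau>\<close>
  get different colours. The far points of one colour form together with \<open>x\<^sub>k\<close> a \<open>\<tau>\<close>-separated set, for which
  Ingham's inequality on the ball of radius \<open>\<alpha>/\<tau>\<close> provides a convolution kernel (\<open>separated_multiplier\<close>).
  The \<open>\<nu>\<close> kernels together use radius at most \<open>m/2\<close>.
\<^item> Points within \<open>\<nu>/m\<close> lie on \<open>q \<le> r\<close> hyperplanes. A hyperplane through \<open>y\<close> with normal direction \<open>a\<close> is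
  annihilated by the difference of the translates by \<open>a\<close> and \<open>-a\<close>, whose multiplier is
  \<open>sin(2\<pi> a\<bullet>(x - y))\<close> (\<open>multiplier_bound_sine\<close>).
\<^item> The at most \<open>\<nu> - 1\<close> points in between are annihilated one by one by such sine factors.

The constants close for two reasons. First, the sine factors are centred: a factor with two frequencies that
differ by \<open>2a\<close> costs only radius \<open>|a|\<close>. Second, the kernels are better than \<open>c(\<alpha>)\<close> by a factor \<open>2/(d+2)\<close> in the
squared norm, because Ingham's inequality holds with the weight \<open>1 - |\<xi>|\<^sup>2/R\<^sup>2\<close>, whose mass is that fraction of
the volume of the ball. This gain pays for a ball that has fewer lattice points than volume and, if \<open>r = 0\<close>, for the
radius spent on the intermediate points (\<open>intermediate_budget\<close>).

Ingham's inequality with the constant \<open>c(\<alpha>)\<close> comes from the extremal function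
\<open>G = 1 - \<phi>(|z|)/\<phi>(\<tau>/2)\<close> on the ball of radius \<open>\<tau>/2\<close>, extended by zero, where \<open>\<phi>\<close> is the radial
solution of \<open>\<Delta>\<phi> = -4\<pi>\<^sup>2R\<^sup>2\<phi>\<close>, a Bessel function. The translates of \<open>G\<close> to the points of a \<open>\<tau>\<close>-separated set have
disjoint supports, so \<open>\<Phi> = \<Sum> u\<^sub>j G(\<cdot> - x\<^sub>j)\<close> satisfies
\<open>R\<^sup>2\<parallel>\<Phi>\<parallel>\<^sup>2 - \<parallel>\<nabla>\<Phi>\<parallel>\<^sup>2/4\<pi>\<^sup>2 = (\<Sum> |u\<^sub>j|\<^sup>2) R\<^sup>2 \<integral>G\<close>. By Plancherel the left side is the integral of
\<open>(R\<^sup>2 - |\<xi>|\<^sup>2) |G^(\<xi>)|\<^sup>2 |F(\<xi>)|\<^sup>2\<close>, where the part with \<open>|\<xi>| > R\<close> is negative, and \<open>|G^| \<le> \<integral>G\<close> as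
\<open>G \<ge> 0\<close> (\<open>ingham_ball\<close>).
\<close>

section \<open>The Bessel-Clifford function and first zeros of Bessel functions\<close>

text \<open>
The entire function \<open>C\<^sub>N\<close> with \<open>J\<^sub>N\<^sub>-\<^sub>1(z) = (z/2)\<^sup>N\<^sup>-\<^sup>1 C\<^sub>N(z\<^sup>2/4)\<close>. As a function of the square of the argument it
makes radial functions \<open>C\<^sub>N(b\<^sup>2 z\<bullet>z)\<close> smooth at the origin and avoids real powers. The index is shifted by
one so that \<open>N = d/2\<close> in dimension \<open>d\<close>.
\<close>

definition bessel_clifford :: "real \<Rightarrow> real \<Rightarrow> real" where
  "bessel_clifford N s = (\<Sum>k. (-1) ^ k / (fact k * Gamma (N + real k)) * s ^ k)"

lemma fact_Suc_cancel: "real (Suc k) * (a / (fact (Suc k) * g)) = a / (fact k * g)"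
  by (simp add: fact_Suc del: of_nat_Suc)

text \<open>
\<open>\<Gamma>(N + k) \<ge> N\<^sup>k \<Gamma>(N)\<close>, so the series is dominated by an exponential series.
\<close>

lemma bessel_clifford_coeff_bound:
  assumes "N > 0"
  shows "\<bar>(-1) ^ k / (fact k * Gamma (N + real k)) * s ^ k\<bar> \<le> (\<bar>s\<bar> / N) ^ k / fact k / Gamma N"
proof -
  have "N ^ k \<le> pochhammer N k"
  proof -
    have "N ^ k = (\<Prod>i<k. N)" by simp
    also have "\<dots> \<le> (\<Prod>i<k. N + real i)" using assms by (intro prod_mono) auto
    finally show ?thesis by (simp add: pochhammer_prod atLeast0LessThan)
  qed
  moreover have "Gamma (N + real k) = pochhammer N k * Gamma N"
    using pochhammer_Gamma[of N k] Gamma_real_pos[OF assms] assms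
    by (auto simp: field_simps nonpos_Ints_def)
  ultimately have "N ^ k * Gamma N \<le> Gamma (N + real k)"
    using Gamma_real_pos[OF assms] by simp
  moreover have "0 < N ^ k * Gamma N" using assms by simp
  ultimately have "1 / Gamma (N + real k) \<le> 1 / (N ^ k * Gamma N)"
    by (intro divide_left_mono) auto
  then have "\<bar>s\<bar> ^ k / fact k * (1 / Gamma (N + real k)) \<le> \<bar>s\<bar> ^ k / fact k * (1 / (N ^ k * Gamma N))"
    by (intro mult_left_mono) auto
  then show ?thesis
    using assms by (simp add: abs_mult power_abs abs_divide power_divide field_simps)
qed

lemma bessel_clifford_summable:
  assumes "N > 0"
  shows "summable (\<lambda>k. (-1) ^ k / (fact k * Gamma (N + real k)) * s ^ k)"
proof (rule summable_comparison_test)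
  show "\<exists>M. \<forall>n\<ge>M. norm ((-1) ^ n / (fact n * Gamma (N + real n)) * s ^ n) \<le> (\<bar>s\<bar> / N) ^ n / fact n / Gamma N"
    using bessel_clifford_coeff_bound[OF assms] by auto
  show "summable (\<lambda>n. (\<bar>s\<bar> / N) ^ n / fact n / Gamma N)"
    using summable_exp[of "\<bar>s\<bar> / N"] by (intro summable_divide) (simp add: field_simps)
qed

lemma bessel_clifford_has_derivative:
  assumes "N > 0"
  shows "(bessel_clifford N has_real_derivative - bessel_clifford (N + 1) s) (at s)"
proof -
  let ?c = "\<lambda>k. (-1) ^ k / (fact k * Gamma (N + real k)) :: real"
  have "(bessel_clifford N has_real_derivative (\<Sum>n. diffs ?c n * s ^ n)) (at s)"
    unfolding bessel_clifford_def[abs_def]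
    using termdiffs_strong_converges_everywhere[OF bessel_clifford_summable[OF assms]] .
  moreover have "diffs ?c n = - ((-1) ^ n / (fact n * Gamma (N + 1 + real n)))" for n
    using fact_Suc_cancel[of n "(-1) ^ Suc n" "Gamma (N + real (Suc n))"]
    by (simp add: diffs_def add_ac del: fact_Suc)
  ultimately show ?thesis
    using suminf_minus[OF bessel_clifford_summable[of "N + 1" s]] assms
    by (simp add: bessel_clifford_def)
qed

text \<open>
The Bessel equation in the form of a three term relation, as \<open>C\<^sub>N\<close> has derivative \<open>-C\<^sub>N\<^sub>+\<^sub>1\<close>.
\<close>

lemma bessel_clifford_recurrence:
  assumes "N > 0"
  shows "bessel_clifford N s = N * bessel_clifford (N + 1) s - s * bessel_clifford (N + 2) s"
proof -
  let ?a = "\<lambda>k. (-1) ^ k / (fact k * Gamma (N + 1 + real k)) * s ^ k"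
  have G: "Gamma (N + 1 + real k) = (N + real k) * Gamma (N + real k)" for k
    using Gamma_plus1[of "N + real k"] assms by (auto simp: nonpos_Ints_def algebra_simps)
  have coeff: "(\<lambda>k. (-1) ^ k / (fact k * Gamma (N + real k)) * s ^ k) = (\<lambda>k. N * ?a k + real k * ?a k)"
  proof
    fix k
    have "Gamma (N + real k) > 0" using assms by simp
    then show "(-1) ^ k / (fact k * Gamma (N + real k)) * s ^ k = N * ?a k + real k * ?a k"
      using assms unfolding G by (simp add: divide_simps) (simp add: algebra_simps)
  qed
  have s1: "(\<lambda>k. N * ?a k) sums (N * bessel_clifford (N + 1) s)"
    unfolding bessel_clifford_def using assms by (intro sums_mult summable_sums bessel_clifford_summable) auto
  have s2: "(\<lambda>k. real k * ?a k) sums (- s * bessel_clifford (N + 2) s)"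
  proof -
    have "(\<lambda>k. - s * ((-1) ^ k / (fact k * Gamma (N + 2 + real k)) * s ^ k)) sums (- s * bessel_clifford (N + 2) s)"
      unfolding bessel_clifford_def using assms by (intro sums_mult summable_sums bessel_clifford_summable) auto
    moreover have "real (Suc k) * ?a (Suc k) = - s * ((-1) ^ k / (fact k * Gamma (N + 2 + real k)) * s ^ k)" for k
    proof -
      have "real (Suc k) * ?a (Suc k) = (real (Suc k) * ((-1) ^ Suc k / (fact (Suc k) * Gamma (N + 1 + real (Suc k))))) * s ^ Suc k"
        by simp
      also have "\<dots> = ((-1) ^ Suc k / (fact k * Gamma (N + 1 + real (Suc k)))) * s ^ Suc k"
        by (subst fact_Suc_cancel) simp
      also have "\<dots> = - s * ((-1) ^ k / (fact k * Gamma (N + 2 + real k)) * s ^ k)"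
        by (simp add: add_ac)
      finally show ?thesis .
    qed
    ultimately have "(\<lambda>k. real (Suc k) * ?a (Suc k)) sums (- s * bessel_clifford (N + 2) s)" by simp
    then have "(\<lambda>k. real k * ?a k) sums (- s * bessel_clifford (N + 2) s + real 0 * ?a 0)"
      by (rule sums_Suc)
    then show ?thesis by simp
  qed
  have "(\<lambda>k. (-1) ^ k / (fact k * Gamma (N + real k)) * s ^ k) sums (N * bessel_clifford (N + 1) s + - s * bessel_clifford (N + 2) s)"
    unfolding coeff by (rule sums_add[OF s1 s2])
  then show ?thesis by (simp add: bessel_clifford_def sums_iff)
qed

lemma bessel_clifford_0: "N > 0 \<Longrightarrow> bessel_clifford N 0 = 1 / Gamma N"
  unfolding bessel_clifford_def by (subst powser_zero) simp

lemma bessel_clifford_continuous: "N > 0 \<Longrightarrow> continuous_on A (bessel_clifford N)"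
  by (rule DERIV_continuous_on[OF has_field_derivative_at_within[OF bessel_clifford_has_derivative]])

lemma bessel_J_eq_bessel_clifford:
  assumes "N > 0" "z > 0"
  shows "bessel_J (N - 1) z = (z / 2) powr (N - 1) * bessel_clifford N ((z / 2)\<^sup>2)"
proof -
  have coeff: "(-1) ^ k / (fact k * Gamma (N - 1 + real k + 1)) * (z / 2) powr (N - 1 + 2 * real k)
      = (z / 2) powr (N - 1) * ((-1) ^ k / (fact k * Gamma (N + real k)) * ((z / 2)\<^sup>2) ^ k)" for k
  proof -
    have "(z / 2) powr (2 * real k) = ((z / 2)\<^sup>2) ^ k"
      using assms powr_realpow[of "z / 2" "2 * k"] by (simp add: power_mult del: power_divide)
    moreover have "(z / 2) powr (N - 1 + 2 * real k) = (z / 2) powr (N - 1) * (z / 2) powr (2 * real k)"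
      by (rule powr_add)
    moreover have "N - 1 + real k + 1 = N + real k" by simp
    ultimately show ?thesis by (simp del: power_divide)
  qed
  show ?thesis
    unfolding bessel_J_def bessel_clifford_def coeff
    by (rule suminf_mult[OF bessel_clifford_summable[OF assms(1)]])
qed

lemma bessel_clifford_weighted_derivative:
  assumes "N > 0" "s > 0"
  shows "((\<lambda>s. s powr N * bessel_clifford (N + 1) s) has_real_derivative s powr (N - 1) * bessel_clifford N s) (at s)"
proof -
  have "((\<lambda>s. s powr N * bessel_clifford (N + 1) s) has_real_derivative
      (N * s powr (N - 1)) * bessel_clifford (N + 1) s + (- bessel_clifford (N + 1 + 1) s) * s powr N) (at s)"
    using assms by (intro DERIV_mult bessel_clifford_has_derivative has_real_derivative_powr) auto
  moreover have "s powr N = s * s powr (N - 1)"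
    using assms powr_mult_base[of s "N - 1"] by simp
  moreover have "(N * s powr (N - 1)) * bessel_clifford (N + 1) s + (- bessel_clifford (N + 1 + 1) s) * s powr N
      = s powr (N - 1) * (N * bessel_clifford (N + 1) s - s * bessel_clifford (N + 2) s)"
    using calculation(2) by (simp add: algebra_simps)
  ultimately show ?thesis
    using bessel_clifford_recurrence[OF assms(1), of s] by simp
qed

text \<open>
\<open>s\<^sup>N C\<^sub>N\<^sub>+\<^sub>1(s)\<close> vanishes at \<open>0\<close> and has derivative \<open>s\<^sup>N\<^sup>-\<^sup>1 C\<^sub>N(s)\<close>, so it increases as long as \<open>C\<^sub>N > 0\<close>. In
particular the first zeros of \<open>C\<^sub>N\<close> and \<open>C\<^sub>N\<^sub>+\<^sub>1\<close> are ordered.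
\<close>

lemma bessel_clifford_succ_pos:
  assumes N: "N > 0" and s: "s > 0" and pos: "\<And>t. 0 < t \<Longrightarrow> t < s \<Longrightarrow> bessel_clifford N t > 0"
  shows "bessel_clifford (N + 1) s > 0"
proof -
  let ?f = "\<lambda>s. s powr N * bessel_clifford (N + 1) s"
  have "?f 0 < ?f s"
  proof (rule DERIV_pos_imp_increasing_open[OF s])
    fix t assume "0 < t" "t < s"
    then show "\<exists>y. (?f has_real_derivative y) (at t) \<and> 0 < y"
      using bessel_clifford_weighted_derivative[OF N, of t] pos[of t] by (intro exI[of _ "t powr (N - 1) * bessel_clifford N t"]) auto
  next
    show "continuous_on {0..s} ?f"
      using N by (intro continuous_on_mult bessel_clifford_continuous continuous_on_powr') (auto intro: continuous_intros)
  qed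
  then show ?thesis using N s by (simp add: zero_less_mult_iff)
qed

text \<open>
Suppose \<open>C\<^sub>N > 0\<close> throughout. Then the quotient \<open>q = C\<^sub>N/C\<^sub>N\<^sub>+\<^sub>1\<close> takes values in \<open>(0, N]\<close> and satisfies the Riccati
equation \<open>q' = -1 + q (N - q)/s\<close>, whose right side is at most \<open>-1/2\<close> once \<open>s \<ge> N\<^sup>2/2\<close>. So \<open>q\<close> would become
negative.
\<close>

lemma bessel_clifford_has_zero:
  assumes N: "N > 0"
  shows "\<exists>s>0. bessel_clifford N s \<le> 0"
proof (rule ccontr)
  assume "\<not> ?thesis"
  then have pos: "bessel_clifford N t > 0" if "t > 0" for t using that by force
  have pos1: "bessel_clifford (N + 1) t > 0" if "t > 0" for t
    using bessel_clifford_succ_pos[OF N that] pos by auto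
  have pos2: "bessel_clifford (N + 2) t > 0" if "t > 0" for t
    using bessel_clifford_succ_pos[of "N + 1" t] pos1 N that by (simp add: add.assoc)
  let ?q = "\<lambda>t. bessel_clifford N t / bessel_clifford (N + 1) t"
  have bound: "?q t \<le> N" if "t > 0" for t
  proof -
    have "t * bessel_clifford (N + 2) t \<ge> 0" using that pos2[OF that] by simp
    then have "bessel_clifford N t \<le> N * bessel_clifford (N + 1) t" using bessel_clifford_recurrence[OF N, of t] by simp
    then show ?thesis using pos1[OF that] by (simp add: pos_divide_le_eq)
  qed
  define a where "a = N\<^sup>2 / 2"
  define b where "b = a + 2 * N + 1"
  have ab: "a < b" "a > 0" using N by (auto simp: a_def b_def)
  have "?q b + b / 2 \<le> ?q a + a / 2"
  proof (rule DERIV_nonpos_imp_nonincreasing[OF less_imp_le[OF ab(1)]])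
    fix t assume t: "a \<le> t" "t \<le> b"
    then have t0: "t > 0" using ab by simp
    let ?D = "(- bessel_clifford (N + 1) t * bessel_clifford (N + 1) t - bessel_clifford N t * (- bessel_clifford (N + 1 + 1) t)) / (bessel_clifford (N + 1) t * bessel_clifford (N + 1) t) + 1 / 2"
    have "((\<lambda>t. ?q t + t / 2) has_real_derivative ?D) (at t)"
      using pos1[OF t0] N
      by (intro DERIV_add DERIV_divide bessel_clifford_has_derivative) (auto intro!: derivative_eq_intros)
    moreover have "?D \<le> 0"
    proof -
      let ?x = "bessel_clifford N t" and ?y = "bessel_clifford (N + 1) t"
      have z: "t * bessel_clifford (N + 2) t = N * ?y - ?x" using bessel_clifford_recurrence[OF N, of t] by simp
      have "?x * (N * ?y - ?x) \<le> N\<^sup>2 * ?y\<^sup>2 / 4"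
      proof -
        have "0 \<le> (N * ?y / 2 - ?x)\<^sup>2" by simp
        then show ?thesis by (simp add: power2_eq_square algebra_simps)
      qed
      also have "\<dots> = N\<^sup>2 / 4 * ?y\<^sup>2" by simp
      also have "\<dots> \<le> t / 2 * ?y\<^sup>2" using t unfolding a_def by (intro mult_right_mono) auto
      finally have "?x * (t * bessel_clifford (N + 2) t) \<le> t / 2 * ?y\<^sup>2" unfolding z .
      then have "t * (?x * bessel_clifford (N + 2) t) \<le> t * (?y\<^sup>2 / 2)" by (simp add: mult.left_commute)
      then have "?x * bessel_clifford (N + 2) t \<le> ?y\<^sup>2 / 2" using t0 by simp
      then show ?thesis using pos1[OF t0]
        by (simp add: divide_simps power2_eq_square add.assoc)
    qed
    ultimately show "\<exists>y. ((\<lambda>t. ?q t + t / 2) has_real_derivative y) (at t) \<and> y \<le> 0" by blast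
  qed
  moreover have "b / 2 = a / 2 + N + 1 / 2" by (simp add: b_def add_divide_distrib)
  ultimately have "?q b \<le> ?q a - N - 1/2" by linarith
  also have "\<dots> < 0" using bound[OF ab(2)] by linarith
  finally have "?q b < 0" .
  moreover have "?q b > 0" using pos[of b] pos1[of b] ab by simp
  ultimately show False by simp
qed

lemma bessel_clifford_first_zero:
  assumes N: "N > 0"
  obtains s where "s > 0" "bessel_clifford N s = 0" "\<And>t. 0 \<le> t \<Longrightarrow> t < s \<Longrightarrow> bessel_clifford N t > 0"
proof -
  obtain b where b: "b > 0" "bessel_clifford N b \<le> 0" using bessel_clifford_has_zero[OF N] by auto
  let ?Z = "{t \<in> {0..b}. bessel_clifford N t = 0}"
  have c0: "bessel_clifford N 0 > 0" using N by (simp add: bessel_clifford_0)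
  have "\<exists>t. 0 \<le> t \<and> t \<le> b \<and> bessel_clifford N t = 0"
    using b c0 bessel_clifford_continuous[OF N] by (intro IVT2') auto
  then have ne: "?Z \<noteq> {}" by auto
  have "closed ?Z"
    using continuous_closed_preimage_constant[OF bessel_clifford_continuous[OF N], of "{0..b}" 0] by simp
  then have "compact ?Z"
    using bounded_subset[OF bounded_closed_interval[of 0 b], of ?Z] by (auto simp: compact_eq_bounded_closed subset_iff)
  then obtain s where s: "s \<in> ?Z" "\<And>t. t \<in> ?Z \<Longrightarrow> s \<le> t"
    using compact_attains_inf[OF _ ne] by blast
  have "s \<noteq> 0" using s(1) c0 by auto
  then have "s > 0" using s(1) by auto
  moreover have "bessel_clifford N t > 0" if t: "0 \<le> t" "t < s" for t
  proof (rule ccontr)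
    assume "\<not> ?thesis"
    then have "\<exists>u. 0 \<le> u \<and> u \<le> t \<and> bessel_clifford N u = 0"
      using t c0 bessel_clifford_continuous[OF N] by (intro IVT2') auto
    then show False using s t by force
  qed
  ultimately show ?thesis using that s(1) by auto
qed

text \<open>
The description in \<open>bessel_zero\<close> is meaningful only once a first zero is known to exist; afterwards everything about
\<open>j\<^sub>\<nu>\<^sub>,\<^sub>1\<close> is used in this form.
\<close>

lemma bessel_zero_first:
  assumes N: "N > 0"
  defines "j \<equiv> bessel_zero (N - 1) 1"
  shows "j > 0" and "bessel_clifford N ((j / 2)\<^sup>2) = 0"
    and "\<And>t. 0 \<le> t \<Longrightarrow> t < (j / 2)\<^sup>2 \<Longrightarrow> bessel_clifford N t > 0"
proof -
  obtain s where s: "s > 0" "bessel_clifford N s = 0" "\<And>t. 0 \<le> t \<Longrightarrow> t < s \<Longrightarrow> bessel_clifford N t > 0"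
    using bessel_clifford_first_zero[OF N] by blast
  define z where "z = 2 * sqrt s"
  have z: "z > 0" "(z / 2)\<^sup>2 = s" using s(1) by (auto simp: z_def)
  have zero: "bessel_J (N - 1) y = 0 \<longleftrightarrow> bessel_clifford N ((y / 2)\<^sup>2) = 0" if "y > 0" for y
    using bessel_J_eq_bessel_clifford[OF N that] that by simp
  have nz: "bessel_J (N - 1) y \<noteq> 0" if "0 < y" "y < z" for y
  proof -
    have "(y / 2)\<^sup>2 < (z / 2)\<^sup>2" using that by (intro power_strict_mono) auto
    then have "(y / 2)\<^sup>2 < s" using z by simp
    then show ?thesis using zero that s(3)[of "(y / 2)\<^sup>2"] by simp
  qed
  have "bessel_zero (N - 1) 1 = z"
    unfolding bessel_zero_def
  proof (rule the_equality)
    have "{y. 0 < y \<and> y \<le> z \<and> bessel_J (N - 1) y = 0} = {z}"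
      using nz zero z s(2) by force
    then show "z > 0 \<and> bessel_J (N - 1) z = 0 \<and> card {y. 0 < y \<and> y \<le> z \<and> bessel_J (N - 1) y = 0} = 1"
      using zero z s(2) by simp
  next
    fix w assume w: "w > 0 \<and> bessel_J (N - 1) w = 0 \<and> card {y. 0 < y \<and> y \<le> w \<and> bessel_J (N - 1) y = 0} = 1"
    then have "z \<le> w" using nz by force
    then have "{z, w} \<subseteq> {y. 0 < y \<and> y \<le> w \<and> bessel_J (N - 1) y = 0}" using w z zero s(2) by auto
    moreover obtain v where "{y. 0 < y \<and> y \<le> w \<and> bessel_J (N - 1) y = 0} = {v}"
      using w card_1_singletonE by blast
    ultimately show "w = z" by auto
  qed
  then have "j = z" by (simp add: j_def)
  then show "j > 0" "bessel_clifford N ((j / 2)\<^sup>2) = 0" "\<And>t. 0 \<le> t \<Longrightarrow> t < (j / 2)\<^sup>2 \<Longrightarrow> bessel_clifford N t > 0"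
    using s z by auto
qed

text \<open>
The bound \<open>j\<^sub>N\<^sub>-\<^sub>1\<^sub>,\<^sub>1\<^sup>2 \<ge> N (N + 4)\<close> by Sturm comparison with \<open>\<psi>(s) = (1 - s/\<sigma>) exp(-\<mu>s)\<close>. For
\<open>\<sigma> = N(N+4)/4\<close> and \<open>\<mu> = 2/(N+4)\<close> this function satisfies \<open>s\<psi>'' + N\<psi>' + \<psi> \<le> 0\<close> on \<open>[0, \<sigma>]\<close>, and the
Wronskian of \<open>\<psi>\<close> and \<open>C\<^sub>N\<close> excludes a zero of \<open>C\<^sub>N\<close> before \<open>\<sigma>\<close>. It makes the radius \<open>\<alpha>/\<tau>\<close> large compared with
the mesh of the lattice.
\<close>

lemma bessel_zero_lower_bound:
  assumes N: "N > 0"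
  shows "sqrt (N * (N + 4)) \<le> bessel_zero (N - 1) 1"
proof (rule ccontr)
  assume "\<not> ?thesis"
  define j where "j = bessel_zero (N - 1) 1"
  define s where "s = (j / 2)\<^sup>2"
  \<comment> \<open>For these values \<open>t\<psi>'' + N\<psi>' + \<psi>\<close> has the factor \<open>1 - t/\<sigma>\<close>, and the other factor is linear in \<open>t\<close> with zero \<open>\<sigma>\<close>.\<close>
  define \<sigma> where "\<sigma> = N * (N + 4) / 4"
  define \<mu> where "\<mu> = 2 / (N + 4)"
  note z = bessel_zero_first[OF N, folded j_def, folded s_def]
  have "j < sqrt (N * (N + 4))" using \<open>\<not> _\<close> by (simp add: j_def)
  then have "j\<^sup>2 < (sqrt (N * (N + 4)))\<^sup>2" using z(1) by (intro power_strict_mono) auto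
  then have "j\<^sup>2 < N * (N + 4)" using N by simp
  then have s\<sigma>: "s < \<sigma>" by (simp add: s_def \<sigma>_def power_divide)
  have s0: "s > 0" using z(1) by (simp add: s_def)
  have \<sigma>0: "\<sigma> > 0" using N by (simp add: \<sigma>_def)
  define \<psi> where "\<psi> t = (1 - t / \<sigma>) * exp (- \<mu> * t)" for t
  define \<psi>1 where "\<psi>1 t = (- 1 / \<sigma> - \<mu> * (1 - t / \<sigma>)) * exp (- \<mu> * t)" for t
  define \<psi>2 where "\<psi>2 t = (2 * \<mu> / \<sigma> + \<mu>\<^sup>2 * (1 - t / \<sigma>)) * exp (- \<mu> * t)" for t
  have d1: "(\<psi> has_real_derivative \<psi>1 t) (at t)" for t
    unfolding \<psi>_def \<psi>1_def using \<sigma>0 by (auto intro!: derivative_eq_intros simp: field_simps)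
  have d2: "(\<psi>1 has_real_derivative \<psi>2 t) (at t)" for t
    unfolding \<psi>1_def \<psi>2_def using \<sigma>0
    by (auto intro!: derivative_eq_intros simp: field_simps power2_eq_square)
  have L: "t * \<psi>2 t + N * \<psi>1 t + \<psi> t \<le> 0" if t: "0 < t" "t < s" for t
  proof -
    have e1: "2 * \<mu> * \<sigma> = N" using N by (simp add: \<mu>_def \<sigma>_def field_simps)
    have "t * \<psi>2 t + N * \<psi>1 t + \<psi> t
        = ((1 - t / \<sigma>) * (t * \<mu>\<^sup>2 - N * \<mu> + 1) + (2 * \<mu> * t - N) / \<sigma>) * exp (- \<mu> * t)"
      using \<sigma>0 by (simp add: \<psi>_def \<psi>1_def \<psi>2_def field_simps)
    also have "(2 * \<mu> * t - N) / \<sigma> = - (1 - t / \<sigma>) * (N / \<sigma>)"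
      using \<sigma>0 by (simp add: e1[symmetric] field_simps)
    finally have eq: "t * \<psi>2 t + N * \<psi>1 t + \<psi> t
        = (1 - t / \<sigma>) * (t * \<mu>\<^sup>2 - N * \<mu> + 1 - N / \<sigma>) * exp (- \<mu> * t)" by (simp add: algebra_simps)
    have "\<sigma> * \<mu>\<^sup>2 - N * \<mu> + 1 - N / \<sigma> = 0"
      using N by (simp add: \<mu>_def \<sigma>_def divide_simps power2_eq_square)
    moreover have "t * \<mu>\<^sup>2 \<le> \<sigma> * \<mu>\<^sup>2" using t s\<sigma> by (intro mult_right_mono) auto
    ultimately have "t * \<mu>\<^sup>2 - N * \<mu> + 1 - N / \<sigma> \<le> 0" by simp
    moreover have "0 \<le> 1 - t / \<sigma>" using t s\<sigma> \<sigma>0 by simp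
    ultimately show ?thesis unfolding eq
      by (intro mult_nonpos_nonneg mult_nonneg_nonpos) auto
  qed
  let ?W = "\<lambda>t. (t powr N * bessel_clifford (N + 1) t) * \<psi> t + t powr N * bessel_clifford N t * \<psi>1 t"
  have "?W s \<le> ?W 0"
  proof (rule DERIV_nonpos_imp_decreasing_open[OF less_imp_le[OF s0]])
    fix t assume t: "0 < t" "t < s"
    have tp: "t powr N = t * t powr (N - 1)"
      using t powr_mult_base[of t "N - 1"] by simp
    have dW: "(?W has_real_derivative
        ((t powr (N - 1) * bessel_clifford N t) * \<psi> t + \<psi>1 t * (t powr N * bessel_clifford (N + 1) t))
        + (((N * t powr (N - 1)) * bessel_clifford N t + (- bessel_clifford (N + 1) t) * t powr N) * \<psi>1 t + \<psi>2 t * (t powr N * bessel_clifford N t))) (at t)"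
      (is "(_ has_real_derivative ?D) _")
      by (intro DERIV_add DERIV_mult bessel_clifford_weighted_derivative[OF N t(1)] d1 d2 bessel_clifford_has_derivative[OF N] has_real_derivative_powr[OF t(1)])
    have "?D = t powr (N - 1) * bessel_clifford N t * (t * \<psi>2 t + N * \<psi>1 t + \<psi> t)"
      unfolding tp by (simp add: algebra_simps)
    also have "\<dots> \<le> 0" using z(3)[of t] t L[OF t] by (intro mult_nonneg_nonpos) auto
    finally show "\<exists>y. (?W has_real_derivative y) (at t) \<and> y \<le> 0" using dW by blast
  next
    have "continuous_on {0..s} \<psi>"
      by (rule DERIV_continuous_on[OF has_field_derivative_at_within[OF d1]])
    moreover have "continuous_on {0..s} \<psi>1"
      by (rule DERIV_continuous_on[OF has_field_derivative_at_within[OF d2]])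
    ultimately show "continuous_on {0..s} ?W"
      using N by (intro continuous_on_add continuous_on_mult bessel_clifford_continuous continuous_on_powr') (auto intro: continuous_intros)
  qed
  then have "s powr N * bessel_clifford (N + 1) s * \<psi> s \<le> 0" using N z(2) by simp
  moreover have "bessel_clifford (N + 1) s > 0" using bessel_clifford_succ_pos[OF N s0] z(3) by auto
  moreover have "\<psi> s > 0" using s\<sigma> \<sigma>0 by (simp add: \<psi>_def)
  ultimately show False using s0 by (simp add: mult_le_0_iff)
qed

text \<open>
\<open>C\<^sub>N\<close> decreases up to the first zero of \<open>C\<^sub>N\<^sub>+\<^sub>1 = -C\<^sub>N'\<close>. This is what makes the extremal bump function
nonnegative for all radii in question.
\<close>

lemma bessel_clifford_negative_past_first_zero:
  assumes N: "N > 0" and lo: "(bessel_zero (N - 1) 1 / 2)\<^sup>2 < s" and hi: "s \<le> (bessel_zero N 1 / 2)\<^sup>2"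
  shows "bessel_clifford N s < 0" and "\<And>t. 0 \<le> t \<Longrightarrow> t \<le> s \<Longrightarrow> bessel_clifford N s \<le> bessel_clifford N t"
proof -
  note z0 = bessel_zero_first[OF N]
  note z1 = bessel_zero_first[of "N + 1", simplified]
  have dec: "bessel_clifford N b < bessel_clifford N a" if "0 \<le> a" "a < b" "b \<le> s" for a b
  proof (rule DERIV_neg_imp_decreasing_open[OF that(2)])
    fix t assume "a < t" "t < b"
    then show "\<exists>y. (bessel_clifford N has_real_derivative y) (at t) \<and> y < 0"
      using bessel_clifford_has_derivative[OF N, of t] z1(3)[of t] N hi that
      by (intro exI[of _ "- bessel_clifford (N + 1) t"]) auto
  qed (rule bessel_clifford_continuous[OF N])
  show "bessel_clifford N s < 0" using dec[of "(bessel_zero (N - 1) 1 / 2)\<^sup>2" s] lo z0(2) by simp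
  show "bessel_clifford N s \<le> bessel_clifford N t" if "0 \<le> t" "t \<le> s" for t
    using dec[of t s] that by (cases "t = s") auto
qed

lemma bessel_zero_less_succ:
  assumes N: "N > 0"
  shows "(bessel_zero (N - 1) 1 / 2)\<^sup>2 < (bessel_zero N 1 / 2)\<^sup>2"
proof (rule ccontr)
  note z0 = bessel_zero_first[OF N]
  note z1 = bessel_zero_first[of "N + 1", simplified]
  let ?s = "(bessel_zero N 1 / 2)\<^sup>2"
  assume "\<not> ?thesis"
  then have "bessel_clifford N t > 0" if "0 < t" "t < ?s" for t using z0(3)[of t] that by simp
  then have "bessel_clifford (N + 1) ?s > 0" using bessel_clifford_succ_pos[OF N, of ?s] z1(1) N by simp
  then show False using z1(2) N by simp
qed

section \<open>Integration by parts on balls\<close>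

lemma has_derivative_imp_difference_quotient:
  fixes f :: "'a::real_normed_vector \<Rightarrow> 'b::real_normed_vector"
  assumes "(f has_derivative f') (at x)" and h: "h \<longlonglongrightarrow> 0" "\<And>n. h n \<noteq> 0"
  shows "(\<lambda>n. (1 / h n) *\<^sub>R (f (x + h n *\<^sub>R v) - f x)) \<longlonglongrightarrow> f' v"
proof -
  have l: "linear f'" using assms(1) has_derivative_linear by blast
  have "((\<lambda>t. x + t *\<^sub>R v) has_derivative (\<lambda>t. t *\<^sub>R v)) (at 0)"
    by (auto intro!: derivative_eq_intros)
  moreover have "(f has_derivative f') (at (x + 0 *\<^sub>R v))" using assms(1) by simp
  ultimately have "((\<lambda>t. f (x + t *\<^sub>R v)) has_derivative (\<lambda>t. f' (t *\<^sub>R v))) (at 0)"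
    by (rule has_derivative_compose)
  then have "((\<lambda>t. f (x + t *\<^sub>R v)) has_vector_derivative f' v) (at 0)"
    using linear_scale[OF l] by (simp add: has_vector_derivative_def)
  then have "((\<lambda>t. (1 / t) *\<^sub>R (f (x + t *\<^sub>R v) - f x)) \<longlongrightarrow> f' v) (at 0)"
  proof -
    assume "((\<lambda>t. f (x + t *\<^sub>R v)) has_vector_derivative f' v) (at 0)"
    then have lim: "((\<lambda>t. norm (f (x + t *\<^sub>R v) - f x - t *\<^sub>R f' v) / norm t) \<longlongrightarrow> 0) (at 0)"
      by (simp add: has_vector_derivative_def has_derivative_at)
    have "\<forall>\<^sub>F t in at 0. norm (f (x + t *\<^sub>R v) - f x - t *\<^sub>R f' v) / norm t
        = norm ((1 / t) *\<^sub>R (f (x + t *\<^sub>R v) - f x) - f' v)"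
      unfolding eventually_at_filter
    proof (rule always_eventually, intro allI impI)
      fix t :: real assume "t \<noteq> 0"
      then have "(1 / t) *\<^sub>R (f (x + t *\<^sub>R v) - f x) - f' v = (1 / t) *\<^sub>R (f (x + t *\<^sub>R v) - f x - t *\<^sub>R f' v)"
        by (simp add: scaleR_diff_right)
      then show "norm (f (x + t *\<^sub>R v) - f x - t *\<^sub>R f' v) / norm t
        = norm ((1 / t) *\<^sub>R (f (x + t *\<^sub>R v) - f x) - f' v)" by simp
    qed
    from tendsto_cong[OF this] lim
    have "((\<lambda>t. norm ((1 / t) *\<^sub>R (f (x + t *\<^sub>R v) - f x) - f' v)) \<longlongrightarrow> 0) (at 0)" by blast
    then show ?thesis by (simp add: LIM_zero_iff tendsto_norm_zero_iff)
  qed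
  moreover have "filterlim h (at 0) sequentially"
    using h by (simp add: filterlim_at)
  ultimately show ?thesis by (rule filterlim_compose)
qed

text \<open>
A segment that leaves the ball crosses the sphere, where the function vanishes.
\<close>

lemma lipschitz_extension_by_zero:
  fixes f :: "'a::real_inner \<Rightarrow> 'b::real_normed_vector"
  assumes lip: "\<And>x y. norm x \<le> \<rho> \<Longrightarrow> norm y \<le> \<rho> \<Longrightarrow> norm (f x - f y) \<le> L * norm (x - y)"
    and bd: "\<And>x. norm x = \<rho> \<Longrightarrow> f x = 0" and L: "L \<ge> 0"
  defines "g \<equiv> \<lambda>x. if norm x \<le> \<rho> then f x else 0"
  shows "norm (g x - g y) \<le> L * norm (x - y)"
proof -
  have *: "norm (f x) \<le> L * norm (x - y)" if x: "norm x \<le> \<rho>" and y: "norm y > \<rho>" for x y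
  proof -
    have "\<exists>t\<ge>0. t \<le> 1 \<and> norm (x + t *\<^sub>R (y - x)) = \<rho>"
      using x y by (intro IVT') (auto intro!: continuous_intros)
    then obtain t where t: "0 \<le> t" "t \<le> 1" "norm (x + t *\<^sub>R (y - x)) = \<rho>" by blast
    have "norm (f x) = norm (f x - f (x + t *\<^sub>R (y - x)))" using bd[OF t(3)] by simp
    also have "\<dots> \<le> L * norm (x - (x + t *\<^sub>R (y - x)))" using x t by (intro lip) auto
    also have "\<dots> = L * (t * norm (x - y))" using t by (simp add: norm_minus_commute)
    also have "\<dots> \<le> L * norm (x - y)" using t L by (intro mult_left_mono mult_left_le_one_le) auto
    finally show ?thesis .
  qed
  show ?thesis
    using lip[of x y] *[of x y] *[of y x] L by (auto simp: g_def norm_minus_commute)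
qed

lemma integral_shift:
  fixes f :: "'a::euclidean_space \<Rightarrow> 'b::{banach, second_countable_topology}"
  assumes [measurable]: "f \<in> borel_measurable borel"
  shows "(\<integral>x. f (x + a) \<partial>lborel) = (\<integral>x. f x \<partial>lborel)"
proof -
  have "(\<integral>x. f x \<partial>lborel) = (\<integral>x. f x \<partial>(distr lborel borel ((+) a)))"
    by (simp add: lborel_distr_plus)
  also have "\<dots> = (\<integral>x. f (a + x) \<partial>lborel)" by (rule integral_distr) auto
  finally show ?thesis by (simp add: add.commute)
qed

lemma integrable_shift:
  fixes f :: "'a::euclidean_space \<Rightarrow> 'b::{banach, second_countable_topology}"
  assumes "integrable lborel f"
  shows "integrable lborel (\<lambda>x. f (x + a))"
proof -
  have "f \<in> borel_measurable borel" using borel_measurable_integrable[OF assms] by simp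
  moreover have "integrable (distr lborel borel ((+) a)) f" using assms by (simp add: lborel_distr_plus)
  ultimately show ?thesis by (subst (asm) integrable_distr_eq) (auto simp: add.commute)
qed

text \<open>
The divergence theorem in the only case needed, that of vanishing boundary values. The extension \<open>g\<close> by zero is
Lipschitz, translation invariance gives \<open>\<integral> (g(x + hv) - g(x))/h = 0\<close>, and the difference quotients converge
boundedly off the sphere.
\<close>

lemma integral_ball_directional_derivative:
  fixes f :: "'a::euclidean_space \<Rightarrow> 'b::{banach, second_countable_topology}"
  assumes der: "\<And>x. (f has_derivative f' x) (at x)"
    and cont: "continuous_on UNIV (\<lambda>x. f' x v)"
    and lip: "\<And>x y. norm x \<le> \<rho> \<Longrightarrow> norm y \<le> \<rho> \<Longrightarrow> norm (f x - f y) \<le> L * norm (x - y)"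
    and bd: "\<And>x. norm x = \<rho> \<Longrightarrow> f x = 0"
  shows "(\<integral>x. indicator (cball 0 \<rho>) x *\<^sub>R f' x v \<partial>lborel) = 0"
proof -
  define M where "M = max L 0"
  define g where "g x = (if norm x \<le> \<rho> then f x else 0)" for x
  define h where "h = (\<lambda>n. 1 / real (Suc n))"
  have h: "h \<longlonglongrightarrow> 0" "\<And>n. h n \<noteq> 0" "\<And>n. 0 < h n" "\<And>n. h n \<le> 1"
    using LIMSEQ_inverse_real_of_nat by (auto simp: h_def inverse_eq_divide)
  have M0: "0 \<le> M" by (simp add: M_def)
  have lipM: "norm (f x - f y) \<le> M * norm (x - y)" if "norm x \<le> \<rho>" "norm y \<le> \<rho>" for x y
    using lip[OF that] by (smt (verit) M_def mult_right_mono norm_ge_zero)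
  have lipg: "norm (g x - g y) \<le> M * norm (x - y)" for x y
    unfolding g_def by (rule lipschitz_extension_by_zero[OF lipM bd]) (auto simp: M_def)
  have contf: "continuous_on UNIV f"
    using der by (meson has_derivative_continuous continuous_at_imp_continuous_on)
  have contg: "continuous_on UNIV g"
    using lipg M0 by (intro lipschitz_on_continuous_on[of M] lipschitz_onI) (auto simp: dist_norm)
  have [measurable]: "f \<in> borel_measurable borel" "g \<in> borel_measurable borel"
      "(\<lambda>x. f' x v) \<in> borel_measurable borel"
    using contf contg cont by (auto intro: borel_measurable_continuous_onI)
  let ?q = "\<lambda>n x. (1 / h n) *\<^sub>R (g (x + h n *\<^sub>R v) - g x)"
  let ?r = "\<rho> + norm v"
  have intg: "integrable lborel g"
  proof (rule integrableI_bounded_set[where A="cball 0 \<rho>" and B="M * (2 * \<bar>\<rho>\<bar>)"])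
    have "norm (g x) \<le> M * (2 * \<bar>\<rho>\<bar>)" if "norm x \<le> \<rho>" for x
    proof -
      \<comment> \<open>The point \<open>\<rho> b\<close> of the sphere is a zero of \<open>g\<close>, so the Lipschitz constant bounds \<open>g\<close> on the ball.\<close>
      obtain b :: 'a where "b \<in> Basis" by fastforce
      then have "norm (\<rho> *\<^sub>R b) = \<rho>" using that by (simp add: abs_of_nonneg[OF order_trans[OF norm_ge_zero]])
      then have "g (\<rho> *\<^sub>R b) = 0" by (simp add: g_def bd)
      then have "norm (g x) \<le> M * norm (x - \<rho> *\<^sub>R b)" using lipg[of x "\<rho> *\<^sub>R b"] by simp
      also have "\<dots> \<le> M * (2 * \<bar>\<rho>\<bar>)"
        using norm_triangle_ineq4[of x "\<rho> *\<^sub>R b"] that \<open>norm (\<rho> *\<^sub>R b) = \<rho>\<close>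
        by (intro mult_left_mono) (auto simp: M_def)
      finally show ?thesis .
    qed
    then show "AE x in lborel. x \<in> cball 0 \<rho> \<longrightarrow> norm (g x) \<le> M * (2 * \<bar>\<rho>\<bar>)" by simp
    show "AE x in lborel. x \<notin> cball 0 \<rho> \<longrightarrow> g x = 0" by (simp add: g_def)
  qed (use emeasure_bounded_finite[OF bounded_cball, of 0 \<rho>] in auto)
  have intg': "integrable lborel (\<lambda>x. g (x + a))" for a using intg by (rule integrable_shift)
  have zero: "(\<integral>x. ?q n x \<partial>lborel) = 0" for n
    using intg intg'[of "h n *\<^sub>R v"] integral_shift[of g "h n *\<^sub>R v"] by simp
  have "(\<lambda>n. \<integral>x. ?q n x \<partial>lborel) \<longlonglongrightarrow> (\<integral>x. indicator (cball 0 \<rho>) x *\<^sub>R f' x v \<partial>lborel)"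
  proof (rule integral_dominated_convergence[where w="\<lambda>x. indicator (cball 0 ?r) x * (M * norm v)"])
    show "integrable lborel (\<lambda>x. indicator (cball 0 ?r) x * (M * norm v))"
      using emeasure_bounded_finite[OF bounded_cball, of 0 ?r]
      by (intro integrable_mult_left integrable_real_indicator) auto
    have "{x::'a. norm x = \<rho>} \<in> null_sets lborel"
    proof -
      have "negligible (sphere (0::'a) \<rho>)" by (rule negligible_sphere)
      then have "sphere (0::'a) \<rho> \<in> null_sets lebesgue" by (simp add: negligible_iff_null_sets)
      then show ?thesis by (simp add: null_sets_completion_iff sphere_def dist_norm)
    qed
    then have "AE x in lborel. norm (x::'a) \<noteq> \<rho>" using AE_not_in by fastforce
    then show "AE x in lborel. (\<lambda>n. ?q n x) \<longlonglongrightarrow> indicator (cball 0 \<rho>) x *\<^sub>R f' x v"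
    proof eventually_elim
      case (elim x)
      have lim: "(\<lambda>n. x + h n *\<^sub>R v) \<longlonglongrightarrow> x"
        using tendsto_add[OF tendsto_const tendsto_scaleR[OF h(1) tendsto_const]] by simp
      show ?case
      proof (cases "norm x < \<rho>")
        case True
        have "eventually (\<lambda>n. x + h n *\<^sub>R v \<in> ball 0 \<rho>) sequentially"
          using lim True by (intro topological_tendstoD) auto
        then have ev: "eventually (\<lambda>n. ?q n x = (1 / h n) *\<^sub>R (f (x + h n *\<^sub>R v) - f x)) sequentially"
          by eventually_elim (use True in \<open>auto simp: g_def\<close>)
        have "(\<lambda>n. (1 / h n) *\<^sub>R (f (x + h n *\<^sub>R v) - f x)) \<longlonglongrightarrow> f' x v"
          by (rule has_derivative_imp_difference_quotient[OF der h(1,2)])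
        with tendsto_cong[OF ev] have "(\<lambda>n. ?q n x) \<longlonglongrightarrow> f' x v" by blast
        then show ?thesis using True by simp
      next
        case False
        then have "x \<in> - cball 0 \<rho>" using elim by simp
        then have "eventually (\<lambda>n. x + h n *\<^sub>R v \<in> - cball 0 \<rho>) sequentially"
          using lim by (intro topological_tendstoD) auto
        then have "eventually (\<lambda>n. ?q n x = 0) sequentially"
          by eventually_elim (use False elim in \<open>auto simp: g_def\<close>)
        then have "(\<lambda>n. ?q n x) \<longlonglongrightarrow> 0" by (rule tendsto_eventually)
        then show ?thesis using False elim by simp
      qed
    qed
    show "AE x in lborel. norm (?q n x) \<le> indicator (cball 0 ?r) x * (M * norm v)" for n
    proof (rule AE_I2)
      fix x
      have "norm (?q n x) = (1 / h n) * norm (g (x + h n *\<^sub>R v) - g x)" using h(3)[of n] by simp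
      also have "\<dots> \<le> (1 / h n) * (M * norm (h n *\<^sub>R v))"
        using lipg[of "x + h n *\<^sub>R v" x] h(3)[of n] by (intro mult_left_mono) auto
      also have "\<dots> = M * norm v" using h(3)[of n] by simp
      finally have b: "norm (?q n x) \<le> M * norm v" .
      show "norm (?q n x) \<le> indicator (cball 0 ?r) x * (M * norm v)"
      proof (cases "norm x \<le> ?r")
        case True then show ?thesis using b by simp
      next
        case False
        have "norm x \<le> norm (x + h n *\<^sub>R v) + norm (h n *\<^sub>R v)"
          using norm_triangle_ineq4[of "x + h n *\<^sub>R v" "h n *\<^sub>R v"] by simp
        moreover have "norm (h n *\<^sub>R v) \<le> norm v" using h(3,4)[of n] by (simp add: mult_left_le_one_le)
        ultimately have "norm (x + h n *\<^sub>R v) > \<rho>" "norm x > \<rho>"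
          using False norm_ge_zero[of v] by linarith+
        then show ?thesis using False by (simp add: g_def)
      qed
    qed
  qed (auto intro!: borel_measurable_scaleR borel_measurable_indicator)
  then show ?thesis unfolding zero by (simp add: LIMSEQ_const_iff)
qed

lemma lipschitz_on_cball_if_C1:
  fixes f :: "'a::euclidean_space \<Rightarrow> 'b::{banach, second_countable_topology}"
  assumes der: "\<And>x. (f has_derivative f' x) (at x)"
    and cont: "\<And>v. continuous_on UNIV (\<lambda>x. f' x v)"
  shows "\<exists>L\<ge>0. \<forall>x y. norm x \<le> \<rho> \<longrightarrow> norm y \<le> \<rho> \<longrightarrow> norm (f x - f y) \<le> L * norm (x - y)"
proof -
  have "continuous_on (cball 0 \<rho>) (\<lambda>x. \<Sum>b\<in>Basis. norm (f' x b))"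
    using cont by (intro continuous_on_sum continuous_on_norm) (auto intro: continuous_on_subset)
  then have "bounded ((\<lambda>x. \<Sum>b\<in>Basis. norm (f' x b)) ` cball 0 \<rho>)"
    by (intro compact_imp_bounded compact_continuous_image) auto
  then obtain L where L: "\<And>x. x \<in> cball 0 \<rho> \<Longrightarrow> (\<Sum>b\<in>Basis. norm (f' x b)) \<le> L"
  proof -
    from \<open>bounded _\<close> obtain L where "\<forall>y\<in>(\<lambda>x. \<Sum>b\<in>Basis. norm (f' x b)) ` cball 0 \<rho>. norm y \<le> L"
      unfolding bounded_iff by blast
    then have "(\<Sum>b\<in>Basis. norm (f' x b)) \<le> L" if "x \<in> cball 0 \<rho>" for x
      using that abs_ge_self order_trans by (fastforce simp: real_norm_def)
    then show ?thesis using that by blast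
  qed
  have "norm (f x - f y) \<le> \<bar>L\<bar> * norm (x - y)" if "norm x \<le> \<rho>" "norm y \<le> \<rho>" for x y
  proof (rule differentiable_bound[where S="cball 0 \<rho>" and f'=f'])
    fix z assume z: "z \<in> cball (0::'a) \<rho>"
    show "(f has_derivative f' z) (at z within cball 0 \<rho>)" using der by (rule has_derivative_at_withinI)
    have l: "linear (f' z)" using der has_derivative_linear by blast
    have "onorm (f' z) \<le> L"
    proof (rule onorm_le)
      fix h
      have "f' z h = f' z (\<Sum>b\<in>Basis. (h \<bullet> b) *\<^sub>R b)" by (simp add: euclidean_representation)
      also have "\<dots> = (\<Sum>b\<in>Basis. (h \<bullet> b) *\<^sub>R f' z b)"
        using l by (simp add: linear_sum linear_scale)
      finally have "norm (f' z h) \<le> (\<Sum>b\<in>Basis. norm ((h \<bullet> b) *\<^sub>R f' z b))"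
        using norm_sum by metis
      also have "\<dots> \<le> (\<Sum>b\<in>Basis. norm h * norm (f' z b))"
        by (intro sum_mono) (simp add: Basis_le_norm mult_right_mono)
      also have "\<dots> = norm h * (\<Sum>b\<in>Basis. norm (f' z b))" by (simp add: sum_distrib_left)
      also have "\<dots> \<le> norm h * L" using L[OF z] by (intro mult_left_mono) auto
      also have "\<dots> = L * norm h" by simp
      finally show "norm (f' z h) \<le> L * norm h" .
    qed
    then show "onorm (f' z) \<le> \<bar>L\<bar>" by simp
  qed (use that in auto)
  then show ?thesis by (intro exI[of _ "\<bar>L\<bar>"]) auto
qed

lemma integral_ball_divergence_zero:
  fixes f :: "'a::euclidean_space \<Rightarrow> 'b::{banach, second_countable_topology}"
  assumes der: "\<And>x. (f has_derivative f' x) (at x)"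
    and cont: "\<And>v. continuous_on UNIV (\<lambda>x. f' x v)"
    and bd: "\<And>x. norm x = \<rho> \<Longrightarrow> f x = 0"
  shows "(\<integral>x. indicator (cball 0 \<rho>) x *\<^sub>R f' x v \<partial>lborel) = 0"
proof -
  obtain L where "\<And>x y. norm x \<le> \<rho> \<Longrightarrow> norm y \<le> \<rho> \<Longrightarrow> norm (f x - f y) \<le> L * norm (x - y)"
    using lipschitz_on_cball_if_C1[OF der cont] by blast
  then show ?thesis by (intro integral_ball_directional_derivative[OF der cont _ bd]) auto
qed

lemma integrable_ball_continuous:
  fixes f :: "'a::euclidean_space \<Rightarrow> 'b::{banach, second_countable_topology}"
  assumes "continuous_on UNIV f"
  shows "integrable lborel (\<lambda>x. indicator (cball 0 \<rho>) x *\<^sub>R f x)"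
  using borel_integrable_compact[OF compact_cball continuous_on_subset[OF assms]]
  by (simp add: set_integrable_def)

text \<open>
Both moments come from the derivative of \<open>(\<rho>\<^sup>2 - |x|\<^sup>2) (x\<bullet>v)\<close> in direction \<open>v\<close>: its integral vanishes, which relates
the two integrals, and summation over an orthonormal basis gives a second relation.
\<close>

lemma
  fixes v :: "'a::euclidean_space"
  assumes "\<rho> \<ge> 0"
  defines "V \<equiv> measure lborel (cball (0::'a) \<rho>)" and "D \<equiv> real DIM('a) + 2"
  shows integral_ball_paraboloid:
      "(\<integral>x. indicator (cball (0::'a) \<rho>) x * (\<rho>\<^sup>2 - (norm x)\<^sup>2) \<partial>lborel) = 2 / D * \<rho>\<^sup>2 * V" (is "?J = _")
    and integral_ball_inner_squared:
      "(\<integral>x. indicator (cball 0 \<rho>) x * (x \<bullet> v)\<^sup>2 \<partial>lborel) = (norm v)\<^sup>2 * \<rho>\<^sup>2 / D * V"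
proof -
  let ?I = "\<lambda>v. \<integral>x. indicator (cball 0 \<rho>) x * (x \<bullet> v)\<^sup>2 \<partial>lborel"
  note int = integrable_ball_continuous[where 'b=real, simplified]
  have I: "2 * ?I v = (norm v)\<^sup>2 * ?J" for v :: 'a
  proof -
    let ?f' = "\<lambda>x h. (\<rho>\<^sup>2 - x \<bullet> x) * (h \<bullet> v) + - (x \<bullet> h + h \<bullet> x) * (x \<bullet> v)"
    have "(\<integral>x. indicator (cball 0 \<rho>) x *\<^sub>R ?f' x v \<partial>lborel) = 0"
    proof (rule integral_ball_divergence_zero[where f="\<lambda>x. (\<rho>\<^sup>2 - x \<bullet> x) * (x \<bullet> v)" and f'="?f'"])
      show "((\<lambda>x. (\<rho>\<^sup>2 - x \<bullet> x) * (x \<bullet> v)) has_derivative ?f' x) (at x)" for x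
        by (auto intro!: derivative_eq_intros simp: inner_commute)
    qed (auto intro!: continuous_intros simp: norm_eq_sqrt_inner)
    moreover have "indicator (cball 0 \<rho>) x *\<^sub>R ?f' x v
        = indicator (cball 0 \<rho>) x * (\<rho>\<^sup>2 - (norm x)\<^sup>2) * (norm v)\<^sup>2 - 2 * (indicator (cball 0 \<rho>) x * (x \<bullet> v)\<^sup>2)" for x
      unfolding power2_norm_eq_inner by (simp add: power2_eq_square inner_commute algebra_simps)
    moreover have "(\<integral>x. indicator (cball 0 \<rho>) x * (\<rho>\<^sup>2 - (norm x)\<^sup>2) * (norm v)\<^sup>2 - 2 * (indicator (cball 0 \<rho>) x * (x \<bullet> v)\<^sup>2) \<partial>lborel)
        = ?J * (norm v)\<^sup>2 - 2 * ?I v"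
    proof -
      have i1: "integrable lborel (\<lambda>x::'a. indicator (cball 0 \<rho>) x * (\<rho>\<^sup>2 - (norm x)\<^sup>2))"
        by (intro int continuous_intros)
      have i2: "integrable lborel (\<lambda>x. indicator (cball 0 \<rho>) x * (x \<bullet> v)\<^sup>2)"
        by (intro int continuous_intros)
      show ?thesis
        using Bochner_Integration.integral_diff[OF integrable_mult_left[OF i1, of "(norm v)\<^sup>2"] integrable_mult_right[OF i2, of 2]]
        by (simp only: integral_mult_left_zero integral_mult_right_zero)
    qed
    ultimately show ?thesis by (simp add: mult.commute)
  qed
  have "(\<Sum>b\<in>(Basis::'a set). ?I b) = (\<integral>x. indicator (cball (0::'a) \<rho>) x * (norm x)\<^sup>2 \<partial>lborel)"
  proof -
    have "(norm x)\<^sup>2 = (\<Sum>b\<in>Basis. (x \<bullet> b)\<^sup>2)" for x :: 'a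
      unfolding power2_norm_eq_inner euclidean_inner[of x x] by (simp add: power2_eq_square)
    then have "(\<lambda>x::'a. indicator (cball 0 \<rho>) x * (norm x)\<^sup>2) = (\<lambda>x. \<Sum>b\<in>Basis. indicator (cball 0 \<rho>) x * (x \<bullet> b)\<^sup>2)"
      by (simp only: sum_distrib_left)
    moreover have "integrable lborel (\<lambda>x. indicator (cball 0 \<rho>) x * (x \<bullet> b)\<^sup>2)" for b :: 'a
      by (intro int continuous_intros)
    ultimately show ?thesis by (simp only: Bochner_Integration.integral_sum)
  qed
  also have "\<dots> = \<rho>\<^sup>2 * V - ?J"
  proof -
    have "integrable lborel (\<lambda>x::'a. indicator (cball 0 \<rho>) x * \<rho>\<^sup>2)"
      "integrable lborel (\<lambda>x::'a. indicator (cball 0 \<rho>) x * (norm x)\<^sup>2)"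
      by (intro int continuous_intros)+
    then have "?J = (\<integral>x. indicator (cball (0::'a) \<rho>) x * \<rho>\<^sup>2 \<partial>lborel) - (\<integral>x. indicator (cball (0::'a) \<rho>) x * (norm x)\<^sup>2 \<partial>lborel)"
      by (simp only: Bochner_Integration.integral_diff[symmetric] right_diff_distrib)
    then show ?thesis using int[of "\<lambda>_::'a. 1" \<rho>] by (simp add: V_def)
  qed
  finally have "2 * (\<Sum>b\<in>(Basis::'a set). ?I b) = 2 * (\<rho>\<^sup>2 * V - ?J)" by simp
  moreover have "2 * (\<Sum>b\<in>(Basis::'a set). ?I b) = DIM('a) * ?J"
    using I by (simp add: sum_distrib_left)
  ultimately have "D * ?J = 2 * \<rho>\<^sup>2 * V" by (simp add: D_def algebra_simps)
  moreover have "D > 0" by (simp add: D_def add_nonneg_pos)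
  ultimately show J: "?J = 2 / D * \<rho>\<^sup>2 * V" by (simp add: field_simps)
  show "?I v = (norm v)\<^sup>2 * \<rho>\<^sup>2 / D * V" using I[of v] \<open>D > 0\<close> unfolding J by (simp add: field_simps)
qed

section \<open>The extremal bump function\<close>

text \<open>
The extremal function \<open>1 - \<phi>(|z|)/c\<close>, where \<open>\<phi>\<close> is the radial solution of \<open>\<Delta>\<phi> = -4b\<^sup>2\<phi>\<close> and \<open>c\<close> its value on the
boundary sphere. It solves \<open>\<Delta>g = 4b\<^sup>2 (1 - g)\<close> and is used on the ball only.
\<close>

definition bump_profile :: "real \<Rightarrow> real \<Rightarrow> 'a::euclidean_space \<Rightarrow> real" where
  "bump_profile b c z = 1 - bessel_clifford (real DIM('a) / 2) (b\<^sup>2 * (z \<bullet> z)) / c"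

definition bump_profile_deriv :: "real \<Rightarrow> real \<Rightarrow> 'a::euclidean_space \<Rightarrow> 'a \<Rightarrow> real" where
  "bump_profile_deriv b c z v = 2 * b\<^sup>2 / c * (z \<bullet> v) * bessel_clifford (real DIM('a) / 2 + 1) (b\<^sup>2 * (z \<bullet> z))"

lemma bessel_clifford_radial_has_derivative:
  fixes z :: "'a::euclidean_space"
  assumes "N > 0"
  shows "((\<lambda>z. bessel_clifford N (b\<^sup>2 * (z \<bullet> z))) has_derivative
      (\<lambda>h. - 2 * b\<^sup>2 * (z \<bullet> h) * bessel_clifford (N + 1) (b\<^sup>2 * (z \<bullet> z)))) (at z)"
proof -
  have "((\<lambda>z. b\<^sup>2 * (z \<bullet> z)) has_derivative (\<lambda>h. b\<^sup>2 * (z \<bullet> h + h \<bullet> z))) (at z)"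
    by (auto intro!: derivative_eq_intros)
  from DERIV_compose_FDERIV[OF bessel_clifford_has_derivative[OF assms] this]
  show ?thesis by (simp add: inner_commute mult_ac)
qed

lemma continuous_on_bessel_clifford_compose [continuous_intros]:
  "N > 0 \<Longrightarrow> continuous_on A f \<Longrightarrow> continuous_on A (\<lambda>x. bessel_clifford N (f x))"
  using continuous_on_compose2[OF bessel_clifford_continuous[of N UNIV]] by auto

lemma DIM_half_pos: "real DIM('a::euclidean_space) / 2 > 0" "real DIM('a::euclidean_space) / 2 + 1 > 0"
  by (simp_all add: add_pos_pos)

lemma bump_profile_has_derivative:
  fixes z :: "'a::euclidean_space"
  shows "(bump_profile b c has_derivative bump_profile_deriv b c z) (at z)"
proof -
  have "((\<lambda>z. 1 - bessel_clifford (real DIM('a) / 2) (b\<^sup>2 * (z \<bullet> z)) / c) has_derivative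
      (\<lambda>h. 0 - (- 2 * b\<^sup>2 * (z \<bullet> h) * bessel_clifford (real DIM('a) / 2 + 1) (b\<^sup>2 * (z \<bullet> z))) / c)) (at z)"
    by (intro has_derivative_diff has_derivative_const bounded_linear.has_derivative[OF bounded_linear_divide]
        bessel_clifford_radial_has_derivative DIM_half_pos)
  then show ?thesis
    unfolding bump_profile_def[abs_def] bump_profile_deriv_def[abs_def] by (simp add: mult_ac)
qed

lemma continuous_on_bump_profile [continuous_intros]:
  "continuous_on A f \<Longrightarrow> continuous_on A (\<lambda>x. bump_profile b c (f x))"
  "continuous_on A f \<Longrightarrow> continuous_on A (\<lambda>x. bump_profile_deriv b c (f x) v)"
  unfolding bump_profile_def bump_profile_deriv_def divide_inverse
  by (intro continuous_intros; simp add: add_pos_pos)+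

text \<open>
The field \<open>(p(z) - p\<^sub>1) z\<close> with \<open>p(z) = C\<^sub>N\<^sub>+\<^sub>1(b\<^sup>2 z\<bullet>z)\<close> and \<open>p\<^sub>1\<close> its boundary value vanishes on the sphere, and by the
recurrence its divergence is \<open>2 C\<^sub>N(b\<^sup>2 z\<bullet>z) - d p\<^sub>1\<close>.
\<close>

lemma integral_ball_bessel_clifford:
  fixes b \<rho> :: real
  assumes "\<rho> \<ge> 0"
  defines "N \<equiv> real DIM('a::euclidean_space) / 2"
  shows "(\<integral>z. indicator (cball (0::'a) \<rho>) z * bessel_clifford N (b\<^sup>2 * (z \<bullet> z)) \<partial>lborel)
      = N * bessel_clifford (N + 1) ((b * \<rho>)\<^sup>2) * measure lborel (cball (0::'a) \<rho>)"
proof -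
  note N = DIM_half_pos[where 'a='a, folded N_def]
  let ?c = "\<lambda>k (z::'a). bessel_clifford (N + k) (b\<^sup>2 * (z \<bullet> z))"
  let ?p = "bessel_clifford (N + 1) ((b * \<rho>)\<^sup>2)"
  let ?I = "indicator (cball (0::'a) \<rho>) :: 'a \<Rightarrow> real"
  let ?f' = "\<lambda>v x h. (x \<bullet> v) * (- 2 * b\<^sup>2 * (x \<bullet> h) * ?c 2 x) + (h \<bullet> v) * (?c 1 x - ?p)"
  have zero: "(\<integral>z. ?I z *\<^sub>R ?f' v z v \<partial>lborel) = 0" for v :: 'a
  proof (rule integral_ball_divergence_zero[where f="\<lambda>x. (x \<bullet> v) * (?c 1 x - ?p)" and f'="?f' v"])
    fix x :: 'a
    have "((\<lambda>x. ?c 1 x - ?p) has_derivative (\<lambda>h. (- 2 * b\<^sup>2 * (x \<bullet> h) * ?c 2 x) - 0)) (at x)"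
      using bessel_clifford_radial_has_derivative[OF N(2), of b x]
      by (intro has_derivative_diff has_derivative_const) (simp add: add.assoc)
    then have "((\<lambda>x. ?c 1 x - ?p) has_derivative (\<lambda>h. - 2 * b\<^sup>2 * (x \<bullet> h) * ?c 2 x)) (at x)" by simp
    from has_derivative_mult[OF has_derivative_inner_left[OF has_derivative_ident] this]
    show "((\<lambda>x. (x \<bullet> v) * (?c 1 x - ?p)) has_derivative ?f' v x) (at x)" .
  next
    show "continuous_on UNIV (\<lambda>x. ?f' v x w)" for w
      using N by (intro continuous_intros) auto
  next
    fix x :: 'a assume "norm x = \<rho>"
    then have "b\<^sup>2 * (x \<bullet> x) = (b * \<rho>)\<^sup>2" by (simp add: power2_norm_eq_inner[symmetric] power_mult_distrib)
    then show "(x \<bullet> v) * (?c 1 x - ?p) = 0" by simp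
  qed
  have int: "integrable lborel (\<lambda>z. ?I z * f z)" if "continuous_on UNIV f" for f
    using integrable_ball_continuous[OF that] by simp
  have "0 = (\<Sum>v\<in>Basis. \<integral>z. ?I z *\<^sub>R ?f' v z v \<partial>lborel)" unfolding zero by simp
  also have "\<dots> = (\<integral>z. (\<Sum>v\<in>Basis. ?I z *\<^sub>R ?f' v z v) \<partial>lborel)"
    using N by (subst Bochner_Integration.integral_sum) (auto intro!: integrable_ball_continuous continuous_intros simp del: real_scaleR_def)
  also have "(\<lambda>z. \<Sum>v\<in>Basis. ?I z *\<^sub>R ?f' v z v) = (\<lambda>z. 2 * (?I z * ?c 0 z) - 2 * N * ?p * ?I z)"
  proof
    fix z :: 'a
    have "(\<Sum>v\<in>Basis. ?f' v z v) = (\<Sum>v\<in>Basis. - 2 * b\<^sup>2 * ?c 2 z * ((z \<bullet> v) * (z \<bullet> v)) + (?c 1 z - ?p))"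
      by (intro sum.cong) (auto simp: algebra_simps)
    also have "\<dots> = - 2 * b\<^sup>2 * ?c 2 z * (z \<bullet> z) + DIM('a) * (?c 1 z - ?p)"
      by (subst sum.distrib, subst sum_distrib_left[symmetric]) (simp add: euclidean_inner[of z z])
    also have "\<dots> = 2 * ?c 0 z - 2 * N * ?p"
      using bessel_clifford_recurrence[OF N(1), of "b\<^sup>2 * (z \<bullet> z)"] by (simp add: N_def algebra_simps)
    finally have eq: "(\<Sum>v\<in>Basis. ?f' v z v) = 2 * ?c 0 z - 2 * N * ?p" .
    have "(\<Sum>v\<in>Basis. ?I z *\<^sub>R ?f' v z v) = ?I z * (\<Sum>v\<in>Basis. ?f' v z v)"
      by (simp only: real_scaleR_def sum_distrib_left)
    then show "(\<Sum>v\<in>Basis. ?I z *\<^sub>R ?f' v z v) = 2 * (?I z * ?c 0 z) - 2 * N * ?p * ?I z"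
      unfolding eq by (simp add: algebra_simps)
  qed
  also have "(\<integral>z. 2 * (?I z * ?c 0 z) - 2 * N * ?p * ?I z \<partial>lborel)
      = 2 * (\<integral>z. ?I z * ?c 0 z \<partial>lborel) - 2 * N * ?p * measure lborel (cball (0::'a) \<rho>)"
  proof -
    have i1: "integrable lborel (\<lambda>z. 2 * (?I z * ?c 0 z))"
      using N by (intro integrable_mult_right int continuous_intros) auto
    have i2: "integrable lborel (\<lambda>z. 2 * N * ?p * ?I z)"
      using int[of "\<lambda>_. 1"] by (intro integrable_mult_right) simp
    show ?thesis using Bochner_Integration.integral_diff[OF i1 i2] by simp
  qed
  finally show ?thesis by simp
qed

text \<open>
Green's identity \<open>\<integral> |\<nabla>g|\<^sup>2 = -\<integral> g \<Delta>g\<close> with \<open>\<Delta>g = 4b\<^sup>2 (1 - g)\<close>; there is no boundary term as \<open>g\<close>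
vanishes on the sphere.
\<close>

lemma bump_energy_identity:
  fixes b \<rho> :: real
  defines "N \<equiv> real DIM('a::euclidean_space) / 2"
  defines "c \<equiv> bessel_clifford N ((b * \<rho>)\<^sup>2)"
  assumes c0: "c \<noteq> 0"
  shows "(\<Sum>v\<in>Basis. \<integral>z. indicator (cball (0::'a) \<rho>) z * (bump_profile_deriv b c z v)\<^sup>2 \<partial>lborel)
      = 4 * b\<^sup>2 * ((\<integral>z. indicator (cball (0::'a) \<rho>) z * (bump_profile b c z)\<^sup>2 \<partial>lborel)
          - (\<integral>z. indicator (cball (0::'a) \<rho>) z * bump_profile b c z \<partial>lborel))"
proof -
  note N = DIM_half_pos[where 'a='a, folded N_def]
  let ?c = "\<lambda>k (z::'a). bessel_clifford (N + k) (b\<^sup>2 * (z \<bullet> z))"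
  let ?I = "indicator (cball (0::'a) \<rho>) :: 'a \<Rightarrow> real"
  let ?g = "bump_profile b c :: 'a \<Rightarrow> real"
  let ?d = "bump_profile_deriv b c :: 'a \<Rightarrow> 'a \<Rightarrow> real"
  let ?d2 = "\<lambda>v x h. 2 * b\<^sup>2 / c * ((x \<bullet> v) * (- 2 * b\<^sup>2 * (x \<bullet> h) * ?c 2 x) + (h \<bullet> v) * ?c 1 x)"
  let ?f' = "\<lambda>v x h. ?g x * ?d2 v x h + ?d x h * ?d x v"
  have zero: "(\<integral>z. ?I z *\<^sub>R ?f' v z v \<partial>lborel) = 0" for v :: 'a
  proof (rule integral_ball_divergence_zero[where f="\<lambda>x. ?g x * ?d x v" and f'="?f' v"])
    fix x :: 'a
    have "(?c 1 has_derivative (\<lambda>h. - 2 * b\<^sup>2 * (x \<bullet> h) * ?c 2 x)) (at x)"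
      using bessel_clifford_radial_has_derivative[OF N(2), of b x] by (simp add: add.assoc)
    from has_derivative_mult_right[OF has_derivative_mult[OF has_derivative_inner_left[OF has_derivative_ident] this], of "2 * b\<^sup>2 / c" v]
    have "((\<lambda>x. ?d x v) has_derivative ?d2 v x) (at x)"
      by (simp add: bump_profile_deriv_def N_def mult.assoc)
    from has_derivative_mult[OF bump_profile_has_derivative this]
    show "((\<lambda>x. ?g x * ?d x v) has_derivative ?f' v x) (at x)" .
  next
    show "continuous_on UNIV (\<lambda>x. ?f' v x w)" for w
      using N c0 by (intro continuous_intros) auto
  next
    fix x :: 'a assume "norm x = \<rho>"
    then have "b\<^sup>2 * (x \<bullet> x) = (b * \<rho>)\<^sup>2" by (simp add: power2_norm_eq_inner[symmetric] power_mult_distrib)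
    then show "?g x * ?d x v = 0" using c0 by (simp add: bump_profile_def c_def N_def)
  qed
  have int: "integrable lborel (\<lambda>z. ?I z * f z)" if "continuous_on UNIV f" for f
    using integrable_ball_continuous[OF that] by simp
  have "0 = (\<Sum>v\<in>Basis. \<integral>z. ?I z *\<^sub>R ?f' v z v \<partial>lborel)" unfolding zero by simp
  also have "\<dots> = (\<integral>z. (\<Sum>v\<in>Basis. ?I z *\<^sub>R ?f' v z v) \<partial>lborel)"
    using N c0 by (subst Bochner_Integration.integral_sum) (auto intro!: integrable_ball_continuous continuous_intros simp del: real_scaleR_def)
  also have "(\<lambda>z. \<Sum>v\<in>Basis. ?I z *\<^sub>R ?f' v z v)
     = (\<lambda>z. (\<Sum>v\<in>Basis. ?I z * (?d z v)\<^sup>2) + 4 * b\<^sup>2 * (?I z * ?g z) - 4 * b\<^sup>2 * (?I z * (?g z)\<^sup>2))"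
  proof
    fix z :: 'a
    have c0': "?c 0 z = c * (1 - ?g z)" using c0 by (simp add: bump_profile_def N_def)
    have "(\<Sum>v\<in>Basis. ?f' v z v) = (\<Sum>v\<in>Basis. (?d z v)\<^sup>2 + ?g z * (2 * b\<^sup>2 / c) * (- 2 * b\<^sup>2 * ?c 2 z * ((z \<bullet> v) * (z \<bullet> v)) + ?c 1 z))"
      by (intro sum.cong) (auto simp: algebra_simps power2_eq_square)
    also have "\<dots> = (\<Sum>v\<in>Basis. (?d z v)\<^sup>2) + ?g z * (2 * b\<^sup>2 / c) * (\<Sum>v\<in>Basis. - 2 * b\<^sup>2 * ?c 2 z * ((z \<bullet> v) * (z \<bullet> v)) + ?c 1 z)"
      by (subst sum.distrib) (simp only: sum_distrib_left)
    also have "(\<Sum>v\<in>Basis. - 2 * b\<^sup>2 * ?c 2 z * ((z \<bullet> v) * (z \<bullet> v)) + ?c 1 z) = - 2 * b\<^sup>2 * ?c 2 z * (z \<bullet> z) + DIM('a) * ?c 1 z"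
      by (subst sum.distrib, subst sum_distrib_left[symmetric]) (simp add: euclidean_inner[of z z])
    also have "\<dots> = 2 * ?c 0 z"
      using bessel_clifford_recurrence[OF N(1), of "b\<^sup>2 * (z \<bullet> z)"] by (simp add: N_def algebra_simps)
    also have "?g z * (2 * b\<^sup>2 / c) * (2 * ?c 0 z) = 4 * b\<^sup>2 * ?g z - 4 * b\<^sup>2 * (?g z)\<^sup>2"
      unfolding c0' using c0 by (simp add: power2_eq_square algebra_simps)
    finally have eq: "(\<Sum>v\<in>Basis. ?f' v z v) = (\<Sum>v\<in>Basis. (?d z v)\<^sup>2) + (4 * b\<^sup>2 * ?g z - 4 * b\<^sup>2 * (?g z)\<^sup>2)" .
    have "(\<Sum>v\<in>Basis. ?I z *\<^sub>R ?f' v z v) = ?I z * (\<Sum>v\<in>Basis. ?f' v z v)"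
      by (simp only: real_scaleR_def sum_distrib_left)
    moreover have "(\<Sum>v\<in>Basis. ?I z * (?d z v)\<^sup>2) = ?I z * (\<Sum>v\<in>Basis. (?d z v)\<^sup>2)"
      by (simp only: sum_distrib_left)
    ultimately show "(\<Sum>v\<in>Basis. ?I z *\<^sub>R ?f' v z v)
        = (\<Sum>v\<in>Basis. ?I z * (?d z v)\<^sup>2) + 4 * b\<^sup>2 * (?I z * ?g z) - 4 * b\<^sup>2 * (?I z * (?g z)\<^sup>2)"
      unfolding eq by (simp add: algebra_simps)
  qed
  also have "(\<integral>z. (\<Sum>v\<in>Basis. ?I z * (?d z v)\<^sup>2) + 4 * b\<^sup>2 * (?I z * ?g z) - 4 * b\<^sup>2 * (?I z * (?g z)\<^sup>2) \<partial>lborel)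
      = (\<Sum>v\<in>Basis. \<integral>z. ?I z * (?d z v)\<^sup>2 \<partial>lborel) + 4 * b\<^sup>2 * (\<integral>z. ?I z * ?g z \<partial>lborel)
        - 4 * b\<^sup>2 * (\<integral>z. ?I z * (?g z)\<^sup>2 \<partial>lborel)"
  proof -
    have i0: "integrable lborel (\<lambda>z. ?I z * (?d z v)\<^sup>2)" for v by (intro int continuous_intros)
    then have i1: "integrable lborel (\<lambda>z. \<Sum>v\<in>Basis. ?I z * (?d z v)\<^sup>2)" by (intro Bochner_Integration.integrable_sum)
    have i2: "integrable lborel (\<lambda>z. 4 * b\<^sup>2 * (?I z * ?g z))" "integrable lborel (\<lambda>z. 4 * b\<^sup>2 * (?I z * (?g z)\<^sup>2))"
      by (intro integrable_mult_right int continuous_intros)+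
    show ?thesis
      using Bochner_Integration.integral_diff[OF Bochner_Integration.integrable_add[OF i1 i2(1)] i2(2)]
        Bochner_Integration.integral_add[OF i1 i2(1)] Bochner_Integration.integral_sum[where I="Basis::'a set", OF i0]
      by (simp only: integral_mult_right_zero)
  qed
  finally show ?thesis by (simp add: algebra_simps)
qed

text \<open>
Extended by zero, the bump has a jump of the gradient only, so its Fourier transform turns the derivative into a
factor \<open>2\<pi>i \<xi>\<bullet>v\<close>.
\<close>

lemma fourier_bump_deriv:
  fixes \<xi> v :: "'a::euclidean_space" and b \<rho> :: real
  defines "N \<equiv> real DIM('a) / 2"
  defines "c \<equiv> bessel_clifford N ((b * \<rho>)\<^sup>2)"
  assumes c0: "c \<noteq> 0"
  shows "(\<integral>z. indicator (cball 0 \<rho>) z *\<^sub>R (bump_profile_deriv b c z v *\<^sub>R cis (- 2 * pi * (\<xi> \<bullet> z))) \<partial>lborel)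
     = (2 * pi * (\<xi> \<bullet> v)) *\<^sub>R (\<i> * (\<integral>z. indicator (cball 0 \<rho>) z *\<^sub>R (bump_profile b c z *\<^sub>R cis (- 2 * pi * (\<xi> \<bullet> z))) \<partial>lborel))"
proof -
  let ?I = "indicator (cball (0::'a) \<rho>) :: 'a \<Rightarrow> real"
  let ?g = "bump_profile b c :: 'a \<Rightarrow> real"
  let ?d = "bump_profile_deriv b c :: 'a \<Rightarrow> 'a \<Rightarrow> real"
  let ?e = "\<lambda>z. cis (- 2 * pi * (\<xi> \<bullet> z))"
  let ?f' = "\<lambda>x h. ?g x *\<^sub>R ((- 2 * pi * (\<xi> \<bullet> h)) *\<^sub>R (\<i> * ?e x)) + ?d x h *\<^sub>R ?e x"
  have "(\<integral>z. ?I z *\<^sub>R ?f' z v \<partial>lborel) = 0"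
  proof (rule integral_ball_divergence_zero[where f="\<lambda>x. ?g x *\<^sub>R ?e x" and f'="?f'"])
    fix x :: 'a
    have "((\<lambda>x. - 2 * pi * (\<xi> \<bullet> x)) has_derivative (\<lambda>h. - 2 * pi * (\<xi> \<bullet> h))) (at x)"
      by (auto intro!: derivative_eq_intros)
    from has_derivative_scaleR[OF bump_profile_has_derivative has_derivative_cis[OF this]]
    show "((\<lambda>x. ?g x *\<^sub>R ?e x) has_derivative ?f' x) (at x)" .
  next
    show "continuous_on UNIV (\<lambda>x. ?f' x w)" for w by (intro continuous_intros)
  next
    fix x :: 'a assume "norm x = \<rho>"
    then have "b\<^sup>2 * (x \<bullet> x) = (b * \<rho>)\<^sup>2" by (simp add: power2_norm_eq_inner[symmetric] power_mult_distrib)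
    then show "?g x *\<^sub>R ?e x = 0" using c0 by (simp add: bump_profile_def c_def N_def)
  qed
  also have "(\<lambda>z. ?I z *\<^sub>R ?f' z v) = (\<lambda>z. ?I z *\<^sub>R (?d z v *\<^sub>R ?e z) - ((2 * pi * (\<xi> \<bullet> v)) *\<^sub>R \<i>) * (?I z *\<^sub>R (?g z *\<^sub>R ?e z)))"
    by (auto simp: algebra_simps scaleR_conv_of_real)
  also have "(\<integral>z. ?I z *\<^sub>R (?d z v *\<^sub>R ?e z) - ((2 * pi * (\<xi> \<bullet> v)) *\<^sub>R \<i>) * (?I z *\<^sub>R (?g z *\<^sub>R ?e z)) \<partial>lborel)
      = (\<integral>z. ?I z *\<^sub>R (?d z v *\<^sub>R ?e z) \<partial>lborel) - ((2 * pi * (\<xi> \<bullet> v)) *\<^sub>R \<i>) * (\<integral>z. ?I z *\<^sub>R (?g z *\<^sub>R ?e z) \<partial>lborel)"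
  proof -
    have i1: "integrable lborel (\<lambda>z. ?I z *\<^sub>R (?d z v *\<^sub>R ?e z))" by (intro integrable_ball_continuous continuous_intros)
    have i2: "integrable lborel (\<lambda>z. ?I z *\<^sub>R (?g z *\<^sub>R ?e z))" by (intro integrable_ball_continuous continuous_intros)
    show ?thesis
      using Bochner_Integration.integral_diff[OF i1 integrable_mult_right[OF i2, of "(2 * pi * (\<xi> \<bullet> v)) *\<^sub>R \<i>"]]
      by (simp only: integral_mult_right_zero)
  qed
  finally show ?thesis by simp
qed

section \<open>Gaussian kernels\<close>

text \<open>
Lebesgue measure on a Euclidean space is the product of the measures on the coordinate axes.
\<close>

lemma
  fixes f :: "'a::euclidean_space \<Rightarrow> real \<Rightarrow> 'c::{real_normed_field, banach, second_countable_topology}"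
  assumes f: "\<And>b. b \<in> Basis \<Longrightarrow> integrable lborel (f b)"
  shows integrable_prod_Basis: "integrable lborel (\<lambda>x::'a. \<Prod>b\<in>Basis. f b (x \<bullet> b))"
    and integral_prod_Basis: "(\<integral>x. (\<Prod>b\<in>Basis. f b (x \<bullet> b)) \<partial>lborel) = (\<Prod>b\<in>Basis. \<integral>t. f b t \<partial>lborel)"
proof -
  interpret product_sigma_finite "\<lambda>_::'a. lborel :: real measure" by standard
  let ?T = "\<lambda>x. \<Sum>b\<in>Basis. x b *\<^sub>R b :: 'a"
  have [measurable]: "?T \<in> measurable (\<Pi>\<^sub>M b\<in>Basis. lborel) borel" by measurable
  have [measurable]: "f b \<in> borel_measurable borel" if "b \<in> Basis" for b
    using borel_measurable_integrable[OF f[OF that]] by simp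
  have meas [measurable]: "(\<lambda>x::'a. \<Prod>b\<in>Basis. f b (x \<bullet> b)) \<in> borel_measurable borel" by measurable
  have eq: "(\<Prod>b\<in>Basis. f b (?T x \<bullet> b)) = (\<Prod>b\<in>Basis. f b (x b))" for x
    by (intro prod.cong) (auto simp: inner_sum_left_Basis)
  show "integrable lborel (\<lambda>x::'a. \<Prod>b\<in>Basis. f b (x \<bullet> b))"
    using product_integrable_prod[OF finite_Basis f]
    by (subst lborel_eq, subst integrable_distr_eq) (auto simp: eq)
  show "(\<integral>x. (\<Prod>b\<in>Basis. f b (x \<bullet> b)) \<partial>lborel) = (\<Prod>b\<in>Basis. \<integral>t. f b t \<partial>lborel)"
    using product_integral_prod[OF finite_Basis f]
    by (subst lborel_eq, subst integral_distr) (auto simp: eq)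
qed

definition gauss :: "real \<Rightarrow> 'a::euclidean_space \<Rightarrow> real" where
  "gauss \<epsilon> z = (\<Prod>b\<in>Basis. normal_density 0 \<epsilon> (z \<bullet> b))"

text \<open>
The characteristic function of the normal density \<open>gauss \<epsilon>\<close> at \<open>2\<pi>\<xi>\<close>.
\<close>

definition gauss_multiplier :: "real \<Rightarrow> 'a::euclidean_space \<Rightarrow> real" where
  "gauss_multiplier \<epsilon> \<xi> = exp (- (2 * pi * \<epsilon> * norm \<xi>)\<^sup>2 / 2)"

lemma gauss_nonneg: "gauss \<epsilon> z \<ge> 0"
  by (simp add: gauss_def prod_nonneg)

lemma gauss_minus: "gauss \<epsilon> (- z) = gauss \<epsilon> z"
  by (simp add: gauss_def normal_density_def)

lemma gauss_measurable [measurable]: "gauss \<epsilon> \<in> borel_measurable borel"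
  unfolding gauss_def[abs_def] by measurable

lemma gauss_multiplier_measurable [measurable]: "gauss_multiplier \<epsilon> \<in> borel_measurable borel"
  unfolding gauss_multiplier_def[abs_def] by measurable

lemma gauss_integral:
  assumes "\<epsilon> > 0"
  shows "integrable lborel (gauss \<epsilon> :: 'a::euclidean_space \<Rightarrow> real)" "(\<integral>z. gauss \<epsilon> (z::'a) \<partial>lborel) = 1"
  unfolding gauss_def[abs_def]
  using integrable_prod_Basis[of "\<lambda>_::'a. normal_density 0 \<epsilon>"]
    integral_prod_Basis[of "\<lambda>_::'a. normal_density 0 \<epsilon>"] assms
  by (auto simp: integrable_normal_density integral_normal_density)

lemma gauss_second_moment:
  assumes "\<epsilon> > 0"
  shows "integrable lborel (\<lambda>z::'a::euclidean_space. (norm z)\<^sup>2 * gauss \<epsilon> z)"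
    and "(\<integral>z. (norm (z::'a))\<^sup>2 * gauss \<epsilon> z \<partial>lborel) = real DIM('a) * \<epsilon>\<^sup>2"
proof -
  let ?n = "normal_density 0 \<epsilon>"
  let ?f = "\<lambda>b c t. if c = b then ?n t * t\<^sup>2 else ?n t"
  have m: "has_bochner_integral lborel (\<lambda>t. ?n t * t\<^sup>2) (\<epsilon>\<^sup>2)"
    using normal_moment_even[OF assms, of 0 1] by (simp add: fact_2)
  have int: "integrable lborel (?f b c)" for b c :: 'a
    using m assms by (cases "c = b") (auto simp: integrable.intros integrable_normal_density)
  have eq: "(\<Prod>c\<in>Basis. ?f b c (z \<bullet> c)) = (z \<bullet> b)\<^sup>2 * gauss \<epsilon> z" if b: "b \<in> Basis" for b z :: 'a
  proof -
    have "(\<Prod>c\<in>Basis. ?f b c (z \<bullet> c)) = (?n (z \<bullet> b) * (z \<bullet> b)\<^sup>2) * (\<Prod>c\<in>Basis - {b}. ?n (z \<bullet> c))"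
      using b by (subst prod.remove[of _ b]) (auto intro!: prod.cong)
    then show ?thesis using b by (simp add: gauss_def prod.remove[of Basis b])
  qed
  have i1: "integrable lborel (\<lambda>z. (z \<bullet> b)\<^sup>2 * gauss \<epsilon> z)" if b: "b \<in> Basis" for b :: 'a
    using integrable_prod_Basis[of "?f b", OF int] eq[OF b] by simp
  have i2: "(\<integral>z. (z \<bullet> b)\<^sup>2 * gauss \<epsilon> z \<partial>lborel) = \<epsilon>\<^sup>2" if b: "b \<in> Basis" for b :: 'a
  proof -
    have "(\<integral>z. (z \<bullet> b)\<^sup>2 * gauss \<epsilon> z \<partial>lborel) = (\<Prod>c\<in>Basis. \<integral>t. ?f b c t \<partial>lborel)"
      using integral_prod_Basis[of "?f b", OF int] eq[OF b] by simp
    also have "\<dots> = (\<integral>t. ?n t * t\<^sup>2 \<partial>lborel) * (\<Prod>c\<in>Basis - {b}. \<integral>t. ?n t \<partial>lborel)"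
      using b by (subst prod.remove[of _ b]) (auto intro!: prod.cong)
    finally show ?thesis
      using m assms by (simp add: has_bochner_integral_iff integral_normal_density)
  qed
  have s: "(\<lambda>z::'a. (norm z)\<^sup>2 * gauss \<epsilon> z) = (\<lambda>z. \<Sum>b\<in>Basis. (z \<bullet> b)\<^sup>2 * gauss \<epsilon> z)"
    unfolding power2_norm_eq_inner euclidean_inner[of z z for z] sum_distrib_right by (simp add: power2_eq_square)
  show "integrable lborel (\<lambda>z::'a. (norm z)\<^sup>2 * gauss \<epsilon> z)"
    unfolding s by (intro Bochner_Integration.integrable_sum i1)
  show "(\<integral>z. (norm (z::'a))\<^sup>2 * gauss \<epsilon> z \<partial>lborel) = real DIM('a) * \<epsilon>\<^sup>2"
    unfolding s by (subst Bochner_Integration.integral_sum) (auto simp: i1 i2)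
qed

lemma gauss_fourier_1d:
  assumes e: "\<epsilon> > 0"
  shows "integrable lborel (\<lambda>x. exp (- (2 * pi * \<epsilon> * x)\<^sup>2 / 2) *\<^sub>R cis (2 * pi * x * z))" (is "integrable _ ?f")
    and "(\<integral>x. exp (- (2 * pi * \<epsilon> * x)\<^sup>2 / 2) *\<^sub>R cis (2 * pi * x * z) \<partial>lborel) = of_real (normal_density 0 \<epsilon> z)"
proof -
  let ?c = "2 * pi * \<epsilon>"
  let ?g = "\<lambda>y. std_normal_density y *\<^sub>R cis (z / \<epsilon> * y)"
  have c: "?c \<noteq> 0" "?c > 0" using e by auto
  have f: "?f x = sqrt (2 * pi) *\<^sub>R ?g (0 + ?c * x)" for x
  proof -
    have "z / \<epsilon> * (0 + ?c * x) = 2 * pi * x * z" using e by simp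
    then show ?thesis by (simp add: std_normal_density_def)
  qed
  have [measurable]: "(\<lambda>y. cis (z * y / \<epsilon>)) \<in> borel_measurable borel"
    using e by (intro borel_measurable_continuous_onI continuous_intros) auto
  have ig: "integrable lborel ?g"
    by (rule Bochner_Integration.integrable_bound[OF integrable_normal_density[of 1 0]]) auto
  then have ig': "integrable lborel (\<lambda>x. ?g (0 + ?c * x))"
    using lborel_integrable_real_affine_iff[OF c(1), of ?g 0] by simp
  show "integrable lborel ?f" unfolding f using ig' by (intro integrable_scaleR_right)
  have "char std_normal_distribution (z / \<epsilon>) = (\<integral>y. ?g y \<partial>lborel)"
    unfolding char_def by (subst integral_density) (auto simp: cis_conv_exp)
  then have "(\<integral>y. ?g y \<partial>lborel) = of_real (exp (- ((z / \<epsilon>)\<^sup>2) / 2))"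
    by (simp add: char_std_normal_distribution)
  moreover have "(\<integral>y. ?g y \<partial>lborel) = \<bar>?c\<bar> *\<^sub>R (\<integral>x. ?g (0 + ?c * x) \<partial>lborel)"
    by (rule lborel_integral_real_affine[OF c(1)])
  ultimately have I: "(\<integral>x. ?g (0 + ?c * x) \<partial>lborel) = (1 / ?c) *\<^sub>R of_real (exp (- ((z / \<epsilon>)\<^sup>2) / 2))"
  proof -
    assume a: "(\<integral>y. ?g y \<partial>lborel) = of_real (exp (- ((z / \<epsilon>)\<^sup>2) / 2))"
      and b: "(\<integral>y. ?g y \<partial>lborel) = \<bar>?c\<bar> *\<^sub>R (\<integral>x. ?g (0 + ?c * x) \<partial>lborel)"
    have X: "X = (1 / ?c) *\<^sub>R (\<bar>?c\<bar> *\<^sub>R X)" for X :: complex using e by simp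
    show ?thesis by (subst X) (simp only: b[symmetric] a)
  qed
  have "(\<integral>x. ?f x \<partial>lborel) = sqrt (2 * pi) *\<^sub>R (\<integral>x. ?g (0 + ?c * x) \<partial>lborel)"
    unfolding f by (rule integral_scaleR_right)
  also have "\<dots> = of_real (sqrt (2 * pi) / ?c * exp (- ((z / \<epsilon>)\<^sup>2) / 2))"
    unfolding I by (simp add: scaleR_conv_of_real)
  also have "sqrt (2 * pi) / ?c * exp (- ((z / \<epsilon>)\<^sup>2) / 2) = normal_density 0 \<epsilon> z"
  proof -
    have "sqrt (2 * pi * \<epsilon>\<^sup>2) = sqrt (2 * pi) * \<epsilon>" using e by (simp add: real_sqrt_mult)
    moreover have "sqrt (2 * pi) / ?c = 1 / (sqrt (2 * pi) * \<epsilon>)"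
      using e by (simp add: divide_simps)
    ultimately show ?thesis by (simp add: normal_density_def power_divide mult.commute)
  qed
  finally show "(\<integral>x. ?f x \<partial>lborel) = of_real (normal_density 0 \<epsilon> z)" .
qed

lemma gauss_fourier:
  fixes z :: "'a::euclidean_space"
  assumes e: "\<epsilon> > 0"
  shows "integrable lborel (\<lambda>\<xi>. gauss_multiplier \<epsilon> \<xi> *\<^sub>R cis (2 * pi * (\<xi> \<bullet> z)))"
    and "(\<integral>\<xi>. gauss_multiplier \<epsilon> \<xi> *\<^sub>R cis (2 * pi * (\<xi> \<bullet> z)) \<partial>lborel) = of_real (gauss \<epsilon> z)"
proof -
  let ?f = "\<lambda>b x. exp (- (2 * pi * \<epsilon> * x)\<^sup>2 / 2) *\<^sub>R cis (2 * pi * x * (z \<bullet> b))"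
  have eq: "(\<lambda>\<xi>. gauss_multiplier \<epsilon> \<xi> *\<^sub>R cis (2 * pi * (\<xi> \<bullet> z))) = (\<lambda>\<xi>. \<Prod>b\<in>Basis. ?f b (\<xi> \<bullet> b))"
  proof
    fix \<xi> :: 'a
    have "(\<Prod>b\<in>Basis. ?f b (\<xi> \<bullet> b)) = of_real (\<Prod>b\<in>Basis. exp (- (2 * pi * \<epsilon> * (\<xi> \<bullet> b))\<^sup>2 / 2)) * (\<Prod>b\<in>Basis. cis (2 * pi * (\<xi> \<bullet> b) * (z \<bullet> b)))"
      by (simp add: scaleR_conv_of_real prod.distrib)
    also have "(\<Prod>b\<in>Basis. exp (- (2 * pi * \<epsilon> * (\<xi> \<bullet> b))\<^sup>2 / 2)) = exp (\<Sum>b\<in>Basis. - (2 * pi * \<epsilon> * (\<xi> \<bullet> b))\<^sup>2 / 2)"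
      by (rule exp_sum[symmetric]) simp
    also have "(\<Sum>b\<in>Basis. - (2 * pi * \<epsilon> * (\<xi> \<bullet> b))\<^sup>2 / 2) = - (2 * pi * \<epsilon> * norm \<xi>)\<^sup>2 / 2"
      unfolding power_mult_distrib power2_norm_eq_inner euclidean_inner[of \<xi> \<xi>]
      by (simp add: sum_distrib_left sum_negf sum_divide_distrib power2_eq_square)
    also have "(\<Prod>b\<in>Basis. cis (2 * pi * (\<xi> \<bullet> b) * (z \<bullet> b))) = cis (\<Sum>b\<in>Basis. 2 * pi * (\<xi> \<bullet> b) * (z \<bullet> b))"
      by (induction rule: finite_induct[OF finite_Basis]) (auto simp: cis_mult)
    also have "(\<Sum>b\<in>Basis. 2 * pi * (\<xi> \<bullet> b) * (z \<bullet> b)) = 2 * pi * (\<xi> \<bullet> z)"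
      unfolding euclidean_inner[of \<xi> z] by (simp add: sum_distrib_left mult.assoc)
    finally show "gauss_multiplier \<epsilon> \<xi> *\<^sub>R cis (2 * pi * (\<xi> \<bullet> z)) = (\<Prod>b\<in>Basis. ?f b (\<xi> \<bullet> b))"
      by (simp add: gauss_multiplier_def scaleR_conv_of_real)
  qed
  show "integrable lborel (\<lambda>\<xi>. gauss_multiplier \<epsilon> \<xi> *\<^sub>R cis (2 * pi * (\<xi> \<bullet> z)))"
    unfolding eq by (intro integrable_prod_Basis gauss_fourier_1d[OF e])
  show "(\<integral>\<xi>. gauss_multiplier \<epsilon> \<xi> *\<^sub>R cis (2 * pi * (\<xi> \<bullet> z)) \<partial>lborel) = of_real (gauss \<epsilon> z)"
    unfolding eq integral_prod_Basis[OF gauss_fourier_1d(1)[OF e]] gauss_fourier_1d(2)[OF e]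
    by (simp add: gauss_def)
qed

lemma gauss_multiplier_integrable: "\<epsilon> > 0 \<Longrightarrow> integrable lborel (gauss_multiplier \<epsilon> :: 'a::euclidean_space \<Rightarrow> real)"
proof -
  assume "\<epsilon> > 0"
  from integrable_norm[OF gauss_fourier(1)[OF this, of "0::'a"]]
  show ?thesis by (simp add: gauss_multiplier_def[abs_def])
qed

lemma
  fixes f :: "'a::euclidean_space \<Rightarrow> 'c::{real_normed_field, banach, second_countable_topology}"
    and g :: "'b::euclidean_space \<Rightarrow> 'c"
  assumes f: "integrable lborel f" and g: "integrable lborel g"
  shows integrable_lborel_tensor: "integrable lborel (\<lambda>w. f (fst w) * g (snd w))"
    and integral_lborel_tensor: "(\<integral>w. f (fst w) * g (snd w) \<partial>lborel) = (\<integral>x. f x \<partial>lborel) * (\<integral>y. g y \<partial>lborel)"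
proof -
  have [measurable]: "f \<in> borel_measurable borel" "g \<in> borel_measurable borel"
    using borel_measurable_integrable[OF f] borel_measurable_integrable[OF g] by simp_all
  have "integrable (lborel \<Otimes>\<^sub>M lborel) (\<lambda>w. f (fst w) * g (snd w))"
    by (rule lborel_pair.Fubini_integrable) (use f g in \<open>auto simp: norm_mult\<close>)
  then show int: "integrable lborel (\<lambda>w. f (fst w) * g (snd w))" by (simp add: lborel_prod)
  have "(\<integral>w. f (fst w) * g (snd w) \<partial>(lborel \<Otimes>\<^sub>M lborel)) = (\<integral>x. \<integral>y. f x * g y \<partial>lborel \<partial>lborel)"
    using int by (subst lborel_pair.integral_fst'[symmetric]) (auto simp: lborel_prod)
  then show "(\<integral>w. f (fst w) * g (snd w) \<partial>lborel) = (\<integral>x. f x \<partial>lborel) * (\<integral>y. g y \<partial>lborel)"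
    by (simp add: lborel_prod)
qed

text \<open>
Convolution integrals with an even kernel, written on the product space.
\<close>

lemma
  fixes a k :: "'a::euclidean_space \<Rightarrow> real"
  assumes a: "integrable lborel a" and k: "integrable lborel k" and even: "\<And>v. k (- v) = k v"
  shows integrable_correlation: "integrable lborel (\<lambda>w. a (fst w) * k (snd w - fst w))"
      "integrable lborel (\<lambda>w. a (snd w) * k (snd w - fst w))"
    and integral_correlation: "(\<integral>w. a (fst w) * k (snd w - fst w) \<partial>lborel) = (\<integral>x. a x \<partial>lborel) * (\<integral>v. k v \<partial>lborel)"
      "(\<integral>w. a (snd w) * k (snd w - fst w) \<partial>lborel) = (\<integral>x. a x \<partial>lborel) * (\<integral>v. k v \<partial>lborel)"
proof -
  have [measurable]: "a \<in> borel_measurable borel" "k \<in> borel_measurable borel"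
    using borel_measurable_integrable[OF a] borel_measurable_integrable[OF k] by simp_all
  have s: "(\<integral>y. f (y - x) \<partial>lborel) = (\<integral>v. f v \<partial>lborel)" if "f \<in> borel_measurable borel" for f :: "'a \<Rightarrow> real" and x
    using integral_shift[OF that, of "- x"] by simp
  have i: "integrable lborel (\<lambda>y. k (y - x))" for x using integrable_shift[OF k, of "- x"] by simp
  let ?h = "\<lambda>w. a (fst w) * k (snd w - fst w)"
  have int: "integrable (lborel \<Otimes>\<^sub>M lborel) ?h"
  proof (rule lborel_pair.Fubini_integrable)
    have "(\<integral>y. norm (?h (x, y)) \<partial>lborel) = \<bar>a x\<bar> * (\<integral>v. \<bar>k v\<bar> \<partial>lborel)" for x
      using s[of "\<lambda>v. \<bar>k v\<bar>" x] by (simp add: abs_mult)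
    then show "integrable lborel (\<lambda>x. \<integral>y. norm (?h (x, y)) \<partial>lborel)" using a by simp
    show "AE x in lborel. integrable lborel (\<lambda>y. ?h (x, y))" using i by simp
  qed auto
  then show int1: "integrable lborel ?h" by (simp add: lborel_prod)
  have "(\<integral>w. ?h w \<partial>(lborel \<Otimes>\<^sub>M lborel)) = (\<integral>x. \<integral>y. a x * k (y - x) \<partial>lborel \<partial>lborel)"
    using int by (subst lborel_pair.integral_fst'[symmetric]) auto
  then show eq: "(\<integral>w. ?h w \<partial>lborel) = (\<integral>x. a x \<partial>lborel) * (\<integral>v. k v \<partial>lborel)"
    by (simp add: lborel_prod s)
  have swap: "(\<lambda>w. a (snd w) * k (snd w - fst w)) = (\<lambda>(x, y). ?h (y, x))"
    using even[of "snd w - fst w" for w] by (auto simp: fun_eq_iff)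
  show "integrable lborel (\<lambda>w. a (snd w) * k (snd w - fst w))"
    using lborel_pair.integrable_product_swap[OF int] unfolding swap by (simp add: lborel_prod)
  show "(\<integral>w. a (snd w) * k (snd w - fst w) \<partial>lborel) = (\<integral>x. a x \<partial>lborel) * (\<integral>v. k v \<partial>lborel)"
    using lborel_pair.integral_product_swap[OF borel_measurable_integrable[OF int]] eq unfolding swap by (simp add: lborel_prod)
qed

section \<open>Plancherel identity with Gaussian regularization\<close>

definition fourier :: "('a::euclidean_space \<Rightarrow> complex) \<Rightarrow> 'a \<Rightarrow> complex" where
  "fourier f \<xi> = (\<integral>z. f z * cis (- 2 * pi * (\<xi> \<bullet> z)) \<partial>lborel)"

lemma cis_inner_measurable [measurable]:
  "(\<lambda>z. cis (a * (\<xi> \<bullet> z))) \<in> borel_measurable borel"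
  by (intro borel_measurable_continuous_onI continuous_intros)

lemma integrable_times_cis:
  fixes f :: "'a::euclidean_space \<Rightarrow> complex"
  assumes "integrable lborel f"
  shows "integrable lborel (\<lambda>z. f z * cis (a * (\<xi> \<bullet> z)))"
proof -
  have [measurable]: "f \<in> borel_measurable borel" using borel_measurable_integrable[OF assms] by simp
  show ?thesis by (rule Bochner_Integration.integrable_bound[OF assms]) (auto simp: norm_mult)
qed

lemma norm_fourier_le:
  assumes "integrable lborel f"
  shows "norm (fourier f \<xi>) \<le> (\<integral>z. norm (f z) \<partial>lborel)"
proof -
  have "norm (fourier f \<xi>) \<le> (\<integral>z. norm (f z * cis (- 2 * pi * (\<xi> \<bullet> z))) \<partial>lborel)"
    unfolding fourier_def by (rule integral_norm_bound)
  then show ?thesis by (simp add: norm_mult)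
qed

lemma fourier_measurable [measurable]:
  assumes [measurable]: "f \<in> borel_measurable borel"
  shows "fourier f \<in> borel_measurable borel"
proof -
  have [measurable]: "(\<lambda>w::'a \<times> 'a. cis (- 2 * pi * (fst w \<bullet> snd w))) \<in> borel_measurable (borel \<Otimes>\<^sub>M borel)"
    unfolding borel_prod by (intro borel_measurable_continuous_onI continuous_intros)
  have "(\<lambda>w. f (snd w) * cis (- 2 * pi * (fst w \<bullet> snd w))) \<in> borel_measurable (borel \<Otimes>\<^sub>M borel)"
    by measurable
  then have "(\<lambda>(\<xi>, z). f z * cis (- 2 * pi * (\<xi> \<bullet> z))) \<in> borel_measurable (borel \<Otimes>\<^sub>M lborel)"
    by (simp only: measurable_cong_sets[OF sets_pair_measure_cong[OF refl sets_lborel] refl] case_prod_beta')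
  then show ?thesis
    unfolding fourier_def[abs_def]
    using lborel.borel_measurable_lebesgue_integral[of "\<lambda>\<xi> z. f z * cis (- 2 * pi * (\<xi> \<bullet> z))" borel] by simp
qed

lemma norm_diff_squared_complex:
  "(cmod (x - y))\<^sup>2 = (cmod x)\<^sup>2 + (cmod y)\<^sup>2 - 2 * Re (x * cnj y)"
  unfolding cmod_power2 by (simp add: power2_eq_square algebra_simps)

text \<open>
Inserting the Fourier integral of the Gaussian and exchanging the order of integration expresses the regularized
norm by \<open>f(x) cnj (f(y)) gauss(y - x)\<close>. Writing the real part of the product as a difference of squares makes
the identity yield both estimates that follow: the correction term is nonnegative, and it is small for a Lipschitz function.
\<close>

lemma
  fixes f :: "'a::euclidean_space \<Rightarrow> complex"
  assumes f: "integrable lborel f" and f2: "integrable lborel (\<lambda>z. (norm (f z))\<^sup>2)" and e: "\<epsilon> > 0"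
  shows integrable_regularized_fourier: "integrable lborel (\<lambda>\<xi>. gauss_multiplier \<epsilon> \<xi> * (norm (fourier f \<xi>))\<^sup>2)"
    and integrable_regularized_difference:
      "integrable lborel (\<lambda>w. (norm (f (fst w) - f (snd w)))\<^sup>2 * gauss \<epsilon> (snd w - fst w))"
    and regularized_plancherel: "(\<integral>\<xi>. gauss_multiplier \<epsilon> \<xi> * (norm (fourier f \<xi>))\<^sup>2 \<partial>lborel)
      = (\<integral>z. (norm (f z))\<^sup>2 \<partial>lborel)
        - (\<integral>w. (norm (f (fst w) - f (snd w)))\<^sup>2 * gauss \<epsilon> (snd w - fst w) \<partial>lborel) / 2"
proof -
  have [measurable]: "f \<in> borel_measurable borel" using borel_measurable_integrable[OF f] by simp
  have [measurable]: "cnj \<in> borel_measurable borel"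
    by (intro borel_measurable_continuous_onI continuous_intros)
  let ?H = "\<lambda>w. f (fst w) * cnj (f (snd w))"
  let ?g = "\<lambda>w. gauss \<epsilon> (snd w - fst w)"
  let ?K = "\<lambda>\<xi> w. (gauss_multiplier \<epsilon> \<xi> *\<^sub>R cis (2 * pi * (\<xi> \<bullet> (snd w - fst w)))) * ?H w"
  have H: "integrable lborel ?H"
    using integrable_lborel_tensor[OF f, of "\<lambda>y. cnj (f y)"] f by simp
  show "integrable lborel (\<lambda>\<xi>. gauss_multiplier \<epsilon> \<xi> * (norm (fourier f \<xi>))\<^sup>2)"
  proof (rule Bochner_Integration.integrable_bound[OF integrable_mult_left[OF gauss_multiplier_integrable[OF e]]])
    show "AE \<xi> in lborel. norm (gauss_multiplier \<epsilon> \<xi> * (norm (fourier f \<xi>))\<^sup>2)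
        \<le> norm (gauss_multiplier \<epsilon> \<xi> * (\<integral>z. norm (f z) \<partial>lborel)\<^sup>2)"
      using norm_fourier_le[OF f]
      by (auto simp: abs_mult gauss_multiplier_def intro!: mult_left_mono power_mono)
  qed measurable
  have tensor: "of_real ((norm (fourier f \<xi>))\<^sup>2) = (\<integral>w. cis (2 * pi * (\<xi> \<bullet> (snd w - fst w))) * ?H w \<partial>lborel)" for \<xi>
  proof -
    have "cnj (fourier f \<xi>) = (\<integral>z. cnj (f z) * cis (2 * pi * (\<xi> \<bullet> z)) \<partial>lborel)"
    proof -
      have "cnj (fourier f \<xi>) = (\<integral>z. cnj (f z * cis (- 2 * pi * (\<xi> \<bullet> z))) \<partial>lborel)"
        unfolding fourier_def by (rule Bochner_Integration.integral_cnj[symmetric])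
      then show ?thesis by (simp add: cis_cnj)
    qed
    then have "of_real ((norm (fourier f \<xi>))\<^sup>2) = fourier f \<xi> * (\<integral>z. cnj (f z) * cis (2 * pi * (\<xi> \<bullet> z)) \<partial>lborel)"
      by (metis complex_norm_square of_real_power)
    also have "\<dots> = (\<integral>w. (f (fst w) * cis (- 2 * pi * (\<xi> \<bullet> fst w))) * (cnj (f (snd w)) * cis (2 * pi * (\<xi> \<bullet> snd w))) \<partial>lborel)"
      unfolding fourier_def
      using integral_lborel_tensor[OF integrable_times_cis[OF f, of "- 2 * pi" \<xi>] integrable_times_cis[of "\<lambda>z. cnj (f z)" "2 * pi" \<xi>]] f
      by simp
    also have "\<dots> = (\<integral>w. cis (2 * pi * (\<xi> \<bullet> (snd w - fst w))) * ?H w \<partial>lborel)"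
    proof (rule Bochner_Integration.integral_cong)
      fix w :: "'a \<times> 'a"
      have "cis (2 * pi * (\<xi> \<bullet> (snd w - fst w))) = cis (- 2 * pi * (\<xi> \<bullet> fst w)) * cis (2 * pi * (\<xi> \<bullet> snd w))"
        by (simp add: cis_mult inner_diff_right algebra_simps)
      then show "(f (fst w) * cis (- 2 * pi * (\<xi> \<bullet> fst w))) * (cnj (f (snd w)) * cis (2 * pi * (\<xi> \<bullet> snd w)))
          = cis (2 * pi * (\<xi> \<bullet> (snd w - fst w))) * ?H w" by (simp only: mult_ac)
    qed simp
    finally show ?thesis .
  qed
  have cm: "(\<lambda>p::'a \<times> 'a \<times> 'a. cis (2 * pi * (fst p \<bullet> (snd (snd p) - fst (snd p))))) \<in> borel_measurable borel"
    by (intro borel_measurable_continuous_onI continuous_intros)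
  have Kint: "integrable lborel (\<lambda>p. ?K (fst p) (snd p))"
  proof (rule Bochner_Integration.integrable_bound)
    show "integrable lborel (\<lambda>p. of_real (gauss_multiplier \<epsilon> (fst p)) * ?H (snd p))"
      using integrable_lborel_tensor[OF integrable_of_real[OF gauss_multiplier_integrable[OF e]] H] .
    have "(\<lambda>p::'a \<times> 'a \<times> 'a. of_real (gauss_multiplier \<epsilon> (fst p)) * ?H (snd p)) \<in> borel_measurable (borel \<Otimes>\<^sub>M (borel \<Otimes>\<^sub>M borel))"
      by measurable
    from borel_measurable_times[OF this[unfolded borel_prod] cm]
    show "(\<lambda>p. ?K (fst p) (snd p)) \<in> borel_measurable lborel"
      by (simp add: scaleR_conv_of_real mult_ac)
  qed (auto simp: norm_mult)
  have "of_real (\<integral>\<xi>. gauss_multiplier \<epsilon> \<xi> * (norm (fourier f \<xi>))\<^sup>2 \<partial>lborel)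
      = (\<integral>\<xi>. \<integral>w. ?K \<xi> w \<partial>lborel \<partial>lborel)"
  proof -
    have "of_real (gauss_multiplier \<epsilon> \<xi> * (norm (fourier f \<xi>))\<^sup>2) = (\<integral>w. ?K \<xi> w \<partial>lborel)" for \<xi>
      unfolding of_real_mult tensor mult_scaleR_left scaleR_conv_of_real mult.assoc
      by (rule integral_mult_right_zero[symmetric])
    then show ?thesis by (subst integral_complex_of_real[symmetric]) simp
  qed
  also have "\<dots> = (\<integral>w. \<integral>\<xi>. ?K \<xi> w \<partial>lborel \<partial>lborel)"
    using Kint by (intro lborel_pair.Fubini_integral[symmetric]) (simp only: lborel_prod case_prod_beta')
  also have "\<dots> = (\<integral>w. of_real (?g w) * ?H w \<partial>lborel)"
  proof (rule Bochner_Integration.integral_cong)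
    fix w :: "'a \<times> 'a"
    have "(\<integral>\<xi>. ?K \<xi> w \<partial>lborel) = (\<integral>\<xi>. gauss_multiplier \<epsilon> \<xi> *\<^sub>R cis (2 * pi * (\<xi> \<bullet> (snd w - fst w))) \<partial>lborel) * ?H w"
      by (rule integral_mult_left_zero)
    then show "(\<integral>\<xi>. ?K \<xi> w \<partial>lborel) = of_real (?g w) * ?H w" by (simp only: gauss_fourier(2)[OF e])
  qed simp
  finally have main: "of_real (\<integral>\<xi>. gauss_multiplier \<epsilon> \<xi> * (norm (fourier f \<xi>))\<^sup>2 \<partial>lborel)
      = (\<integral>w. of_real (?g w) * ?H w \<partial>lborel)" .
  note corr = integrable_correlation[OF f2 gauss_integral(1)[OF e] gauss_minus]
    integral_correlation[OF f2 gauss_integral(1)[OF e] gauss_minus]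
  have Hg_meas: "(\<lambda>w. of_real (?g w) * ?H w) \<in> borel_measurable (borel \<Otimes>\<^sub>M borel)"
    by measurable
  have Hg: "integrable lborel (\<lambda>w. of_real (?g w) * ?H w)"
  proof (rule Bochner_Integration.integrable_bound)
    show "integrable lborel (\<lambda>w. (norm (f (fst w)))\<^sup>2 * ?g w + (norm (f (snd w)))\<^sup>2 * ?g w)"
      using corr by (intro Bochner_Integration.integrable_add)
    show "AE w in lborel. norm (of_real (?g w) * ?H w) \<le> norm ((norm (f (fst w)))\<^sup>2 * ?g w + (norm (f (snd w)))\<^sup>2 * ?g w)"
    proof (rule AE_I2)
      fix w :: "'a \<times> 'a"
      have "2 * (norm (f (fst w)) * norm (f (snd w))) \<le> (norm (f (fst w)))\<^sup>2 + (norm (f (snd w)))\<^sup>2"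
        using sum_squares_bound[of "norm (f (fst w))" "norm (f (snd w))"] by simp
      moreover have "0 \<le> norm (f (fst w)) * norm (f (snd w))" by simp
      ultimately have "norm (f (fst w)) * norm (f (snd w)) \<le> (norm (f (fst w)))\<^sup>2 + (norm (f (snd w)))\<^sup>2" by linarith
      from mult_right_mono[OF this gauss_nonneg[of \<epsilon> "snd w - fst w"]]
      show "norm (of_real (?g w) * ?H w) \<le> norm ((norm (f (fst w)))\<^sup>2 * ?g w + (norm (f (snd w)))\<^sup>2 * ?g w)"
        using gauss_nonneg[of \<epsilon> "snd w - fst w"] by (simp add: norm_mult algebra_simps)
    qed
  qed (use Hg_meas in \<open>simp only: borel_prod measurable_lborel2\<close>)
  have pointwise: "(norm (f (fst w) - f (snd w)))\<^sup>2 * ?g w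
      = ((norm (f (fst w)))\<^sup>2 * ?g w + (norm (f (snd w)))\<^sup>2 * ?g w) - 2 * Re (of_real (?g w) * ?H w)" for w
    unfolding norm_diff_squared_complex by (simp add: algebra_simps)
  have ReH: "integrable lborel (\<lambda>w. Re (of_real (?g w) * ?H w))"
    using Hg by (rule integrable_Re)
  have sum: "integrable lborel (\<lambda>w. (norm (f (fst w)))\<^sup>2 * ?g w + (norm (f (snd w)))\<^sup>2 * ?g w)"
    using corr by (intro Bochner_Integration.integrable_add)
  show "integrable lborel (\<lambda>w. (norm (f (fst w) - f (snd w)))\<^sup>2 * ?g w)"
    unfolding pointwise by (intro Bochner_Integration.integrable_diff sum integrable_mult_right ReH)
  have "(\<integral>w. (norm (f (fst w) - f (snd w)))\<^sup>2 * ?g w \<partial>lborel)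
      = (\<integral>w. (norm (f (fst w)))\<^sup>2 * ?g w + (norm (f (snd w)))\<^sup>2 * ?g w \<partial>lborel)
        - (\<integral>w. 2 * Re (of_real (?g w) * ?H w) \<partial>lborel)"
    unfolding pointwise by (rule Bochner_Integration.integral_diff[OF sum integrable_mult_right[OF ReH]])
  also have "(\<integral>w. (norm (f (fst w)))\<^sup>2 * ?g w + (norm (f (snd w)))\<^sup>2 * ?g w \<partial>lborel) = 2 * (\<integral>z. (norm (f z))\<^sup>2 \<partial>lborel)"
    using Bochner_Integration.integral_add[OF corr(1,2)] corr(3,4) gauss_integral(2)[OF e, where 'a='a] by simp
  also have "(\<integral>w. 2 * Re (of_real (?g w) * ?H w) \<partial>lborel) = 2 * Re (\<integral>w. of_real (?g w) * ?H w \<partial>lborel)"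
    using integral_Re[OF Hg] by (simp only: integral_mult_right_zero)
  also have "\<dots> = 2 * (\<integral>\<xi>. gauss_multiplier \<epsilon> \<xi> * (norm (fourier f \<xi>))\<^sup>2 \<partial>lborel)"
    by (simp only: main[symmetric] Re_complex_of_real)
  finally show "(\<integral>\<xi>. gauss_multiplier \<epsilon> \<xi> * (norm (fourier f \<xi>))\<^sup>2 \<partial>lborel)
      = (\<integral>z. (norm (f z))\<^sup>2 \<partial>lborel)
        - (\<integral>w. (norm (f (fst w) - f (snd w)))\<^sup>2 * ?g w \<partial>lborel) / 2" by linarith
qed

lemma regularized_plancherel_upper:
  fixes f :: "'a::euclidean_space \<Rightarrow> complex"
  assumes f: "integrable lborel f" and f2: "integrable lborel (\<lambda>z. (norm (f z))\<^sup>2)" and e: "\<epsilon> > 0"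
  shows "(\<integral>\<xi>. gauss_multiplier \<epsilon> \<xi> * (norm (fourier f \<xi>))\<^sup>2 \<partial>lborel) \<le> (\<integral>z. (norm (f z))\<^sup>2 \<partial>lborel)"
proof -
  have "0 \<le> (\<integral>w. (norm (f (fst w) - f (snd w)))\<^sup>2 * gauss \<epsilon> (snd w - fst w) \<partial>lborel)"
    by (intro integral_nonneg_AE AE_I2 mult_nonneg_nonneg gauss_nonneg) simp
  then show ?thesis using regularized_plancherel[OF assms] by simp
qed

text \<open>
For a Lipschitz function of compact support the correction term is controlled by the second moment of the Gaussian,
which is \<open>d \<epsilon>\<^sup>2\<close>.
\<close>

lemma regularized_plancherel_lower:
  fixes f :: "'a::euclidean_space \<Rightarrow> complex"
  assumes f: "integrable lborel f" and f2: "integrable lborel (\<lambda>z. (norm (f z))\<^sup>2)" and e: "\<epsilon> > 0"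
    and lip: "\<And>x y. norm (f x - f y) \<le> L * norm (x - y)" and supp: "\<And>x. norm x > M \<Longrightarrow> f x = 0"
  shows "(\<integral>z. (norm (f z))\<^sup>2 \<partial>lborel) - L\<^sup>2 * measure lborel (cball (0::'a) M) * (real DIM('a) * \<epsilon>\<^sup>2)
    \<le> (\<integral>\<xi>. gauss_multiplier \<epsilon> \<xi> * (norm (fourier f \<xi>))\<^sup>2 \<partial>lborel)"
proof -
  let ?I = "indicator (cball (0::'a) M) :: 'a \<Rightarrow> real"
  let ?k = "\<lambda>v::'a. (norm v)\<^sup>2 * gauss \<epsilon> v"
  have I: "integrable lborel ?I"
    using emeasure_bounded_finite[OF bounded_cball, of 0 M] by (intro integrable_real_indicator) auto
  have even: "?k (- v) = ?k v" for v by (simp add: gauss_minus)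
  note corr = integrable_correlation[OF I gauss_second_moment(1)[OF e] even]
    integral_correlation[OF I gauss_second_moment(1)[OF e] even]
  have "(\<integral>w. (norm (f (fst w) - f (snd w)))\<^sup>2 * gauss \<epsilon> (snd w - fst w) \<partial>lborel)
      \<le> (\<integral>w. L\<^sup>2 * (?I (fst w) * ?k (snd w - fst w) + ?I (snd w) * ?k (snd w - fst w)) \<partial>lborel)"
  proof (rule integral_mono)
    show "integrable lborel (\<lambda>w. L\<^sup>2 * (?I (fst w) * ?k (snd w - fst w) + ?I (snd w) * ?k (snd w - fst w)))"
      by (intro integrable_mult_right Bochner_Integration.integrable_add corr)
    fix w :: "'a \<times> 'a"
    have "(norm (f (fst w) - f (snd w)))\<^sup>2 \<le> L\<^sup>2 * (?I (fst w) + ?I (snd w)) * (norm (snd w - fst w))\<^sup>2"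
    proof (cases "norm (fst w) > M \<and> norm (snd w) > M")
      case True then show ?thesis using supp by simp
    next
      case False
      have "(norm (f (fst w) - f (snd w)))\<^sup>2 \<le> (L * norm (snd w - fst w))\<^sup>2"
        using lip[of "fst w" "snd w"] by (intro power_mono) (auto simp: norm_minus_commute)
      also have "\<dots> = L\<^sup>2 * 1 * (norm (snd w - fst w))\<^sup>2" by (simp add: power_mult_distrib)
      also have "\<dots> \<le> L\<^sup>2 * (?I (fst w) + ?I (snd w)) * (norm (snd w - fst w))\<^sup>2"
        using False by (intro mult_right_mono mult_left_mono) (auto simp: indicator_def)
      finally show ?thesis .
    qed
    from mult_right_mono[OF this gauss_nonneg[of \<epsilon> "snd w - fst w"]]
    show "(norm (f (fst w) - f (snd w)))\<^sup>2 * gauss \<epsilon> (snd w - fst w)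
        \<le> L\<^sup>2 * (?I (fst w) * ?k (snd w - fst w) + ?I (snd w) * ?k (snd w - fst w))"
      by (simp add: algebra_simps)
  qed (rule integrable_regularized_difference[OF f f2 e])
  also have "\<dots> = L\<^sup>2 * (2 * (measure lborel (cball (0::'a) M) * (real DIM('a) * \<epsilon>\<^sup>2)))"
    using Bochner_Integration.integral_add[OF corr(1,2)] corr(3,4) gauss_second_moment(2)[OF e, where 'a='a]
    by (simp only: integral_mult_right_zero) (simp add: emeasure_bounded_finite)
  finally show ?thesis using regularized_plancherel[OF f f2 e] by (simp add: algebra_simps)
qed

section \<open>Ingham inequality on a ball\<close>

lemma fourier_superposition:
  fixes x :: "'i \<Rightarrow> 'a::euclidean_space"
  assumes f: "integrable lborel f"
  shows "fourier (\<lambda>z. \<Sum>j\<in>U. u j * f (z - x j)) \<xi> = (\<Sum>j\<in>U. u j * cis (- 2 * pi * (\<xi> \<bullet> x j))) * fourier f \<xi>"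
proof -
  have shift: "integrable lborel (\<lambda>z. f (z - a) * cis (- 2 * pi * (\<xi> \<bullet> z)))"
      "(\<integral>z. f (z - a) * cis (- 2 * pi * (\<xi> \<bullet> z)) \<partial>lborel) = cis (- 2 * pi * (\<xi> \<bullet> a)) * fourier f \<xi>" for a
  proof -
    let ?h = "\<lambda>z. f z * cis (- 2 * pi * (\<xi> \<bullet> z))"
    have eq: "f (z - a) * cis (- 2 * pi * (\<xi> \<bullet> z)) = cis (- 2 * pi * (\<xi> \<bullet> a)) * ?h (z + - a)" for z
    proof -
      have "cis (- 2 * pi * (\<xi> \<bullet> z)) = cis (- 2 * pi * (\<xi> \<bullet> a)) * cis (- 2 * pi * (\<xi> \<bullet> (z + - a)))"
        by (simp add: cis_mult inner_diff_right algebra_simps)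
      then show ?thesis by simp
    qed
    have h: "integrable lborel ?h" by (rule integrable_times_cis[OF f])
    then show "integrable lborel (\<lambda>z. f (z - a) * cis (- 2 * pi * (\<xi> \<bullet> z)))"
      unfolding eq by (intro integrable_mult_right integrable_shift)
    show "(\<integral>z. f (z - a) * cis (- 2 * pi * (\<xi> \<bullet> z)) \<partial>lborel) = cis (- 2 * pi * (\<xi> \<bullet> a)) * fourier f \<xi>"
      unfolding eq fourier_def integral_mult_right_zero
      using integral_shift[of ?h "- a"] borel_measurable_integrable[OF h] by simp
  qed
  have "fourier (\<lambda>z. \<Sum>j\<in>U. u j * f (z - x j)) \<xi>
      = (\<integral>z. (\<Sum>j\<in>U. u j * (f (z - x j) * cis (- 2 * pi * (\<xi> \<bullet> z)))) \<partial>lborel)"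
    unfolding fourier_def by (simp add: sum_distrib_right mult.assoc)
  also have "\<dots> = (\<Sum>j\<in>U. \<integral>z. u j * (f (z - x j) * cis (- 2 * pi * (\<xi> \<bullet> z))) \<partial>lborel)"
    by (intro Bochner_Integration.integral_sum integrable_mult_right shift)
  also have "\<dots> = (\<Sum>j\<in>U. u j * cis (- 2 * pi * (\<xi> \<bullet> x j))) * fourier f \<xi>"
    unfolding integral_mult_right_zero shift(2) by (simp add: sum_distrib_right mult.assoc)
  finally show ?thesis .
qed

lemma integrable_superposition:
  fixes f :: "'a::euclidean_space \<Rightarrow> complex"
  assumes "integrable lborel f"
  shows "integrable lborel (\<lambda>z. \<Sum>j\<in>U. u j * f (z - x j))"
  using integrable_shift[OF assms, of "- x j" for j]
  by (intro Bochner_Integration.integrable_sum integrable_mult_right) simp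

text \<open>
At every point at most one of the translates is nonzero.
\<close>

lemma
  fixes f :: "'a::euclidean_space \<Rightarrow> complex"
  assumes U: "finite U" and supp: "\<And>z. norm z > \<rho> \<Longrightarrow> f z = 0"
    and sep: "\<And>i j. i \<in> U \<Longrightarrow> j \<in> U \<Longrightarrow> i \<noteq> j \<Longrightarrow> dist (x i) (x j) > 2 * \<rho>"
    and f2: "integrable lborel (\<lambda>z. (norm (f z))\<^sup>2)"
  shows integrable_superposition_squared: "integrable lborel (\<lambda>z. (norm (\<Sum>j\<in>U. u j * f (z - x j)))\<^sup>2)"
    and integral_superposition_squared: "(\<integral>z. (norm (\<Sum>j\<in>U. u j * f (z - x j)))\<^sup>2 \<partial>lborel)
      = (\<Sum>j\<in>U. (norm (u j))\<^sup>2) * (\<integral>z. (norm (f z))\<^sup>2 \<partial>lborel)"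
proof -
  have eq: "(norm (\<Sum>j\<in>U. u j * f (z - x j)))\<^sup>2 = (\<Sum>j\<in>U. (norm (u j))\<^sup>2 * (norm (f (z - x j)))\<^sup>2)" for z
  proof (cases "\<exists>j\<in>U. norm (z - x j) \<le> \<rho>")
    case True
    then obtain j where j: "j \<in> U" "norm (z - x j) \<le> \<rho>" by blast
    have z: "f (z - x i) = 0" if "i \<in> U" "i \<noteq> j" for i
    proof (rule supp, rule ccontr)
      assume "\<not> norm (z - x i) > \<rho>"
      then have "dist (x i) (x j) \<le> 2 * \<rho>"
        using j(2) dist_triangle[of "x i" "x j" z] by (simp add: dist_norm norm_minus_commute)
      then show False using sep[OF that(1) j(1) that(2)] by simp
    qed
    have "(\<Sum>i\<in>U. u i * f (z - x i)) = u j * f (z - x j)"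
      using z U j(1) by (subst sum.remove[OF U j(1)]) simp
    moreover have "(\<Sum>i\<in>U. (norm (u i))\<^sup>2 * (norm (f (z - x i)))\<^sup>2) = (norm (u j))\<^sup>2 * (norm (f (z - x j)))\<^sup>2"
      using z U j(1) by (subst sum.remove[OF U j(1)]) simp
    ultimately show ?thesis by (simp add: norm_mult power_mult_distrib)
  next
    case False
    then have "f (z - x j) = 0" if "j \<in> U" for j using that by (intro supp) auto
    then show ?thesis by simp
  qed
  have i: "integrable lborel (\<lambda>z. (norm (f (z - a)))\<^sup>2)" "(\<integral>z. (norm (f (z - a)))\<^sup>2 \<partial>lborel) = (\<integral>z. (norm (f z))\<^sup>2 \<partial>lborel)" for a
    using integrable_shift[OF f2, of "- a"] integral_shift[of "\<lambda>z. (norm (f z))\<^sup>2" "- a"] borel_measurable_integrable[OF f2]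
    by simp_all
  show "integrable lborel (\<lambda>z. (norm (\<Sum>j\<in>U. u j * f (z - x j)))\<^sup>2)"
    unfolding eq by (intro Bochner_Integration.integrable_sum integrable_mult_right i)
  have "(\<integral>z. (norm (\<Sum>j\<in>U. u j * f (z - x j)))\<^sup>2 \<partial>lborel) = (\<Sum>j\<in>U. \<integral>z. (norm (u j))\<^sup>2 * (norm (f (z - x j)))\<^sup>2 \<partial>lborel)"
    unfolding eq by (intro Bochner_Integration.integral_sum integrable_mult_right i)
  then show "(\<integral>z. (norm (\<Sum>j\<in>U. u j * f (z - x j)))\<^sup>2 \<partial>lborel)
      = (\<Sum>j\<in>U. (norm (u j))\<^sup>2) * (\<integral>z. (norm (f z))\<^sup>2 \<partial>lborel)"
    by (simp add: i(2) sum_distrib_right)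
qed

text \<open>
Ingham's inequality with the weight \<open>1 - |\<xi>|\<^sup>2/R\<^sup>2\<close>. The Gaussian regularization replaces the decay of the
Fourier transform of the bump at infinity: for the superposition \<open>\<Phi>\<close> of bumps a lower bound that is exact in the
limit is needed, and for its derivatives \<open>\<Psi>\<close> the upper bound suffices. Inside the ball the integrand is nonnegative
and the Gaussian factor is at most \<open>1\<close>; outside the ball the integrand is at most \<open>0\<close> and is dropped.
\<close>

lemma ingham_ball:
  fixes x :: "'i \<Rightarrow> 'a::euclidean_space" and R \<rho> :: real
  defines "N \<equiv> real DIM('a) / 2" and "b \<equiv> pi * R"
  defines "c \<equiv> bessel_clifford N ((b * \<rho>)\<^sup>2)"
  defines "A \<equiv> \<integral>z. indicator (cball (0::'a) \<rho>) z * bump_profile b c z \<partial>lborel"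
  assumes U: "finite U" and sep: "\<And>i j. i \<in> U \<Longrightarrow> j \<in> U \<Longrightarrow> i \<noteq> j \<Longrightarrow> dist (x i) (x j) > 2 * \<rho>"
    and R: "R > 0" and rho: "\<rho> \<ge> 0" and c: "c < 0" and min: "\<And>t. 0 \<le> t \<Longrightarrow> t \<le> (b * \<rho>)\<^sup>2 \<Longrightarrow> c \<le> bessel_clifford N t"
    and A: "A > 0"
  shows "(\<Sum>j\<in>U. (norm (u j))\<^sup>2) / A
    \<le> (\<integral>\<xi>. indicator (cball 0 R) \<xi> * ((1 - (norm \<xi> / R)\<^sup>2) * (norm (\<Sum>j\<in>U. u j * cis (- 2 * pi * (\<xi> \<bullet> x j))))\<^sup>2) \<partial>lborel)"
proof -
  let ?I = "indicator (cball (0::'a) \<rho>) :: 'a \<Rightarrow> real"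
  let ?p = "bump_profile b c :: 'a \<Rightarrow> real" and ?d = "bump_profile_deriv b c :: 'a \<Rightarrow> 'a \<Rightarrow> real"
  define G where "G z = complex_of_real (?I z * ?p z)" for z
  define Gd where "Gd v z = complex_of_real (?I z * ?d z v)" for v z
  define \<Phi> where "\<Phi> z = (\<Sum>j\<in>U. u j * G (z - x j))" for z
  define \<Psi> where "\<Psi> v z = (\<Sum>j\<in>U. u j * Gd v (z - x j))" for v z
  define F where "F \<xi> = (\<Sum>j\<in>U. u j * cis (- 2 * pi * (\<xi> \<bullet> x j)))" for \<xi>
  define S where "S = (\<Sum>j\<in>U. (norm (u j))\<^sup>2)"
  have contp: "continuous_on UNIV ?p" "continuous_on UNIV (\<lambda>z. ?d z v)" for v
    by (intro continuous_intros)+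
  have int: "integrable lborel (\<lambda>z. ?I z * f z)" if "continuous_on UNIV f" for f
    using integrable_ball_continuous[OF that] by simp
  have G_int: "integrable lborel G" "integrable lborel (Gd v)" for v
    unfolding G_def[abs_def] Gd_def[abs_def] using contp by (intro integrable_of_real int; simp)+
  have Isq: "(?I z * a)\<^sup>2 = ?I z * a\<^sup>2" for z a by (simp add: indicator_def)
  have G2: "(norm (G z))\<^sup>2 = ?I z * (?p z)\<^sup>2" "(norm (Gd v z))\<^sup>2 = ?I z * (?d z v)\<^sup>2" for v z
    unfolding G_def Gd_def norm_of_real by (simp_all add: Isq)
  have G2_int: "integrable lborel (\<lambda>z. (norm (G z))\<^sup>2)" "integrable lborel (\<lambda>z. (norm (Gd v z))\<^sup>2)" for v
    unfolding G2 using contp by (auto intro!: int continuous_intros)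
  have G_supp: "G z = 0" "Gd v z = 0" if "norm z > \<rho>" for v z using that by (auto simp: G_def Gd_def)
  have p_nonneg: "?p z \<ge> 0" if "norm z \<le> \<rho>" for z
  proof -
    have "b\<^sup>2 * (z \<bullet> z) \<le> (b * \<rho>)\<^sup>2"
      using that rho by (simp add: power2_norm_eq_inner[symmetric] power_mult_distrib mult_left_mono power_mono)
    then have "c \<le> bessel_clifford N (b\<^sup>2 * (z \<bullet> z))" by (intro min) auto
    then show ?thesis using c by (simp add: bump_profile_def N_def divide_le_eq)
  qed
  have G_fourier_bound: "norm (fourier G \<xi>) \<le> A" for \<xi>
  proof -
    have "norm (G z) = ?I z * ?p z" for z using p_nonneg[of z] by (auto simp: G_def indicator_def)
    then show ?thesis using norm_fourier_le[OF G_int(1), of \<xi>] by (simp add: A_def)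
  qed
  have Gd_fourier: "fourier (Gd v) \<xi> = of_real (2 * pi * (\<xi> \<bullet> v)) * \<i> * fourier G \<xi>" for v \<xi>
  proof -
    have "(\<lambda>z. Gd v z * cis (- 2 * pi * (\<xi> \<bullet> z))) = (\<lambda>z. ?I z *\<^sub>R (?d z v *\<^sub>R cis (- 2 * pi * (\<xi> \<bullet> z))))"
      "(\<lambda>z. G z * cis (- 2 * pi * (\<xi> \<bullet> z))) = (\<lambda>z. ?I z *\<^sub>R (?p z *\<^sub>R cis (- 2 * pi * (\<xi> \<bullet> z))))"
      by (simp_all add: Gd_def G_def scaleR_conv_of_real fun_eq_iff)
    then show ?thesis
      unfolding fourier_def using fourier_bump_deriv[of b \<rho> v \<xi>] c
      by (simp add: c_def N_def scaleR_conv_of_real mult.assoc)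
  qed
  have \<Phi>_fourier: "fourier \<Phi> \<xi> = F \<xi> * fourier G \<xi>" for \<xi>
    unfolding \<Phi>_def[abs_def] F_def by (rule fourier_superposition[OF G_int(1)])
  have \<Psi>_fourier: "(norm (fourier (\<Psi> v) \<xi>))\<^sup>2 = 4 * pi\<^sup>2 * (\<xi> \<bullet> v)\<^sup>2 * (norm (fourier \<Phi> \<xi>))\<^sup>2" for v \<xi>
  proof -
    have "fourier (\<Psi> v) \<xi> = F \<xi> * fourier (Gd v) \<xi>"
      unfolding \<Psi>_def[abs_def] F_def by (rule fourier_superposition[OF G_int(2)])
    then have "norm (fourier (\<Psi> v) \<xi>) = norm (2 * pi * (\<xi> \<bullet> v)) * norm (fourier \<Phi> \<xi>)"
      by (simp add: \<Phi>_fourier Gd_fourier norm_mult abs_mult)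
    then show ?thesis by (simp add: power_mult_distrib)
  qed
  have \<Phi>_int: "integrable lborel \<Phi>" "integrable lborel (\<lambda>z. (norm (\<Phi> z))\<^sup>2)"
    "integrable lborel (\<Psi> v)" "integrable lborel (\<lambda>z. (norm (\<Psi> v z))\<^sup>2)" for v
    unfolding \<Phi>_def[abs_def] \<Psi>_def[abs_def]
    by (intro integrable_superposition G_int integrable_superposition_squared[OF U G_supp(1) sep G2_int(1)]
        integrable_superposition_squared[OF U G_supp(2) sep G2_int(2)]; assumption)+
  define P where "P = (\<integral>z. ?I z * (?p z)\<^sup>2 \<partial>lborel)"
  have \<Phi>_norm: "(\<integral>z. (norm (\<Phi> z))\<^sup>2 \<partial>lborel) = S * P"
    unfolding \<Phi>_def S_def P_def using integral_superposition_squared[OF U G_supp(1) sep G2_int(1)] by (simp add: G2)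
  have \<Psi>_norm: "(\<Sum>v\<in>Basis. \<integral>z. (norm (\<Psi> v z))\<^sup>2 \<partial>lborel) = S * (4 * b\<^sup>2 * (P - A))"
  proof -
    have "(\<integral>z. (norm (\<Psi> v z))\<^sup>2 \<partial>lborel) = S * (\<integral>z. ?I z * (?d z v)\<^sup>2 \<partial>lborel)" for v
      unfolding \<Psi>_def S_def using integral_superposition_squared[OF U G_supp(2) sep G2_int(2)] by (simp add: G2)
    then show ?thesis
      using bump_energy_identity[where 'a='a, of b \<rho>] c
      by (simp add: sum_distrib_left[symmetric] P_def A_def c_def N_def)
  qed
  obtain L M where L: "\<And>y z. norm (\<Phi> y - \<Phi> z) \<le> L * norm (y - z)" and M: "\<And>z. norm z > M \<Longrightarrow> \<Phi> z = 0"
  proof -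
    obtain K where K: "K \<ge> 0" "\<And>y z. norm y \<le> \<rho> \<Longrightarrow> norm z \<le> \<rho> \<Longrightarrow> norm (?p y - ?p z) \<le> K * norm (y - z)"
      using lipschitz_on_cball_if_C1[OF bump_profile_has_derivative contp(2)] by blast
    have bd: "?p z = 0" if "norm z = \<rho>" for z :: 'a
    proof -
      have "b\<^sup>2 * (z \<bullet> z) = (b * \<rho>)\<^sup>2" using that by (simp add: power2_norm_eq_inner[symmetric] power_mult_distrib)
      then show ?thesis using c by (simp add: bump_profile_def c_def N_def)
    qed
    have G_lip: "norm (G y - G z) \<le> K * norm (y - z)" for y z
    proof -
      have "?I y * ?p y = (if norm y \<le> \<rho> then ?p y else 0)" for y by simp
      then show ?thesis
        using lipschitz_extension_by_zero[OF K(2) bd K(1), where x=y and y=z]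
        unfolding G_def of_real_diff[symmetric] norm_of_real by simp
    qed
    have "norm (\<Phi> y - \<Phi> z) \<le> (\<Sum>j\<in>U. norm (u j) * K) * norm (y - z)" for y z
    proof -
      have "\<Phi> y - \<Phi> z = (\<Sum>j\<in>U. u j * (G (y - x j) - G (z - x j)))"
        unfolding \<Phi>_def by (simp add: sum_subtractf right_diff_distrib)
      also have "norm \<dots> \<le> (\<Sum>j\<in>U. norm (u j) * (K * norm (y - z)))"
        using G_lip[of "y - x j" "z - x j" for j]
        by (intro sum_norm_le) (auto simp: norm_mult intro!: mult_left_mono)
      finally show ?thesis by (simp add: sum_distrib_right mult.assoc)
    qed
    moreover have "\<Phi> z = 0" if "norm z > \<rho> + (\<Sum>j\<in>U. norm (x j))" for z
    proof -
      have "norm (z - x j) > \<rho>" if "j \<in> U" for j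
      proof -
        have "norm (x j) \<le> (\<Sum>j\<in>U. norm (x j))" using U that by (intro member_le_sum) auto
        then show ?thesis using \<open>norm z > _\<close> norm_triangle_ineq2[of z "x j"] by simp
      qed
      then show ?thesis by (simp add: \<Phi>_def G_supp)
    qed
    ultimately show ?thesis using that by blast
  qed
  define E where "E = L\<^sup>2 * measure lborel (cball (0::'a) M) * real DIM('a)"
  have E: "E \<ge> 0" by (simp add: E_def)
  let ?B = "\<lambda>\<xi>. indicator (cball 0 R) \<xi> * ((R\<^sup>2 - (norm \<xi>)\<^sup>2) * (norm (F \<xi>))\<^sup>2)"
  have contF: "continuous_on UNIV F" unfolding F_def[abs_def] by (intro continuous_intros)
  have B_int: "integrable lborel ?B"
    by (rule integrable_ball_continuous[where 'b=real, simplified]) (intro continuous_intros contF)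
  have approx: "R\<^sup>2 * A * S - R\<^sup>2 * E * \<epsilon>\<^sup>2 \<le> A\<^sup>2 * (\<integral>\<xi>. ?B \<xi> \<partial>lborel)" if e: "\<epsilon> > 0" for \<epsilon>
  proof -
    let ?g = "gauss_multiplier \<epsilon> :: 'a \<Rightarrow> real"
    let ?q = "\<lambda>\<xi>. ?g \<xi> * (norm (fourier \<Phi> \<xi>))\<^sup>2"
    let ?r = "\<lambda>v \<xi>. ?g \<xi> * (norm (fourier (\<Psi> v) \<xi>))\<^sup>2"
    have iq: "integrable lborel ?q" "integrable lborel (?r v)" for v
      by (intro integrable_regularized_fourier \<Phi>_int e)+
    have eq: "R\<^sup>2 * ?q \<xi> - (1 / (4 * pi\<^sup>2)) * (\<Sum>v\<in>Basis. ?r v \<xi>) = (R\<^sup>2 - (norm \<xi>)\<^sup>2) * ?q \<xi>" for \<xi>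
    proof -
      have "(\<Sum>v\<in>Basis. ?r v \<xi>) = 4 * pi\<^sup>2 * ?q \<xi> * (\<Sum>v\<in>Basis. (\<xi> \<bullet> v) * (\<xi> \<bullet> v))"
        unfolding \<Psi>_fourier by (simp add: sum_distrib_left power2_eq_square mult_ac)
      also have "(\<Sum>v\<in>Basis. (\<xi> \<bullet> v) * (\<xi> \<bullet> v)) = (norm \<xi>)\<^sup>2"
        unfolding power2_norm_eq_inner euclidean_inner[of \<xi> \<xi>] ..
      finally show ?thesis by (simp add: algebra_simps)
    qed
    have "R\<^sup>2 * A * S - R\<^sup>2 * E * \<epsilon>\<^sup>2 = R\<^sup>2 * (S * P - E * \<epsilon>\<^sup>2) - (1 / (4 * pi\<^sup>2)) * (S * (4 * b\<^sup>2 * (P - A)))"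
      by (simp add: b_def power_mult_distrib algebra_simps)
    also have "\<dots> \<le> R\<^sup>2 * (\<integral>\<xi>. ?q \<xi> \<partial>lborel) - (1 / (4 * pi\<^sup>2)) * (\<Sum>v\<in>Basis. \<integral>\<xi>. ?r v \<xi> \<partial>lborel)"
    proof (intro diff_mono mult_left_mono)
      show "S * P - E * \<epsilon>\<^sup>2 \<le> (\<integral>\<xi>. ?q \<xi> \<partial>lborel)"
        using regularized_plancherel_lower[OF \<Phi>_int(1,2) e L M] by (simp add: \<Phi>_norm E_def mult.assoc)
      show "(\<Sum>v\<in>Basis. \<integral>\<xi>. ?r v \<xi> \<partial>lborel) \<le> S * (4 * b\<^sup>2 * (P - A))"
        unfolding \<Psi>_norm[symmetric] by (intro sum_mono regularized_plancherel_upper \<Phi>_int e)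
    qed auto
    also have "\<dots> = (\<integral>\<xi>. (R\<^sup>2 - (norm \<xi>)\<^sup>2) * ?q \<xi> \<partial>lborel)"
    proof -
      have i1: "integrable lborel (\<lambda>\<xi>. R\<^sup>2 * ?q \<xi>)" using iq(1) by (rule integrable_mult_right)
      have i2: "integrable lborel (\<lambda>\<xi>. (1 / (4 * pi\<^sup>2)) * (\<Sum>v\<in>Basis. ?r v \<xi>))"
        using iq(2) by (intro integrable_mult_right Bochner_Integration.integrable_sum)
      show ?thesis
        using Bochner_Integration.integral_diff[OF i1 i2] Bochner_Integration.integral_sum[where I="Basis::'a set", OF iq(2)]
        by (simp only: eq integral_mult_right_zero)
    qed
    also have "\<dots> \<le> (\<integral>\<xi>. A\<^sup>2 * ?B \<xi> \<partial>lborel)"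
    proof (rule integral_mono)
      have "integrable lborel (\<lambda>\<xi>. R\<^sup>2 * ?q \<xi> - (1 / (4 * pi\<^sup>2)) * (\<Sum>v\<in>Basis. ?r v \<xi>))"
        using iq by (intro Bochner_Integration.integrable_diff integrable_mult_right Bochner_Integration.integrable_sum)
      then show "integrable lborel (\<lambda>\<xi>. (R\<^sup>2 - (norm \<xi>)\<^sup>2) * ?q \<xi>)" unfolding eq .
      show "integrable lborel (\<lambda>\<xi>. A\<^sup>2 * ?B \<xi>)" using B_int by (rule integrable_mult_right)
      fix \<xi> :: 'a
      show "(R\<^sup>2 - (norm \<xi>)\<^sup>2) * ?q \<xi> \<le> A\<^sup>2 * ?B \<xi>"
      proof (cases "norm \<xi> \<le> R")
        case True
        have "?q \<xi> \<le> 1 * (norm (F \<xi>) * A)\<^sup>2"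
          using G_fourier_bound[of \<xi>] unfolding \<Phi>_fourier norm_mult
          by (intro mult_mono power_mono mult_left_mono) (auto simp: gauss_multiplier_def)
        moreover have "0 \<le> R\<^sup>2 - (norm \<xi>)\<^sup>2" using True by (simp add: power_mono)
        ultimately have "(R\<^sup>2 - (norm \<xi>)\<^sup>2) * ?q \<xi> \<le> (R\<^sup>2 - (norm \<xi>)\<^sup>2) * (1 * (norm (F \<xi>) * A)\<^sup>2)"
          by (rule mult_left_mono)
        then show ?thesis using True by (simp add: power_mult_distrib mult_ac)
      next
        case False
        then have "R\<^sup>2 - (norm \<xi>)\<^sup>2 \<le> 0" using R by (simp add: power_mono)
        then have "(R\<^sup>2 - (norm \<xi>)\<^sup>2) * ?q \<xi> \<le> 0"
          by (intro mult_nonpos_nonneg mult_nonneg_nonneg) (auto simp: gauss_multiplier_def)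
        then show ?thesis using False by simp
      qed
    qed
    finally show ?thesis by simp
  qed
  have "R\<^sup>2 * A * S \<le> A\<^sup>2 * (\<integral>\<xi>. ?B \<xi> \<partial>lborel)"
  proof (rule field_le_epsilon)
    fix e :: real assume e: "e > 0"
    define \<epsilon> where "\<epsilon> = sqrt (e / (R\<^sup>2 * E + 1))"
    have pos: "R\<^sup>2 * E + 1 > 0" using E by (simp add: add_nonneg_pos)
    then have "\<epsilon> > 0" "\<epsilon>\<^sup>2 = e / (R\<^sup>2 * E + 1)" using e by (auto simp: \<epsilon>_def)
    moreover have "R\<^sup>2 * E * (e / (R\<^sup>2 * E + 1)) \<le> e" using pos e by (simp add: field_simps)
    ultimately show "R\<^sup>2 * A * S \<le> A\<^sup>2 * (\<integral>\<xi>. ?B \<xi> \<partial>lborel) + e" using approx[of \<epsilon>] by simp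
  qed
  then have "A * (R\<^sup>2 * S) \<le> A * (A * (\<integral>\<xi>. ?B \<xi> \<partial>lborel))" by (simp add: power2_eq_square mult_ac)
  then have "R\<^sup>2 * S \<le> A * (\<integral>\<xi>. ?B \<xi> \<partial>lborel)" using A by simp
  then have "S / A \<le> (\<integral>\<xi>. ?B \<xi> \<partial>lborel) * (1 / R\<^sup>2)" using A R by (simp add: field_simps)
  also have "\<dots> = (\<integral>\<xi>. ?B \<xi> * (1 / R\<^sup>2) \<partial>lborel)" by (rule integral_mult_left_zero[symmetric])
  also have "(\<lambda>\<xi>. ?B \<xi> * (1 / R\<^sup>2)) = (\<lambda>\<xi>. indicator (cball 0 R) \<xi> * ((1 - (norm \<xi> / R)\<^sup>2) * (norm (F \<xi>))\<^sup>2))"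
    using R by (auto simp: fun_eq_iff field_simps)
  finally show ?thesis unfolding S_def F_def .
qed

section \<open>Fourier multipliers between balls\<close>

definition trig_sum :: "('s::finite \<Rightarrow> 'a::euclidean_space) \<Rightarrow> ('s \<Rightarrow> complex) \<Rightarrow> 'a \<Rightarrow> complex" where
  "trig_sum x u \<xi> = (\<Sum>k\<in>UNIV. u k * cis (- 2 * pi * (\<xi> \<bullet> x k)))"

definition energy :: "('s::finite \<Rightarrow> 'a::euclidean_space) \<Rightarrow> 'a set \<Rightarrow> ('s \<Rightarrow> complex) \<Rightarrow> real" where
  "energy x E u = (\<integral>\<xi>. indicator E \<xi> * (norm (trig_sum x u \<xi>))\<^sup>2 \<partial>lborel)"

text \<open>
\<open>\<mu>\<close> is the multiplier of an operator that commutes with translations; the operator maps functions on \<open>E'\<close> to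
functions on \<open>E\<close> with squared norm at most \<open>\<kappa>\<close>. Only its effect on the coefficients of the exponentials
matters.
\<close>

definition multiplier_bound ::
    "('s::finite \<Rightarrow> 'a::euclidean_space) \<Rightarrow> 'a set \<Rightarrow> 'a set \<Rightarrow> real \<Rightarrow> ('s \<Rightarrow> complex) \<Rightarrow> bool" where
  "multiplier_bound x E E' \<kappa> \<mu> \<longleftrightarrow> (\<forall>u. energy x E (\<lambda>k. \<mu> k * u k) \<le> \<kappa> * energy x E' u)"

lemma continuous_on_trig_sum [continuous_intros]:
  "continuous_on A f \<Longrightarrow> continuous_on A (\<lambda>z. trig_sum x u (f z))"
  unfolding trig_sum_def by (intro continuous_intros)

lemma trig_sum_measurable [measurable]: "trig_sum x u \<in> borel_measurable borel"
  by (intro borel_measurable_continuous_onI continuous_intros)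

lemma norm_trig_sum_le: "norm (trig_sum x u \<xi>) \<le> (\<Sum>k\<in>UNIV. norm (u k))"
  unfolding trig_sum_def by (intro order_trans[OF norm_sum] sum_mono) (simp add: norm_mult)

lemma integrable_energy_shifted:
  assumes "compact E"
  shows "integrable lborel (\<lambda>\<xi>. indicator E \<xi> * (norm (trig_sum x u (\<xi> + a)))\<^sup>2)"
proof -
  have "continuous_on E (\<lambda>\<xi>. (norm (trig_sum x u (\<xi> + a)))\<^sup>2)" by (intro continuous_intros)
  from borel_integrable_compact[OF assms this] show ?thesis by simp
qed

lemmas integrable_energy = integrable_energy_shifted[where a=0, simplified]

lemma energy_shifted_le:
  assumes E: "compact E" "compact E'" and sub: "\<And>\<xi>. \<xi> \<in> E \<Longrightarrow> \<xi> + a \<in> E'"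
  shows "(\<integral>\<xi>. indicator E \<xi> * (norm (trig_sum x u (\<xi> + a)))\<^sup>2 \<partial>lborel) \<le> energy x E' u"
proof -
  let ?f = "\<lambda>\<xi>. indicator E' \<xi> * (norm (trig_sum x u \<xi>))\<^sup>2"
  have f: "integrable lborel ?f" by (rule integrable_energy[OF E(2)])
  have "(\<integral>\<xi>. indicator E \<xi> * (norm (trig_sum x u (\<xi> + a)))\<^sup>2 \<partial>lborel) \<le> (\<integral>\<xi>. ?f (\<xi> + a) \<partial>lborel)"
    using sub by (intro integral_mono integrable_energy_shifted E integrable_shift[OF f]) (auto simp: indicator_def)
  also have "\<dots> = energy x E' u"
    using integral_shift[of ?f a] borel_measurable_integrable[OF f] by (simp add: energy_def)
  finally show ?thesis .
qed

lemma energy_mono: "compact E \<Longrightarrow> compact E' \<Longrightarrow> E \<subseteq> E' \<Longrightarrow> energy x E u \<le> energy x E' u"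
  using energy_shifted_le[of E E' 0 x u] by (auto simp: energy_def)

lemma energy_nonneg: "energy x E u \<ge> 0"
  by (simp add: energy_def)

lemma multiplier_bound_comp:
  assumes "multiplier_bound x E1 E2 \<kappa>1 \<mu>1" "multiplier_bound x E2 E3 \<kappa>2 \<mu>2" "\<kappa>1 \<ge> 0"
  shows "multiplier_bound x E1 E3 (\<kappa>1 * \<kappa>2) (\<lambda>k. \<mu>1 k * \<mu>2 k)"
  unfolding multiplier_bound_def
proof
  fix u
  have "energy x E1 (\<lambda>k. \<mu>1 k * (\<mu>2 k * u k)) \<le> \<kappa>1 * energy x E2 (\<lambda>k. \<mu>2 k * u k)"
    using assms(1) by (simp add: multiplier_bound_def)
  also have "\<dots> \<le> \<kappa>1 * (\<kappa>2 * energy x E3 u)"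
    using assms by (intro mult_left_mono) (auto simp: multiplier_bound_def)
  finally show "energy x E1 (\<lambda>k. \<mu>1 k * \<mu>2 k * u k) \<le> \<kappa>1 * \<kappa>2 * energy x E3 u"
    by (simp add: mult.assoc)
qed

lemma multiplier_bound_mono:
  assumes "compact E1" "compact E2" "E1 \<subseteq> E2"
  shows "multiplier_bound x E1 E2 1 (\<lambda>_. 1)"
  by (simp add: multiplier_bound_def energy_mono assms)

text \<open>
The operator \<open>F \<mapsto> (F(\<xi> - a) exp(-2\<pi>i a\<bullet>y) - F(\<xi> + a) exp(2\<pi>i a\<bullet>y))/2i\<close>. Taking the difference of the two
opposite translates enlarges a ball only by \<open>|a|\<close>.
\<close>

lemma multiplier_bound_sine:
  assumes E: "compact E" "compact E'" and sub: "\<And>\<xi>. \<xi> \<in> E \<Longrightarrow> \<xi> + a \<in> E'" "\<And>\<xi>. \<xi> \<in> E \<Longrightarrow> \<xi> - a \<in> E'"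
  shows "multiplier_bound x E E' 1 (\<lambda>k. of_real (sin (2 * pi * (a \<bullet> (x k - y)))))"
  unfolding multiplier_bound_def
proof
  fix u
  let ?F = "trig_sum x u" and ?T = "trig_sum x (\<lambda>k. of_real (sin (2 * pi * (a \<bullet> (x k - y)))) * u k)"
  let ?c = "cis (- 2 * pi * (a \<bullet> y))" and ?c' = "cis (2 * pi * (a \<bullet> y))"
  have T: "2 * \<i> * ?T \<xi> = ?c * ?F (\<xi> + - a) - ?c' * ?F (\<xi> + a)" for \<xi>
  proof -
    have "2 * \<i> * of_real (sin t) = cis t - cis (- t)" for t by (simp add: complex_eq_iff)
    then have "2 * \<i> * ?T \<xi> = (\<Sum>k\<in>UNIV. (cis (2 * pi * (a \<bullet> (x k - y))) - cis (- (2 * pi * (a \<bullet> (x k - y))))) * (u k * cis (- 2 * pi * (\<xi> \<bullet> x k))))"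
      unfolding trig_sum_def sum_distrib_left by (intro sum.cong refl) (metis mult.assoc)
    also have "\<dots> = (\<Sum>k\<in>UNIV. ?c * (u k * cis (- 2 * pi * ((\<xi> + - a) \<bullet> x k))) - ?c' * (u k * cis (- 2 * pi * ((\<xi> + a) \<bullet> x k))))"
    proof (rule sum.cong)
      fix k
      have "cis (2 * pi * (a \<bullet> (x k - y))) * cis (- 2 * pi * (\<xi> \<bullet> x k)) = ?c * cis (- 2 * pi * ((\<xi> + - a) \<bullet> x k))"
        "cis (- (2 * pi * (a \<bullet> (x k - y)))) * cis (- 2 * pi * (\<xi> \<bullet> x k)) = ?c' * cis (- 2 * pi * ((\<xi> + a) \<bullet> x k))"
        by (simp_all add: cis_mult inner_diff_right inner_diff_left inner_add_left algebra_simps)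
      then show "(cis (2 * pi * (a \<bullet> (x k - y))) - cis (- (2 * pi * (a \<bullet> (x k - y))))) * (u k * cis (- 2 * pi * (\<xi> \<bullet> x k)))
          = ?c * (u k * cis (- 2 * pi * ((\<xi> + - a) \<bullet> x k))) - ?c' * (u k * cis (- 2 * pi * ((\<xi> + a) \<bullet> x k)))"
        by (simp only: left_diff_distrib right_diff_distrib mult.left_commute)
    qed simp
    finally show ?thesis unfolding trig_sum_def sum_subtractf sum_distrib_left .
  qed
  have bound: "(norm (?T \<xi>))\<^sup>2 \<le> ((norm (?F (\<xi> + - a)))\<^sup>2 + (norm (?F (\<xi> + a)))\<^sup>2) / 2" for \<xi>
  proof -
    have "2 * norm (?T \<xi>) = norm (2 * \<i> * ?T \<xi>)" by (simp add: norm_mult)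
    also have "\<dots> \<le> norm (?F (\<xi> + - a)) + norm (?F (\<xi> + a))"
      unfolding T using norm_triangle_ineq4[of "?c * ?F (\<xi> + - a)" "?c' * ?F (\<xi> + a)"] by (simp add: norm_mult)
    finally have "(2 * norm (?T \<xi>))\<^sup>2 \<le> (norm (?F (\<xi> + - a)) + norm (?F (\<xi> + a)))\<^sup>2" by (intro power_mono) auto
    moreover have "(p + q)\<^sup>2 \<le> 2 * (p\<^sup>2 + q\<^sup>2)" for p q :: real
      using sum_squares_bound[of p q] by (simp add: power2_sum)
    ultimately have "(2 * norm (?T \<xi>))\<^sup>2 \<le> 2 * ((norm (?F (\<xi> + - a)))\<^sup>2 + (norm (?F (\<xi> + a)))\<^sup>2)"
      using order_trans by blast
    then show ?thesis by (simp add: power_mult_distrib)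
  qed
  let ?s = "\<lambda>a \<xi>. indicator E \<xi> * (norm (?F (\<xi> + a)))\<^sup>2"
  have "energy x E (\<lambda>k. of_real (sin (2 * pi * (a \<bullet> (x k - y)))) * u k) \<le> (\<integral>\<xi>. (?s (- a) \<xi> + ?s a \<xi>) / 2 \<partial>lborel)"
    unfolding energy_def
  proof (rule integral_mono)
    fix \<xi>
    have "indicator E \<xi> * (norm (?T \<xi>))\<^sup>2 \<le> indicator E \<xi> * (((norm (?F (\<xi> + - a)))\<^sup>2 + (norm (?F (\<xi> + a)))\<^sup>2) / 2)"
      using bound[of \<xi>] by (intro mult_left_mono) auto
    then show "indicator E \<xi> * (norm (?T \<xi>))\<^sup>2 \<le> (?s (- a) \<xi> + ?s a \<xi>) / 2" by (simp add: algebra_simps add_divide_distrib)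
  qed (intro integrable_energy integrable_divide Bochner_Integration.integrable_add integrable_energy_shifted E)+
  also have "\<dots> = ((\<integral>\<xi>. ?s (- a) \<xi> \<partial>lborel) + (\<integral>\<xi>. ?s a \<xi> \<partial>lborel)) / 2"
    using Bochner_Integration.integral_add[OF integrable_energy_shifted[OF E(1), of x u "- a"] integrable_energy_shifted[OF E(1), of x u a]]
    by simp
  also have "\<dots> \<le> energy x E' u"
    using energy_shifted_le[OF E, of "- a" x u] energy_shifted_le[OF E, of a x u] sub by simp
  finally show "energy x E (\<lambda>k. of_real (sin (2 * pi * (a \<bullet> (x k - y)))) * u k) \<le> 1 * energy x E' u" by simp
qed

text \<open>
From \<open>2|gh| \<le> l|g|\<^sup>2 + |h|\<^sup>2/l\<close> with the best \<open>l\<close>.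
\<close>

lemma weighted_cauchy_schwarz:
  fixes g h :: "'a \<Rightarrow> complex" and w :: "'a \<Rightarrow> real"
  assumes w: "\<And>t. w t \<ge> 0" and int: "integrable M (\<lambda>t. w t * (norm (g t))\<^sup>2)" "integrable M (\<lambda>t. w t * (norm (h t))\<^sup>2)"
    "integrable M (\<lambda>t. of_real (w t) * (g t * h t))"
    and A: "(\<integral>t. w t * (norm (g t))\<^sup>2 \<partial>M) \<le> A" "A > 0"
  shows "(norm (\<integral>t. of_real (w t) * (g t * h t) \<partial>M))\<^sup>2 \<le> A * (\<integral>t. w t * (norm (h t))\<^sup>2 \<partial>M)"
proof (cases "(\<integral>t. of_real (w t) * (g t * h t) \<partial>M) = 0")
  case True
  then show ?thesis using A w by simp
next
  case False
  define C where "C = norm (\<integral>t. of_real (w t) * (g t * h t) \<partial>M)"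
  define B where "B = (\<integral>t. w t * (norm (h t))\<^sup>2 \<partial>M)"
  have C: "C > 0" using False by (simp add: C_def)
  \<comment> \<open>For this \<open>l\<close> the term with \<open>g\<close> is at most half of the left side \<open>C\<close> and can be absorbed.\<close>
  define l where "l = C / A"
  have l: "l > 0" using C A by (simp add: l_def)
  have "C \<le> (\<integral>t. norm (of_real (w t) * (g t * h t)) \<partial>M)"
    unfolding C_def by (rule integral_norm_bound)
  also have "\<dots> \<le> (\<integral>t. (l * (w t * (norm (g t))\<^sup>2) + (1 / l) * (w t * (norm (h t))\<^sup>2)) / 2 \<partial>M)"
  proof (rule integral_mono)
    fix t
    have "2 * (norm (g t) * norm (h t)) \<le> l * (norm (g t))\<^sup>2 + (1 / l) * (norm (h t))\<^sup>2"
    proof -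
      have "0 \<le> (l * norm (g t) - norm (h t))\<^sup>2 / l" using l by simp
      also have "\<dots> = l * (norm (g t))\<^sup>2 + (1 / l) * (norm (h t))\<^sup>2 - 2 * (norm (g t) * norm (h t))"
        using l by (simp add: power2_eq_square field_simps)
      finally show ?thesis by simp
    qed
    from mult_left_mono[OF this w[of t]]
    show "norm (of_real (w t) * (g t * h t)) \<le> (l * (w t * (norm (g t))\<^sup>2) + (1 / l) * (w t * (norm (h t))\<^sup>2)) / 2"
      using w[of t] by (simp add: norm_mult algebra_simps)
  qed (intro integrable_norm integrable_divide Bochner_Integration.integrable_add integrable_mult_right int)+
  also have "\<dots> = (l * (\<integral>t. w t * (norm (g t))\<^sup>2 \<partial>M) + (1 / l) * B) / 2"
    using Bochner_Integration.integral_add[OF integrable_mult_right[OF int(1), of l] integrable_mult_right[OF int(2), of "1 / l"]]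
    by (simp only: integral_divide_zero integral_mult_right_zero B_def)
  also have "\<dots> \<le> (l * A + (1 / l) * B) / 2"
    using A l by (intro divide_right_mono add_right_mono mult_left_mono) auto
  also have "\<dots> = (C + A * B / C) / 2" using A by (simp add: l_def)
  finally have "C \<le> A * B / C" by simp
  then show ?thesis using C unfolding C_def[symmetric] B_def[symmetric]
    by (simp add: pos_le_divide_eq power2_eq_square)
qed

text \<open>
Ingham's inequality says that the Gram matrix of the exponentials \<open>e\<^sub>j\<close> with \<open>j\<close> in \<open>U\<close> is bounded below by \<open>1/A\<close>, so a
combination \<open>g\<close> of these with \<open>\<langle>g, e\<^sub>i\<rangle> = \<delta>\<^sub>i\<^sub>k\<close> exists and \<open>\<parallel>g\<parallel>\<^sup>2 \<le> A\<close>. Correlation with \<open>w g\<close> is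
the required operator; by Cauchy-Schwarz and Tonelli it has squared norm at most \<open>A \<integral>w\<close>.
\<close>

lemma multiplier_bound_kernel:
  fixes x :: "'s::finite \<Rightarrow> 'a::euclidean_space" and R A :: real
  defines "w \<equiv> \<lambda>\<xi>::'a. indicator (cball 0 R) \<xi> * (1 - (norm \<xi> / R)\<^sup>2)"
  assumes R: "R > 0" and A: "A > 0" and k: "k \<in> U"
    and ingham: "\<And>u. (\<Sum>j\<in>U. (norm (u j))\<^sup>2) / A \<le> (\<integral>\<xi>. w \<xi> * (norm (\<Sum>j\<in>U. u j * cis (- 2 * pi * (\<xi> \<bullet> x j))))\<^sup>2 \<partial>lborel)"
  shows "\<exists>\<mu>. \<mu> k = 1 \<and> (\<forall>j\<in>U - {k}. \<mu> j = 0) \<and>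
      (\<forall>\<rho>. multiplier_bound x (cball 0 \<rho>) (cball 0 (\<rho> + R)) (A * (\<integral>\<xi>. w \<xi> \<partial>lborel)) \<mu>)"
proof -
  have U: "finite U" by simp
  define e where "e j \<xi> = cis (- 2 * pi * (\<xi> \<bullet> x j))" for j \<xi>
  have e_cont: "continuous_on UNIV (e j)" for j unfolding e_def by (intro continuous_intros)
  have w_nonneg: "w \<xi> \<ge> 0" for \<xi>
    using R by (auto simp: w_def indicator_def power_le_one_iff)
  have wint: "integrable lborel (\<lambda>\<xi>. of_real (w \<xi>) * f \<xi>)" if "continuous_on UNIV f" for f :: "'a \<Rightarrow> complex"
  proof -
    have "integrable lborel (\<lambda>\<xi>. indicator (cball 0 R) \<xi> *\<^sub>R (of_real (1 - (norm \<xi> / R)\<^sup>2) * f \<xi>))"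
      using R that by (intro integrable_ball_continuous continuous_intros) auto
    then show ?thesis by (simp add: w_def scaleR_conv_of_real mult.assoc)
  qed
  have wintr: "integrable lborel (\<lambda>\<xi>. w \<xi> * f \<xi>)" if "continuous_on UNIV f" for f :: "'a \<Rightarrow> real"
  proof -
    have "integrable lborel (\<lambda>\<xi>. indicator (cball 0 R) \<xi> *\<^sub>R ((1 - (norm \<xi> / R)\<^sup>2) * f \<xi>))"
      using R that by (intro integrable_ball_continuous continuous_intros) auto
    then show ?thesis by (simp add: w_def mult.assoc)
  qed
  define \<Gamma> where "\<Gamma> i j = (\<integral>\<xi>. of_real (w \<xi>) * (cnj (e i \<xi>) * e j \<xi>) \<partial>lborel)" for i j
  have \<Gamma>_int: "integrable lborel (\<lambda>\<xi>. of_real (w \<xi>) * (cnj (e i \<xi>) * e j \<xi>))" for i j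
    by (intro wint continuous_intros e_cont)
  have quad: "of_real (\<integral>\<xi>. w \<xi> * (norm (\<Sum>j\<in>U. b j * e j \<xi>))\<^sup>2 \<partial>lborel) = (\<Sum>i\<in>U. cnj (b i) * (\<Sum>j\<in>U. \<Gamma> i j * b j))" for b
  proof -
    have "of_real (w \<xi> * (norm (\<Sum>j\<in>U. b j * e j \<xi>))\<^sup>2)
        = (\<Sum>i\<in>U. \<Sum>j\<in>U. (cnj (b i) * b j) * (of_real (w \<xi>) * (cnj (e i \<xi>) * e j \<xi>)))" for \<xi>
    proof -
      have "of_real ((norm (\<Sum>j\<in>U. b j * e j \<xi>))\<^sup>2) = cnj (\<Sum>i\<in>U. b i * e i \<xi>) * (\<Sum>j\<in>U. b j * e j \<xi>)"
        using complex_norm_square[of "\<Sum>j\<in>U. b j * e j \<xi>"] by (simp add: mult.commute)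
      also have "\<dots> = (\<Sum>i\<in>U. \<Sum>j\<in>U. (cnj (b i) * cnj (e i \<xi>)) * (b j * e j \<xi>))"
        by (simp add: sum_product)
      finally show ?thesis
        unfolding of_real_mult by (simp add: sum_distrib_left mult_ac)
    qed
    then have "of_real (\<integral>\<xi>. w \<xi> * (norm (\<Sum>j\<in>U. b j * e j \<xi>))\<^sup>2 \<partial>lborel)
        = (\<integral>\<xi>. (\<Sum>i\<in>U. \<Sum>j\<in>U. (cnj (b i) * b j) * (of_real (w \<xi>) * (cnj (e i \<xi>) * e j \<xi>))) \<partial>lborel)"
      by (simp only: integral_complex_of_real[symmetric])
    also have "\<dots> = (\<Sum>i\<in>U. \<Sum>j\<in>U. (cnj (b i) * b j) * \<Gamma> i j)"
      unfolding \<Gamma>_def integral_mult_right_zero[symmetric]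
      by (subst Bochner_Integration.integral_sum, intro Bochner_Integration.integrable_sum integrable_mult_right \<Gamma>_int,
          subst Bochner_Integration.integral_sum, intro integrable_mult_right \<Gamma>_int, rule refl)
    finally show ?thesis by (simp add: sum_distrib_left mult_ac)
  qed
  obtain b where b: "\<And>i. i \<in> U \<Longrightarrow> (\<Sum>j\<in>U. \<Gamma> i j * b j) = (if i = k then 1 else 0)"
  proof -
    \<comment> \<open>The Gram matrix of \<open>U\<close>, completed by the identity to a matrix indexed by all points.\<close>
    define M :: "complex ^ 's ^ 's" where
      "M = (\<chi> i j. if i \<in> U \<and> j \<in> U then \<Gamma> i j else if i = j then 1 else 0)"
    have Mv: "(M *v v) $ i = (if i \<in> U then \<Sum>j\<in>U. \<Gamma> i j * v $ j else v $ i)" for v i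
    proof (cases "i \<in> U")
      case True
      then have "(M *v v) $ i = (\<Sum>j\<in>UNIV. if j \<in> U then \<Gamma> i j * v $ j else 0)"
        by (auto simp: M_def matrix_vector_mult_def intro!: sum.cong)
      then show ?thesis using True by (simp add: sum.If_cases)
    next
      case False
      then have "(M *v v) $ i = (\<Sum>j\<in>UNIV. if j = i then v $ j else 0)"
        unfolding M_def matrix_vector_mult_def vec_lambda_beta by (intro sum.cong) auto
      then show ?thesis using False by simp
    qed
    have "v = 0" if v: "M *v v = 0" for v
    proof -
      have v0: "v $ i = 0" if "i \<notin> U" for i using Mv[of v i] v that by simp
      have "(\<Sum>j\<in>U. \<Gamma> i j * v $ j) = 0" if "i \<in> U" for i using Mv[of v i] v that by simp
      then have "of_real (\<integral>\<xi>. w \<xi> * (norm (\<Sum>j\<in>U. v $ j * e j \<xi>))\<^sup>2 \<partial>lborel) = (0::complex)"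
        unfolding quad by simp
      then have "(\<Sum>j\<in>U. (norm (v $ j))\<^sup>2) / A \<le> 0"
        using ingham[of "\<lambda>j. v $ j"] by (simp add: e_def)
      then have "(\<Sum>j\<in>U. (norm (v $ j))\<^sup>2) \<le> 0" using A by (simp add: divide_le_0_iff)
      then have "(\<Sum>j\<in>U. (norm (v $ j))\<^sup>2) = 0" by (intro antisym sum_nonneg) auto
      then have "v $ j = 0" if "j \<in> U" for j using that by (simp add: sum_nonneg_eq_0_iff)
      then show "v = 0" using v0 by (auto simp: vec_eq_iff)
    qed
    then obtain B where "B ** M = mat 1" using matrix_left_invertible_ker[of M] by blast
    then have "M ** B = mat 1" by (simp add: matrix_left_right_inverse)
    then have "M *v (B *v axis k 1) = axis k 1" by (simp add: matrix_vector_mul_assoc)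
    then have "(M *v (B *v axis k 1)) $ i = (if i = k then 1 else 0)" for i by (simp add: axis_def)
    then have "(\<Sum>j\<in>U. \<Gamma> i j * (B *v axis k 1) $ j) = (if i = k then 1 else 0)" if "i \<in> U" for i
      using Mv[of "B *v axis k 1" i] that by simp
    then show ?thesis using that by blast
  qed
  define g where "g \<xi> = (\<Sum>j\<in>U. b j * e j \<xi>)" for \<xi>
  have g_cont: "continuous_on UNIV g" unfolding g_def by (intro continuous_intros e_cont)
  define Q where "Q = (\<integral>\<xi>. w \<xi> * (norm (g \<xi>))\<^sup>2 \<partial>lborel)"
  have "of_real Q = (\<Sum>i\<in>U. if i = k then cnj (b i) else 0)"
    unfolding Q_def g_def quad using b by (intro sum.cong) auto
  also have "\<dots> = cnj (b k)" using k U by simp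
  finally have Qb: "of_real Q = cnj (b k)" .
  have Q0: "Q \<ge> 0" unfolding Q_def using w_nonneg by simp
  have "norm (b k) = Q" using Qb Q0 by (metis complex_mod_cnj norm_of_real abs_of_nonneg)
  then have "Q\<^sup>2 \<le> (\<Sum>j\<in>U. (norm (b j))\<^sup>2)" using k U by (metis member_le_sum zero_le_power2)
  then have "Q\<^sup>2 / A \<le> Q" using ingham[of b] A unfolding Q_def g_def e_def by (meson divide_right_mono less_imp_le order_trans)
  then have QA: "Q \<le> A" using A Q0 by (cases "Q = 0") (auto simp: power2_eq_square divide_le_eq)
  define \<mu> where "\<mu> i = (\<integral>\<xi>. of_real (w \<xi>) * (cnj (g \<xi>) * e i \<xi>) \<partial>lborel)" for i
  have \<mu>U: "\<mu> i = (if i = k then 1 else 0)" if i: "i \<in> U" for i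
  proof -
    have "cnj (\<mu> i) = (\<integral>\<xi>. of_real (w \<xi>) * (g \<xi> * cnj (e i \<xi>)) \<partial>lborel)"
      unfolding \<mu>_def Bochner_Integration.integral_cnj[symmetric] by simp
    also have "\<dots> = (\<integral>\<xi>. (\<Sum>j\<in>U. b j * (of_real (w \<xi>) * (cnj (e i \<xi>) * e j \<xi>))) \<partial>lborel)"
      by (simp add: g_def sum_distrib_left sum_distrib_right mult_ac)
    also have "\<dots> = (\<Sum>j\<in>U. b j * \<Gamma> i j)"
      unfolding \<Gamma>_def integral_mult_right_zero[symmetric]
      by (intro Bochner_Integration.integral_sum integrable_mult_right \<Gamma>_int)
    also have "\<dots> = (if i = k then 1 else 0)" using b[OF i] by (simp add: mult.commute)
    finally have "cnj (\<mu> i) = (if i = k then 1 else 0)" .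
    then show ?thesis by (metis complex_cnj_cnj complex_cnj_one complex_cnj_zero)
  qed
  have "multiplier_bound x (cball 0 \<rho>) (cball 0 (\<rho> + R)) (A * (\<integral>\<xi>. w \<xi> \<partial>lborel)) \<mu>" for \<rho>
    unfolding multiplier_bound_def
  proof
    fix u
    let ?F = "trig_sum x u"
    have conv: "trig_sum x (\<lambda>i. \<mu> i * u i) \<xi> = (\<integral>\<eta>. of_real (w \<eta>) * (cnj (g \<eta>) * ?F (\<xi> + \<eta>)) \<partial>lborel)" for \<xi>
    proof -
      have "of_real (w \<eta>) * (cnj (g \<eta>) * ?F (\<xi> + \<eta>)) = (\<Sum>i\<in>UNIV. (u i * e i \<xi>) * (of_real (w \<eta>) * (cnj (g \<eta>) * e i \<eta>)))" for \<eta>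
      proof -
        have "?F (\<xi> + \<eta>) = (\<Sum>i\<in>UNIV. u i * e i \<xi> * e i \<eta>)"
          unfolding trig_sum_def e_def by (intro sum.cong) (simp_all add: cis_mult inner_add_left algebra_simps)
        then show ?thesis by (simp add: sum_distrib_left mult_ac)
      qed
      then have "(\<integral>\<eta>. of_real (w \<eta>) * (cnj (g \<eta>) * ?F (\<xi> + \<eta>)) \<partial>lborel)
          = (\<Sum>i\<in>UNIV. (u i * e i \<xi>) * \<mu> i)"
        unfolding \<mu>_def integral_mult_right_zero[symmetric]
        by (simp only:) (intro Bochner_Integration.integral_sum integrable_mult_right wint continuous_intros g_cont e_cont)
      then show ?thesis by (simp add: trig_sum_def e_def mult_ac)
    qed
    have Fc: "continuous_on UNIV (\<lambda>\<eta>. ?F (\<xi> + \<eta>))" for \<xi> by (intro continuous_intros)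
    have cs: "(norm (trig_sum x (\<lambda>i. \<mu> i * u i) \<xi>))\<^sup>2 \<le> A * (\<integral>\<eta>. w \<eta> * (norm (?F (\<xi> + \<eta>)))\<^sup>2 \<partial>lborel)" for \<xi>
      unfolding conv
    proof (rule weighted_cauchy_schwarz[OF w_nonneg])
      show "(\<integral>t. w t * (norm (cnj (g t)))\<^sup>2 \<partial>lborel) \<le> A" using QA by (simp add: Q_def)
    qed (intro wint wintr continuous_intros g_cont Fc A)+
    let ?K = "\<lambda>\<xi> \<eta>. indicator (cball 0 \<rho>) \<xi> * (w \<eta> * (norm (?F (\<xi> + \<eta>)))\<^sup>2)"
    let ?C = "\<Sum>j\<in>UNIV. norm (u j)"
    have wint0: "integrable lborel w" using wintr[of "\<lambda>_. 1"] by simp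
    have wmeas: "w \<in> borel_measurable borel" using borel_measurable_integrable[OF wint0] by simp
    have Kmeas: "(\<lambda>p. ?K (fst p) (snd p)) \<in> borel_measurable lborel"
    proof -
      have "(fst :: 'a \<times> 'a \<Rightarrow> 'a) \<in> borel_measurable borel" "(snd :: 'a \<times> 'a \<Rightarrow> 'a) \<in> borel_measurable borel"
        by (intro borel_measurable_continuous_onI continuous_intros)+
      then have "(\<lambda>p::'a \<times> 'a. indicator (cball 0 \<rho>) (fst p) :: real) \<in> borel_measurable borel"
        "(\<lambda>p::'a \<times> 'a. w (snd p)) \<in> borel_measurable borel"
        using measurable_compose[of fst borel borel "indicator (cball (0::'a) \<rho>)" borel] measurable_compose[of snd borel borel w borel] wmeas
        by (simp_all add: borel_measurable_indicator)
      moreover have "(\<lambda>p. (norm (?F (fst p + snd p)))\<^sup>2) \<in> borel_measurable borel"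
        by (intro borel_measurable_continuous_onI continuous_intros)
      ultimately show ?thesis by (simp only: measurable_lborel2) (intro borel_measurable_times)
    qed
    have Kint: "integrable lborel (\<lambda>p. ?K (fst p) (snd p))"
    proof (rule Bochner_Integration.integrable_bound)
      have "integrable lborel (indicator (cball (0::'a) \<rho>) :: 'a \<Rightarrow> real)"
        using emeasure_bounded_finite[OF bounded_cball, of 0 \<rho>] by (intro integrable_real_indicator) auto
      from integrable_lborel_tensor[OF this integrable_mult_left[OF wint0, of "?C\<^sup>2"]]
      show "integrable lborel (\<lambda>p. indicator (cball (0::'a) \<rho>) (fst p) * (w (snd p) * ?C\<^sup>2))" .
      show "AE p in lborel. norm (?K (fst p) (snd p)) \<le> norm (indicator (cball (0::'a) \<rho>) (fst p) * (w (snd p) * ?C\<^sup>2))"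
        using w_nonneg norm_trig_sum_le[of x u] by (auto simp: abs_mult intro!: mult_left_mono power_mono)
    qed (rule Kmeas)
    note Kint' = Kint[folded lborel_prod]
    have "energy x (cball 0 \<rho>) (\<lambda>i. \<mu> i * u i) \<le> (\<integral>\<xi>. A * (\<integral>\<eta>. ?K \<xi> \<eta> \<partial>lborel) \<partial>lborel)"
      unfolding energy_def
    proof (rule integral_mono)
      show "integrable lborel (\<lambda>\<xi>. A * (\<integral>\<eta>. ?K \<xi> \<eta> \<partial>lborel))"
        using lborel_pair.integrable_fst'[OF Kint'] by (intro integrable_mult_right) simp
      show "indicator (cball 0 \<rho>) \<xi> * (norm (trig_sum x (\<lambda>i. \<mu> i * u i) \<xi>))\<^sup>2 \<le> A * (\<integral>\<eta>. ?K \<xi> \<eta> \<partial>lborel)" for \<xi>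
        using cs[of \<xi>] by (auto simp: indicator_def)
    qed (intro integrable_energy compact_cball)
    also have "\<dots> = A * (\<integral>\<xi>. \<integral>\<eta>. ?K \<xi> \<eta> \<partial>lborel \<partial>lborel)" by (rule integral_mult_right_zero)
    also have "(\<integral>\<xi>. \<integral>\<eta>. ?K \<xi> \<eta> \<partial>lborel \<partial>lborel) = (\<integral>\<eta>. \<integral>\<xi>. ?K \<xi> \<eta> \<partial>lborel \<partial>lborel)"
      using Kint' by (intro lborel_pair.Fubini_integral[symmetric]) (simp only: case_prod_beta')
    also have "\<dots> \<le> (\<integral>\<eta>. w \<eta> * energy x (cball 0 (\<rho> + R)) u \<partial>lborel)"
    proof (rule integral_mono)
      show "integrable lborel (\<lambda>\<eta>. \<integral>\<xi>. ?K \<xi> \<eta> \<partial>lborel)"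
        using lborel_pair.integrable_snd[of ?K] Kint' by (simp only: case_prod_beta')
      show "integrable lborel (\<lambda>\<eta>. w \<eta> * energy x (cball 0 (\<rho> + R)) u)" using wint0 by (rule integrable_mult_left)
      fix \<eta> :: 'a
      have "(\<integral>\<xi>. ?K \<xi> \<eta> \<partial>lborel) = (\<integral>\<xi>. w \<eta> * (indicator (cball 0 \<rho>) \<xi> * (norm (?F (\<xi> + \<eta>)))\<^sup>2) \<partial>lborel)"
        by (simp only: mult.left_commute)
      also have "\<dots> = w \<eta> * (\<integral>\<xi>. indicator (cball 0 \<rho>) \<xi> * (norm (?F (\<xi> + \<eta>)))\<^sup>2 \<partial>lborel)"
        by (rule integral_mult_right_zero)
      also have "\<dots> \<le> w \<eta> * energy x (cball 0 (\<rho> + R)) u"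
      proof (cases "norm \<eta> \<le> R")
        case True
        then show ?thesis
          by (intro mult_left_mono energy_shifted_le compact_cball w_nonneg)
            (auto intro: order_trans[OF norm_triangle_ineq] add_mono)
      qed (simp add: w_def)
      finally show "(\<integral>\<xi>. ?K \<xi> \<eta> \<partial>lborel) \<le> w \<eta> * energy x (cball 0 (\<rho> + R)) u" .
    qed
    also have "\<dots> = (\<integral>\<eta>. w \<eta> \<partial>lborel) * energy x (cball 0 (\<rho> + R)) u" by (rule integral_mult_left_zero)
    finally show "energy x (cball 0 \<rho>) (\<lambda>i. \<mu> i * u i) \<le> A * (\<integral>\<xi>. w \<xi> \<partial>lborel) * energy x (cball 0 (\<rho> + R)) u"
      using A by (simp add: mult.assoc mult_left_mono)
  qed
  then show ?thesis using \<mu>U k by (intro exI[of _ \<mu>]) auto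
qed

section \<open>Multipliers for separated sets\<close>

lemma multiplier_bound_weaken:
  assumes "multiplier_bound x E E' \<kappa> \<mu>" "compact E'" "compact E''" "E' \<subseteq> E''" "0 \<le> \<kappa>" "\<kappa> \<le> \<kappa>'"
  shows "multiplier_bound x E E'' \<kappa>' \<mu>"
  unfolding multiplier_bound_def
proof
  fix u
  have "energy x E (\<lambda>k. \<mu> k * u k) \<le> \<kappa> * energy x E' u" using assms(1) by (simp add: multiplier_bound_def)
  also have "\<dots> \<le> \<kappa>' * energy x E'' u"
    using assms energy_mono[OF assms(2-4), of x u] energy_nonneg[of x E' u] by (intro mult_mono) auto
  finally show "energy x E (\<lambda>k. \<mu> k * u k) \<le> \<kappa>' * energy x E'' u" .
qed

text \<open>
The kernel for a \<open>\<tau>\<close>-separated set with the constant in explicit form. The mass of the weight contributes \<open>2/(d+2)\<close>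
times the volume of the ball of radius \<open>R\<close>.
\<close>

lemma bessel_multiplier:
  fixes x :: "'s::finite \<Rightarrow> 'a::euclidean_space" and R \<tau> :: real
  defines "N \<equiv> real DIM('a) / 2" and "s \<equiv> (pi * R * \<tau> / 2)\<^sup>2"
  defines "\<kappa> \<equiv> 2 / (real DIM('a) + 2) * (unit_ball_vol DIM('a))\<^sup>2 * (R * \<tau> / 2) ^ DIM('a) * (1 - N * bessel_clifford (N + 1) s / bessel_clifford N s)"
  assumes R: "R > 0" and tau: "\<tau> > 0" and k: "k \<in> U"
    and sep: "\<And>i j. i \<in> U \<Longrightarrow> j \<in> U \<Longrightarrow> i \<noteq> j \<Longrightarrow> dist (x i) (x j) > \<tau>"
    and lo: "(bessel_zero (N - 1) 1 / 2)\<^sup>2 < s" and hi: "s \<le> (bessel_zero N 1 / 2)\<^sup>2"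
  shows "\<kappa> \<ge> 0" and "\<exists>\<mu>. \<mu> k = 1 \<and> (\<forall>j\<in>U - {k}. \<mu> j = 0) \<and> (\<forall>\<rho>. multiplier_bound x (cball 0 \<rho>) (cball 0 (\<rho> + R)) \<kappa> \<mu>)"
proof -
  note N = DIM_half_pos[where 'a='a, folded N_def]
  define \<rho> where "\<rho> = \<tau> / 2"
  have rho: "\<rho> > 0" using tau by (simp add: \<rho>_def)
  have s: "s = (pi * R * \<rho>)\<^sup>2" by (simp add: s_def \<rho>_def)
  define c where "c = bessel_clifford N s"
  note neg = bessel_clifford_negative_past_first_zero[OF N(1) lo hi]
  have c: "c < 0" using neg(1) by (simp add: c_def)
  have s0: "s > 0" using R tau by (simp add: s_def)
  have C1: "bessel_clifford (N + 1) s \<ge> 0"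
    using bessel_zero_first(2,3)[OF N(2)] s0 hi by (cases "s = (bessel_zero N 1 / 2)\<^sup>2") (auto intro: less_imp_le)
  let ?V = "\<lambda>r. measure lborel (cball (0::'a) r)"
  have V: "?V r = unit_ball_vol DIM('a) * r ^ DIM('a)" if "r \<ge> 0" for r using content_cball[OF that, of "0::'a"] by simp
  have Vpos: "?V r > 0" if "r > 0" for r using that by (simp add: V)
  define A where "A = (\<integral>z. indicator (cball (0::'a) \<rho>) z * bump_profile (pi * R) c z \<partial>lborel)"
  have A_eq: "A = ?V \<rho> * (1 - N * bessel_clifford (N + 1) s / c)"
  proof -
    have i1: "integrable lborel (\<lambda>z::'a. indicator (cball 0 \<rho>) z * (1::real))"
      using integrable_ball_continuous[of "\<lambda>_::'a. 1::real" \<rho>] by simp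
    have i2: "integrable lborel (\<lambda>z::'a. indicator (cball 0 \<rho>) z * bessel_clifford N ((pi * R)\<^sup>2 * (z \<bullet> z)))"
      using integrable_ball_continuous[of "\<lambda>z::'a. bessel_clifford N ((pi * R)\<^sup>2 * (z \<bullet> z))" \<rho>] N(1)
      by (simp add: continuous_intros)
    have "A = (\<integral>z. indicator (cball (0::'a) \<rho>) z * 1 - (indicator (cball (0::'a) \<rho>) z * bessel_clifford N ((pi * R)\<^sup>2 * (z \<bullet> z))) / c \<partial>lborel)"
      unfolding A_def bump_profile_def N_def by (simp add: right_diff_distrib)
    also have "\<dots> = ?V \<rho> - (N * bessel_clifford (N + 1) s * ?V \<rho>) / c"
      using Bochner_Integration.integral_diff[OF i1 integrable_divide[OF i2, of c]]
        integral_ball_bessel_clifford[where 'a='a, of \<rho> "pi * R", folded N_def] rho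
      by (simp only: integral_divide_zero) (simp add: s power_mult_distrib)
    finally show ?thesis by (simp add: algebra_simps)
  qed
  have "N * bessel_clifford (N + 1) s / c \<le> 0" using N C1 c by (simp add: divide_le_0_iff)
  then have ge1: "1 \<le> 1 - N * bessel_clifford (N + 1) s / c" by simp
  have A: "A > 0" unfolding A_eq using Vpos[OF rho] ge1 by (intro mult_pos_pos) auto
  let ?w = "\<lambda>\<xi>::'a. indicator (cball 0 R) \<xi> * (1 - (norm \<xi> / R)\<^sup>2)"
  have W: "(\<integral>\<xi>. ?w \<xi> \<partial>lborel) = 2 / (real DIM('a) + 2) * ?V R"
  proof -
    have "?w = (\<lambda>\<xi>. (indicator (cball 0 R) \<xi> * (R\<^sup>2 - (norm \<xi>)\<^sup>2)) / R\<^sup>2)"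
      using R by (auto simp: fun_eq_iff field_simps)
    then have "(\<integral>\<xi>. ?w \<xi> \<partial>lborel) = (\<integral>\<xi>. indicator (cball (0::'a) R) \<xi> * (R\<^sup>2 - (norm \<xi>)\<^sup>2) \<partial>lborel) / R\<^sup>2"
      by (simp only: integral_divide_zero)
    then show ?thesis using integral_ball_paraboloid[where 'a='a, of R] R by simp
  qed
  have kappa: "A * (\<integral>\<xi>. ?w \<xi> \<partial>lborel) = \<kappa>"
    unfolding W A_eq \<kappa>_def c_def using R rho
    by (simp add: V \<rho>_def power_mult_distrib power2_eq_square power_divide mult_ac)
  show "\<kappa> \<ge> 0" unfolding kappa[symmetric] W using A Vpos[OF R] by simp
  show "\<exists>\<mu>. \<mu> k = 1 \<and> (\<forall>j\<in>U - {k}. \<mu> j = 0) \<and> (\<forall>\<rho>. multiplier_bound x (cball 0 \<rho>) (cball 0 (\<rho> + R)) \<kappa> \<mu>)"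
    unfolding kappa[symmetric]
  proof (rule multiplier_bound_kernel[OF R A k])
    fix u
    have "(\<Sum>j\<in>U. (norm (u j))\<^sup>2) / A
      \<le> (\<integral>\<xi>. indicator (cball 0 R) \<xi> * ((1 - (norm \<xi> / R)\<^sup>2) * (norm (\<Sum>j\<in>U. u j * cis (- 2 * pi * (\<xi> \<bullet> x j))))\<^sup>2) \<partial>lborel)"
      unfolding A_def c_def s N_def
    proof (rule ingham_ball)
      show "dist (x i) (x j) > 2 * \<rho>" if "i \<in> U" "j \<in> U" "i \<noteq> j" for i j
        using sep[OF that] by (simp add: \<rho>_def)
    qed (use R rho c A neg(2) in \<open>auto simp: A_def c_def s N_def\<close>)
    then show "(\<Sum>j\<in>U. (norm (u j))\<^sup>2) / A
      \<le> (\<integral>\<xi>. ?w \<xi> * (norm (\<Sum>j\<in>U. u j * cis (- 2 * pi * (\<xi> \<bullet> x j))))\<^sup>2 \<partial>lborel)"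
      by (simp only: mult.assoc)
  qed
qed

lemma lebesgue_vol_cball:
  "r \<ge> 0 \<Longrightarrow> lebesgue_vol (cball (a :: real ^ 'n) r) = unit_ball_vol CARD('n) * r ^ CARD('n)"
  using content_cball[of r a] by (simp add: lebesgue_vol_def)

text \<open>
The cone over the unit sphere is the unit ball without its centre.
\<close>

lemma sphere_measure_unit_sphere:
  "sphere_measure (sphere (0 :: real ^ 'n) 1) = real CARD('n) * unit_ball_vol CARD('n)"
proof -
  have "{t *\<^sub>R y | t y. 0 < t \<and> t \<le> 1 \<and> y \<in> sphere (0 :: real ^ 'n) 1} = cball 0 1 - {0}"
  proof (intro equalityI subsetI)
    fix z :: "real ^ 'n" assume z: "z \<in> cball 0 1 - {0}"
    then have "z = norm z *\<^sub>R (z /\<^sub>R norm z) \<and> 0 < norm z \<and> norm z \<le> 1 \<and> z /\<^sub>R norm z \<in> sphere 0 1" by simp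
    then show "z \<in> {t *\<^sub>R y | t y. 0 < t \<and> t \<le> 1 \<and> y \<in> sphere (0 :: real ^ 'n) 1}" by blast
  qed auto
  moreover have "measure lebesgue (cball (0 :: real ^ 'n) 1 - {0}) = measure lebesgue (cball (0 :: real ^ 'n) 1)"
  proof (rule measure_negligible_symdiff)
    show "negligible (cball (0 :: real ^ 'n) 1 - (cball 0 1 - {0}) \<union> (cball 0 1 - {0} - cball 0 1))"
      by (rule negligible_subset[OF negligible_sing[of 0]]) auto
  qed simp
  ultimately show ?thesis
    using lebesgue_vol_cball[of 1 "0 :: real ^ 'n"] by (simp add: sphere_measure_def lebesgue_vol_def)
qed

text \<open>
For \<open>\<alpha>\<close> below \<open>j\<^sub>d\<^sub>/\<^sub>2\<^sub>,\<^sub>1/\<pi>\<close> the constant of \<open>bessel_multiplier\<close> is \<open>2/(d+2) |B\<^sub>1|/c(\<alpha>)\<close> exactly. Beyond that value the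
bump for \<open>t = j\<^sub>d\<^sub>/\<^sub>2\<^sub>,\<^sub>1/\<pi>\<close> is used, whose kernel lives on the smaller ball of radius \<open>t/\<tau>\<close>; there \<open>c(\<alpha>)\<close> is smaller than its
limit from the left by a factor \<open>d\<close>, so the bound holds with room to spare.
\<close>

lemma separated_multiplier:
  fixes x :: "'s::finite \<Rightarrow> real ^ 'n::finite" and \<alpha> \<tau> :: real
  defines "K \<equiv> lebesgue_vol (cball (0 :: real ^ 'n) 1) / c_const TYPE('n) \<alpha>"
  assumes alpha: "\<alpha> > bessel_zero (real CARD('n) / 2 - 1) 1 / pi" and tau: "\<tau> > 0" and k: "k \<in> U"
    and sep: "\<And>i j. i \<in> U \<Longrightarrow> j \<in> U \<Longrightarrow> i \<noteq> j \<Longrightarrow> dist (x i) (x j) > \<tau>"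
  shows "c_const TYPE('n) \<alpha> > 0"
    and "\<exists>\<mu>. \<mu> k = 1 \<and> (\<forall>j\<in>U - {k}. \<mu> j = 0) \<and>
      (\<forall>\<rho>. multiplier_bound x (cball 0 \<rho>) (cball 0 (\<rho> + \<alpha> / \<tau>)) (2 / (real CARD('n) + 2) * K) \<mu>)"
proof -
  define d where "d = CARD('n)"
  define N where "N = real d / 2"
  define v where "v = unit_ball_vol (real d)"
  have d: "real d > 0" by (simp add: d_def)
  have N: "N > 0" using d by (simp add: N_def)
  have v: "v > 0" by (simp add: v_def)
  define j0 where "j0 = bessel_zero (N - 1) 1"
  define j1 where "j1 = bessel_zero N 1"
  have j0: "j0 > 0" using bessel_zero_first(1)[OF N] by (simp add: j0_def)
  have j1: "j1 > 0" "bessel_clifford (N + 1) ((j1 / 2)\<^sup>2) = 0" "\<And>t. 0 \<le> t \<Longrightarrow> t < (j1 / 2)\<^sup>2 \<Longrightarrow> bessel_clifford (N + 1) t > 0"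
    using bessel_zero_first[of "N + 1"] N by (auto simp: j1_def)
  have j01: "(j0 / 2)\<^sup>2 < (j1 / 2)\<^sup>2" using bessel_zero_less_succ[OF N] by (simp add: j0_def j1_def)
  have al: "\<alpha> > j0 / pi" using alpha by (simp add: j0_def N_def d_def)
  have al0: "\<alpha> > 0" using al j0 by (meson divide_pos_pos less_trans pi_gt_zero)
  have V1: "lebesgue_vol (cball (0 :: real ^ 'n) 1) = v" using lebesgue_vol_cball[of 1 "0 :: real ^ 'n"] by (simp add: v_def d_def)
  have c_eq: "c_const TYPE('n) \<alpha> = (if \<alpha> < j1 / pi then 1 / (d * v) * (2 / \<alpha>) ^ d * (bessel_gamma d \<alpha> / (1 + bessel_gamma d \<alpha> / d))
      else 1 / (d * v) * (2 * pi / j1) ^ d)"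
    by (simp add: c_const_def Let_def sphere_measure_unit_sphere d_def j1_def N_def v_def)
  let ?concl = "\<lambda>R \<kappa>. \<exists>\<mu>. \<mu> k = 1 \<and> (\<forall>j\<in>U - {k}. \<mu> j = 0) \<and> (\<forall>\<rho>. multiplier_bound x (cball 0 \<rho>) (cball 0 (\<rho> + R)) \<kappa> \<mu>)"
  have core: "?concl R (2 / (real d + 2) * v\<^sup>2 * (t / 2) ^ d * (1 - N * bessel_clifford (N + 1) ((pi * t / 2)\<^sup>2) / bessel_clifford N ((pi * t / 2)\<^sup>2)))"
      "0 \<le> 2 / (real d + 2) * v\<^sup>2 * (t / 2) ^ d * (1 - N * bessel_clifford (N + 1) ((pi * t / 2)\<^sup>2) / bessel_clifford N ((pi * t / 2)\<^sup>2))"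
    if R: "R = t / \<tau>" "t > 0" "j0 < pi * t" "pi * t \<le> j1" for R t
  proof -
    have t: "R * \<tau> = t" "R > 0" using R tau by auto
    have 1: "(bessel_zero (real DIM(real ^ 'n) / 2 - 1) 1 / 2)\<^sup>2 < (pi * R * \<tau> / 2)\<^sup>2"
      using R(3) j0 unfolding mult.assoc t j0_def N_def d_def by (intro power_strict_mono) auto
    have 2: "(pi * R * \<tau> / 2)\<^sup>2 \<le> (bessel_zero (real DIM(real ^ 'n) / 2) 1 / 2)\<^sup>2"
      using R(2,4) unfolding mult.assoc t j1_def N_def d_def by (intro power_mono) auto
    show "?concl R (2 / (real d + 2) * v\<^sup>2 * (t / 2) ^ d * (1 - N * bessel_clifford (N + 1) ((pi * t / 2)\<^sup>2) / bessel_clifford N ((pi * t / 2)\<^sup>2)))"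
      using bessel_multiplier(2)[OF t(2) tau k sep 1 2] unfolding mult.assoc[of pi] t by (simp add: N_def d_def v_def)
    show "0 \<le> 2 / (real d + 2) * v\<^sup>2 * (t / 2) ^ d * (1 - N * bessel_clifford (N + 1) ((pi * t / 2)\<^sup>2) / bessel_clifford N ((pi * t / 2)\<^sup>2))"
      using bessel_multiplier(1)[OF t(2) tau k sep 1 2] unfolding mult.assoc[of pi] t by (simp add: N_def d_def v_def)
  qed
  have "c_const TYPE('n) \<alpha> > 0 \<and> ?concl (\<alpha> / \<tau>) (2 / (real d + 2) * K)"
  proof (cases "\<alpha> < j1 / pi")
    case True
    define s where "s = (pi * \<alpha> / 2)\<^sup>2"
    have lo: "j0 < pi * \<alpha>" and hi: "pi * \<alpha> < j1" using al True by (simp_all add: field_simps)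
    have slo: "(j0 / 2)\<^sup>2 < s" unfolding s_def using lo j0 by (intro power_strict_mono) auto
    have shi: "s < (j1 / 2)\<^sup>2" unfolding s_def using hi al0 by (intro power_strict_mono) auto
    have C0: "bessel_clifford N s < 0"
      using bessel_clifford_negative_past_first_zero(1)[OF N, of s] slo shi by (simp add: j0_def j1_def)
    have C1: "bessel_clifford (N + 1) s > 0" using j1(3)[of s] shi by (simp add: s_def)
    define g where "g = bessel_gamma d \<alpha>"
    have z: "pi * \<alpha> / 2 > 0" using al0 by simp
    have g: "g = - 2 * bessel_clifford N s / bessel_clifford (N + 1) s"
    proof -
      define X where "X = (pi * \<alpha> / 2) powr (N - 1)"
      have X: "X > 0" using al0 by (simp add: X_def)
      have a: "bessel_J (real d / 2 - 1) (pi * \<alpha>) = X * bessel_clifford N s"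
        using bessel_J_eq_bessel_clifford[OF N, of "pi * \<alpha>"] al0 by (simp add: N_def s_def X_def)
      have "bessel_J (real d / 2) (pi * \<alpha>) = (pi * \<alpha> / 2) powr N * bessel_clifford (N + 1) s"
        using bessel_J_eq_bessel_clifford[of "N + 1" "pi * \<alpha>"] al0 N by (simp add: N_def s_def)
      moreover have "(pi * \<alpha> / 2) powr N = (pi * \<alpha> / 2) * X"
        using powr_mult_base[of "pi * \<alpha> / 2" "N - 1"] z by (simp add: X_def)
      ultimately have b: "bessel_J (real d / 2) (pi * \<alpha>) = (pi * \<alpha> / 2) * X * bessel_clifford (N + 1) s" by simp
      show ?thesis unfolding g_def bessel_gamma_def a b
        using X C1 al0 by (simp add: field_simps)
    qed
    have g0: "g > 0" unfolding g using C0 C1 by (simp add: field_simps)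
    have c: "c_const TYPE('n) \<alpha> = 1 / (d * v) * (2 / \<alpha>) ^ d * (g / (1 + g / d))" using True by (simp add: c_eq g_def)
    have c0: "c_const TYPE('n) \<alpha> > 0" unfolding c using g0 d v al0 by (intro mult_pos_pos divide_pos_pos zero_less_power add_pos_pos) auto
    have "K = v\<^sup>2 * (\<alpha> / 2) ^ d * (1 + d / g)"
      unfolding K_def V1 c using g0 d v al0 by (simp add: field_simps power2_eq_square power_divide)
    also have "d / g = - (N * bessel_clifford (N + 1) s / bessel_clifford N s)"
      unfolding g N_def using C0 C1 by (simp add: field_simps)
    finally have Keq: "2 / (real d + 2) * K = 2 / (real d + 2) * v\<^sup>2 * (\<alpha> / 2) ^ d * (1 - N * bessel_clifford (N + 1) s / bessel_clifford N s)"
      by simp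
    show ?thesis
      unfolding Keq s_def by (rule conjI[OF c0 core(1)[OF refl al0 lo less_imp_le[OF hi]]])
  next
    case False
    define t where "t = j1 / pi"
    have t: "t > 0" "pi * t = j1" "t \<le> \<alpha>" using j1(1) False by (auto simp: t_def)
    have "j0 < j1" using j01 j0 j1(1) by (metis divide_strict_right_mono linorder_not_less power_mono divide_right_mono less_imp_le zero_less_numeral half_gt_zero)
    then have co: "?concl (t / \<tau>) (2 / (real d + 2) * v\<^sup>2 * (t / 2) ^ d)" "0 \<le> 2 / (real d + 2) * v\<^sup>2 * (t / 2) ^ d"
      using core[of "t / \<tau>" t] t j1(2) by simp_all
    have c: "c_const TYPE('n) \<alpha> = 1 / (d * v) * (2 / t) ^ d" using False j1(1) by (simp add: c_eq t_def field_simps)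
    have c0: "c_const TYPE('n) \<alpha> > 0" unfolding c using d v t(1) by (intro mult_pos_pos divide_pos_pos zero_less_power) auto
    have "K = d * (v\<^sup>2 * (t / 2) ^ d)"
      unfolding K_def V1 c using d v t(1) by (simp add: field_simps power2_eq_square power_divide)
    moreover have "1 * (v\<^sup>2 * (t / 2) ^ d) \<le> d * (v\<^sup>2 * (t / 2) ^ d)"
      using t(1) d by (intro mult_right_mono) (auto simp: d_def Suc_leI)
    ultimately have "2 / (real d + 2) * (v\<^sup>2 * (t / 2) ^ d) \<le> 2 / (real d + 2) * K"
      by (intro mult_left_mono) auto
    then have le: "2 / (real d + 2) * v\<^sup>2 * (t / 2) ^ d \<le> 2 / (real d + 2) * K" by (simp only: mult.assoc)
    obtain \<mu> where mu: "\<mu> k = 1" "\<forall>j\<in>U - {k}. \<mu> j = 0"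
      "\<And>\<rho>. multiplier_bound x (cball 0 \<rho>) (cball 0 (\<rho> + t / \<tau>)) (2 / (real d + 2) * v\<^sup>2 * (t / 2) ^ d) \<mu>"
      using co(1) by blast
    have "multiplier_bound x (cball 0 \<rho>) (cball 0 (\<rho> + \<alpha> / \<tau>)) (2 / (real d + 2) * K) \<mu>" for \<rho>
      using t(3) tau by (intro multiplier_bound_weaken[OF mu(3)] compact_cball co(2) le subset_cball)
        (simp add: divide_right_mono)
    then show ?thesis using c0 mu by blast
  qed
  then show "c_const TYPE('n) \<alpha> > 0" "?concl (\<alpha> / \<tau>) (2 / (real CARD('n) + 2) * K)"
    by (auto simp: d_def)
qed

section \<open>Colourings, lattice points and elementary estimates\<close>

lemma greedy_coloring:
  assumes "finite X" and sym: "\<And>x y. adj x y \<Longrightarrow> adj y x"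
    and deg: "\<And>x. x \<in> X \<Longrightarrow> card {y \<in> X. y \<noteq> x \<and> adj x y} < \<nu>"
  shows "\<exists>col :: 'a \<Rightarrow> nat. (\<forall>x\<in>X. col x < \<nu>) \<and> (\<forall>x\<in>X. \<forall>y\<in>X. x \<noteq> y \<and> adj x y \<longrightarrow> col x \<noteq> col y)"
  using assms(1) deg
proof (induction X rule: finite_induct)
  case (insert a X)
  have deg': "card {y \<in> X. y \<noteq> x \<and> adj x y} < \<nu>" if "x \<in> X" for x
  proof -
    have "card {y \<in> X. y \<noteq> x \<and> adj x y} \<le> card {y \<in> insert a X. y \<noteq> x \<and> adj x y}"
      using insert.hyps by (intro card_mono) auto
    then show ?thesis using insert.prems[of x] that by simp
  qed
  from insert.IH[OF deg', simplified] obtain col :: "'a \<Rightarrow> nat"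
    where col: "\<forall>x\<in>X. col x < \<nu>" "\<forall>x\<in>X. \<forall>y\<in>X. x \<noteq> y \<and> adj x y \<longrightarrow> col x \<noteq> col y"
    by (elim exE conjE) blast
  let ?N = "{y \<in> X. adj a y}"
  have "?N = {y \<in> insert a X. y \<noteq> a \<and> adj a y}" using insert.hyps by auto
  then have "card ?N < \<nu>" using insert.prems[of a] by (simp only: insertI1)
  moreover have "card (col ` ?N) \<le> card ?N" using insert.hyps by (intro card_image_le) auto
  ultimately have "\<not> {..<\<nu>} \<subseteq> col ` ?N"
    using insert.hyps card_mono[of "col ` ?N" "{..<\<nu>}"] by auto
  then obtain c where c: "c < \<nu>" "c \<notin> col ` ?N" by auto
  let ?col = "col(a := c)"
  have "\<forall>x\<in>insert a X. ?col x < \<nu>" using col c by auto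
  moreover have "\<forall>x\<in>insert a X. \<forall>y\<in>insert a X. x \<noteq> y \<and> adj x y \<longrightarrow> ?col x \<noteq> ?col y"
  proof (intro ballI impI)
    fix x y assume xy: "x \<in> insert a X" "y \<in> insert a X" "x \<noteq> y \<and> adj x y"
    have new: "col z \<noteq> c" if "z \<in> X" "adj a z" for z using c(2) that by blast
    consider "x = a" "y \<in> X" | "y = a" "x \<in> X" | "x \<in> X" "y \<in> X" "x \<noteq> a" "y \<noteq> a" using xy by blast
    then show "?col x \<noteq> ?col y"
    proof cases
      case 1 then show ?thesis using new[of y] xy by auto
    next
      case 2 then show ?thesis using new[of x] sym[of x y] xy by auto
    next
      case 3 then show ?thesis using col(2) xy by auto
    qed
  qed
  ultimately show ?case by blast
qed auto

text \<open>
From \<open>sin(\<pi>/6) = 1/2\<close> and the Taylor polynomial of the sine at \<open>21/40\<close>.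
\<close>

lemma pi_less_315: "pi < 63 / 20"
proof (rule ccontr)
  assume "\<not> ?thesis"
  then have "sin (21 / 40) \<le> sin (pi / 6)"
    using pi_less_4 by (intro sin_monotone_2pi_le) auto
  then have "sin (21 / 40 :: real) \<le> 1 / 2" by (simp add: sin_30)
  moreover have "\<bar>sin (21 / 40) - (\<Sum>m<5. sin_coeff m * (21 / 40) ^ m)\<bar> \<le> inverse (fact 5) * \<bar>21 / 40 :: real\<bar> ^ 5"
    by (rule Maclaurin_sin_bound)
  moreover have "(\<Sum>m<5. sin_coeff m * (21 / 40 :: real) ^ m) = 21 / 40 - (21 / 40) ^ 3 / 6"
  proof -
    have "{..<5::nat} = {0, 1, 2, 3, 4}" by auto
    then show ?thesis by (simp add: sin_coeff_def fact_numeral)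
  qed
  ultimately have "\<bar>sin (21 / 40) - (21 / 40 - (21 / 40) ^ 3 / 6)\<bar> \<le> inverse 120 * (21 / 40 :: real) ^ 5" "sin (21 / 40 :: real) \<le> 1 / 2"
    by (simp_all add: fact_numeral)
  then show False by (simp add: power_divide)
qed

text \<open>
The chord of the concave sine function over \<open>[0, \<pi>/4]\<close>.
\<close>

lemma sin_lower_bound_quarter:
  assumes "0 \<le> t" "t \<le> 1 / 4"
  shows "2 * sqrt 2 * t \<le> sin (pi * t)"
proof -
  have "convex_on {0..pi} (\<lambda>x. - sin x)"
  proof (rule f''_ge0_imp_convex[where f' = "\<lambda>x. - cos x" and f'' = sin])
    show "((\<lambda>x. - sin x) has_real_derivative - cos x) (at x)" "((\<lambda>x. - cos x) has_real_derivative sin x) (at x)" for x :: real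
      by (auto intro!: derivative_eq_intros)
  qed (auto intro: sin_ge_zero)
  from convex_onD[OF this, of "4 * t" 0 "pi / 4"] assms
  have "- sin ((4 * t) * (pi / 4)) \<le> - ((4 * t) * sin (pi / 4))" by simp
  then show ?thesis by (simp add: sin_45 mult.commute)
qed

text \<open>
The unit cubes centred at the lattice points of the ball cover the ball whose radius is smaller by half the diameter of a
cube.
\<close>

lemma lattice_count_lower_bound:
  assumes R: "R \<ge> sqrt (real CARD('n)) / 2"
  shows "lebesgue_vol (cball (0 :: real ^ 'n) (R - sqrt (real CARD('n)) / 2)) \<le> real (lattice_count (cball (0 :: real ^ 'n) R))"
proof -
  let ?h = "sqrt (real CARD('n)) / 2"
  let ?Z = "cball (0 :: real ^ 'n) R \<inter> {z. \<forall>i. z $ i \<in> \<int>}"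
  have fin: "finite ?Z"
  proof (rule finite_subset)
    let ?S = "{k :: int. \<bar>real_of_int k\<bar> \<le> R}"
    have "?S \<subseteq> {- \<lceil>R\<rceil>..\<lceil>R\<rceil>}" by (auto simp: abs_le_iff) linarith+
    then have "finite ?S" using finite_subset by blast
    then have "finite {f :: 'n \<Rightarrow> int. \<forall>i. f i \<in> ?S}"
      using finite_PiE[of "UNIV :: 'n set" "\<lambda>_. ?S"] by (simp add: PiE_def Pi_def)
    then show "finite ((\<lambda>f. \<chi> i. real_of_int (f i)) ` {f :: 'n \<Rightarrow> int. \<forall>i. f i \<in> ?S})" by (rule finite_imageI)
    show "?Z \<subseteq> (\<lambda>f. \<chi> i. real_of_int (f i)) ` {f :: 'n \<Rightarrow> int. \<forall>i. f i \<in> ?S}"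
    proof
      fix z assume z: "z \<in> ?Z"
      define f where "f i = \<lfloor>z $ i\<rfloor>" for i
      have f: "real_of_int (f i) = z $ i" for i using z by (auto simp: f_def)
      have "\<bar>z $ i\<bar> \<le> R" for i using z component_le_norm_cart[of z i] by simp
      then have "\<forall>i. f i \<in> ?S" using f by simp
      moreover have "z = (\<chi> i. real_of_int (f i))" by (simp add: vec_eq_iff f)
      ultimately show "z \<in> (\<lambda>f. \<chi> i. real_of_int (f i)) ` {f :: 'n \<Rightarrow> int. \<forall>i. f i \<in> ?S}" by blast
    qed
  qed
  let ?e = "(\<chi> i. 1 / 2) :: real ^ 'n"
  let ?Q = "\<lambda>z. cbox (z - ?e) (z + ?e)"
  have Q1: "measure lebesgue (?Q z) = 1" for z :: "real ^ 'n"
  proof -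
    have "measure lborel (?Q z) = 1" by (subst content_cbox_cart) (auto simp: interval_ne_empty_cart)
    then show ?thesis by simp
  qed
  have sub: "cball 0 (R - ?h) \<subseteq> (\<Union>z\<in>?Z. ?Q z)"
  proof
    fix y :: "real ^ 'n" assume y: "y \<in> cball 0 (R - ?h)"
    define z :: "real ^ 'n" where "z = (\<chi> i. real_of_int (round (y $ i)))"
    have yz: "\<bar>y $ i - z $ i\<bar> \<le> 1 / 2" for i
      using of_int_round_abs_le[of "y $ i"] by (simp add: z_def abs_minus_commute)
    have "norm (y - z) \<le> ?h"
    proof -
      have "(norm (y - z))\<^sup>2 = (\<Sum>i\<in>UNIV. \<bar>y $ i - z $ i\<bar>\<^sup>2)"
        by (simp add: norm_vec_def L2_set_def sum_nonneg)
      also have "\<dots> \<le> (\<Sum>i\<in>(UNIV :: 'n set). (1 / 2)\<^sup>2)" using yz by (intro sum_mono power_mono) auto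
      also have "\<dots> = ?h\<^sup>2" by (simp add: power_divide)
      finally show ?thesis by (rule power2_le_imp_le) simp
    qed
    then have "norm z \<le> R" using y norm_triangle_ineq3[of z y] by (simp add: norm_minus_commute)
    then have "z \<in> ?Z" by (simp add: z_def)
    moreover have "z $ i - 1 / 2 \<le> y $ i \<and> y $ i \<le> z $ i + 1 / 2" for i using yz[of i] unfolding abs_le_iff by auto
    then have "y \<in> ?Q z" by (simp add: mem_box_cart)
    ultimately show "y \<in> (\<Union>z\<in>?Z. ?Q z)" by blast
  qed
  have "measure lebesgue (cball (0 :: real ^ 'n) (R - ?h)) \<le> measure lebesgue (\<Union>z\<in>?Z. ?Q z)"
    using fin by (intro measure_mono_fmeasurable sub lmeasurable_compact compact_UN compact_cbox) auto
  also have "\<dots> \<le> (\<Sum>z\<in>?Z. measure lebesgue (?Q z))" using fin by (intro measure_UNION_le) auto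
  finally show ?thesis using Q1 by (simp add: lebesgue_vol_def lattice_count_def)
qed

lemma exp_63_80_bound: "exp (63 / 80 :: real) \<le> 20 / 9"
proof -
  have "exp (63 / 80 :: real) ^ 19 = exp (19 * (63 / 80))" by (simp flip: exp_of_nat_mult)
  also have "\<dots> \<le> exp (15 :: real)" by simp
  also have "\<dots> = exp 1 ^ 15" by (simp flip: exp_of_nat_mult)
  also have "\<dots> \<le> (272 / 100) ^ 15" using e_less_272 by (intro power_mono) auto
  also have "\<dots> \<le> (20 / 9) ^ 19" by (simp add: power_divide)
  finally show ?thesis by (rule power_le_imp_le_base[where n=18, simplified]) simp
qed

text \<open>
With \<open>y = 63/(80(d+2))\<close> and \<open>t = 63/(80d)\<close> one has \<open>(1 - y)(1 + t) \<ge> 1\<close>, so the power is at least \<open>exp(-63/80)\<close>.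
\<close>

lemma lattice_shrink_large:
  assumes d: "d \<ge> (1::nat)"
  shows "9 / 20 \<le> (1 - 63 / (80 * (real d + 2))) ^ d"
proof -
  define y where "y = 63 / (80 * (real d + 2))"
  define t where "t = 63 / (80 * real d)"
  have y: "0 < y" "y < 1" using d by (auto simp: y_def field_simps)
  have t: "t \<ge> 0" by (simp add: t_def)
  define q where "q = 80 * (real d + 2)"
  have q: "q > 0" by (simp add: q_def add_nonneg_pos)
  have "y * (1 + t) = 63 * (80 * real d + 63) / (q * (80 * real d))"
    unfolding y_def t_def q_def[symmetric] using d q by (simp add: field_simps)
  also have "\<dots> \<le> 63 * q / (q * (80 * real d))"
    using q by (intro divide_right_mono) (auto simp: q_def)
  also have "\<dots> = t" using d q by (simp add: t_def)
  finally have "1 \<le> (1 - y) * (1 + t)" by (simp add: algebra_simps)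
  then have "1 \<le> ((1 - y) * (1 + t)) ^ d" by (rule one_le_power)
  also have "\<dots> = (1 - y) ^ d * (1 + t) ^ d" by (rule power_mult_distrib)
  also have "\<dots> \<le> (1 - y) ^ d * (20 / 9)"
  proof (intro mult_left_mono)
    have "(1 + t) ^ d \<le> exp t ^ d" using t exp_ge_add_one_self[of t] by (intro power_mono) auto
    also have "\<dots> = exp (63 / 80)" using d by (simp add: t_def flip: exp_of_nat_mult)
    finally show "(1 + t) ^ d \<le> 20 / 9" using exp_63_80_bound by simp
  qed (use y in auto)
  finally show ?thesis by (simp add: y_def)
qed

lemma lattice_shrink_small:
  assumes "2 \<le> d" "d \<le> (19::nat)"
  shows "(8 / 7) ^ d \<le> ((real d + 2) / 2 * (1 - 63 / (80 * (real d + 2))) ^ d)\<^sup>2"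
proof -
  have "d \<in> {2,3,4,5,6,7,8,9,10,11,12,13,14,15,16,17,18,19}" using assms by simp presburger
  then show ?thesis
    by (elim insertE; simp add: power_divide power_mult_distrib)
qed

section \<open>Products of sine multipliers\<close>

text \<open>
A quadratic inner approximation of the set of \<open>\<xi>\<close> such that \<open>\<xi> \<plusminus> a\<^sub>1 \<plusminus> \<dots> \<plusminus> a\<^sub>p\<close> lies in the ball of radius \<open>\<rho>\<close> for all
choices of signs. If the shifts are small compared with \<open>\<rho>/\<surd>d\<close>, it is much larger than the ball of radius
\<open>\<rho> - |a\<^sub>1| - \<dots> - |a\<^sub>p|\<close> in high dimension.
\<close>

definition sine_erosion :: "'i set \<Rightarrow> ('i \<Rightarrow> 'a::euclidean_space) \<Rightarrow> real \<Rightarrow> 'a set" where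
  "sine_erosion I a \<rho> = {\<xi>. (norm \<xi>)\<^sup>2 + 2 * (\<Sum>i\<in>I. \<bar>\<xi> \<bullet> a i\<bar>) + (\<Sum>i\<in>I. norm (a i))\<^sup>2 \<le> \<rho>\<^sup>2}"

lemma compact_sine_erosion: "compact (sine_erosion I a \<rho>)"
proof -
  have "closed (sine_erosion I a \<rho>)"
    unfolding sine_erosion_def by (intro closed_Collect_le continuous_intros)
  moreover have "sine_erosion I a \<rho> \<subseteq> cball 0 \<bar>\<rho>\<bar>"
  proof
    fix \<xi> assume "\<xi> \<in> sine_erosion I a \<rho>"
    moreover have "0 \<le> 2 * (\<Sum>i\<in>I. \<bar>\<xi> \<bullet> a i\<bar>)" by (simp add: sum_nonneg)
    moreover have "0 \<le> (\<Sum>i\<in>I. norm (a i))\<^sup>2" by simp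
    ultimately have "(norm \<xi>)\<^sup>2 \<le> \<rho>\<^sup>2" unfolding sine_erosion_def mem_Collect_eq by linarith
    then show "\<xi> \<in> cball 0 \<bar>\<rho>\<bar>" using abs_le_square_iff[of "norm \<xi>" \<rho>] by simp
  qed
  ultimately show ?thesis using bounded_subset[OF bounded_cball] by (auto simp: compact_eq_bounded_closed)
qed

lemma cball_subset_sine_erosion:
  fixes a :: "'i \<Rightarrow> 'a::euclidean_space"
  assumes "\<sigma> \<ge> 0" "\<sigma> + (\<Sum>i\<in>I. norm (a i)) \<le> \<rho>"
  shows "cball 0 \<sigma> \<subseteq> sine_erosion I a \<rho>"
proof
  fix \<xi> :: 'a assume "\<xi> \<in> cball 0 \<sigma>"
  then have x: "norm \<xi> \<le> \<sigma>" by simp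
  let ?A = "\<Sum>i\<in>I. norm (a i)"
  have A: "?A \<ge> 0" by (simp add: sum_nonneg)
  have "(\<Sum>i\<in>I. \<bar>\<xi> \<bullet> a i\<bar>) \<le> (\<Sum>i\<in>I. norm \<xi> * norm (a i))" by (intro sum_mono Cauchy_Schwarz_ineq2)
  also have "\<dots> = norm \<xi> * ?A" by (simp add: sum_distrib_left)
  finally have "(norm \<xi>)\<^sup>2 + 2 * (\<Sum>i\<in>I. \<bar>\<xi> \<bullet> a i\<bar>) + ?A\<^sup>2 \<le> (norm \<xi> + ?A)\<^sup>2" by (simp add: power2_sum)
  also have "\<dots> \<le> \<rho>\<^sup>2" using x A assms by (intro power_mono) auto
  finally show "\<xi> \<in> sine_erosion I a \<rho>" by (simp add: sine_erosion_def)
qed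

text \<open>
Moving by \<open>\<plusminus>a\<^sub>i\<close> turns a point of the erosion for \<open>I \<union> {i}\<close> into a point of the erosion for \<open>I\<close>, so the factors can be
applied one after the other.
\<close>

lemma multiplier_bound_sines:
  assumes "finite I" "\<rho> \<ge> 0"
  shows "multiplier_bound x (sine_erosion I a \<rho>) (cball 0 \<rho>) 1 (\<lambda>k. of_real (\<Prod>i\<in>I. sin (2 * pi * (a i \<bullet> (x k - y i)))))"
  using assms(1)
proof (induction I rule: finite_induct)
  case empty
  have "sine_erosion {} a \<rho> = cball 0 \<rho>" using assms(2) by (auto simp: sine_erosion_def)
  then show ?case using multiplier_bound_mono[of "cball 0 \<rho>" "cball 0 \<rho>" x] by simp
next
  case (insert i I)
  have step: "\<xi> + s *\<^sub>R a i \<in> sine_erosion I a \<rho>" if x: "\<xi> \<in> sine_erosion (insert i I) a \<rho>" and s: "\<bar>s\<bar> = 1" for \<xi> and s :: real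
  proof -
    let ?A = "\<Sum>j\<in>I. norm (a j)" and ?Z = "\<lambda>\<xi>. \<Sum>j\<in>I. \<bar>\<xi> \<bullet> a j\<bar>"
    have "(norm (\<xi> + s *\<^sub>R a i))\<^sup>2 = (norm \<xi>)\<^sup>2 + 2 * (s * (\<xi> \<bullet> a i)) + (norm (a i))\<^sup>2"
      using s by (simp add: power2_norm_eq_inner inner_add_left inner_add_right inner_commute algebra_simps abs_mult_self_eq[of s, symmetric])
    moreover have "s * (\<xi> \<bullet> a i) \<le> \<bar>\<xi> \<bullet> a i\<bar>" using s by (metis abs_ge_self abs_mult mult_1)
    moreover have "?Z (\<xi> + s *\<^sub>R a i) \<le> ?Z \<xi> + norm (a i) * ?A"
    proof -
      have "?Z (\<xi> + s *\<^sub>R a i) \<le> (\<Sum>j\<in>I. \<bar>\<xi> \<bullet> a j\<bar> + norm (a i) * norm (a j))"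
      proof (rule sum_mono)
        fix j
        have "\<bar>s * (a i \<bullet> a j)\<bar> \<le> norm (a i) * norm (a j)" using s Cauchy_Schwarz_ineq2[of "a i" "a j"] by (simp add: abs_mult)
        then show "\<bar>(\<xi> + s *\<^sub>R a i) \<bullet> a j\<bar> \<le> \<bar>\<xi> \<bullet> a j\<bar> + norm (a i) * norm (a j)"
          by (simp add: inner_add_left)
      qed
      then show ?thesis by (simp add: sum.distrib sum_distrib_left)
    qed
    ultimately have "(norm (\<xi> + s *\<^sub>R a i))\<^sup>2 + 2 * ?Z (\<xi> + s *\<^sub>R a i) + ?A\<^sup>2
        \<le> (norm \<xi>)\<^sup>2 + 2 * (\<bar>\<xi> \<bullet> a i\<bar> + ?Z \<xi>) + (norm (a i) + ?A)\<^sup>2" by (simp add: power2_sum algebra_simps)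
    also have "\<dots> \<le> \<rho>\<^sup>2" using x insert.hyps by (simp add: sine_erosion_def)
    finally show ?thesis by (simp add: sine_erosion_def)
  qed
  have "multiplier_bound x (sine_erosion (insert i I) a \<rho>) (sine_erosion I a \<rho>) 1 (\<lambda>k. of_real (sin (2 * pi * (a i \<bullet> (x k - y i)))))"
    using step[of _ 1] step[of _ "- 1"] by (intro multiplier_bound_sine compact_sine_erosion) auto
  from multiplier_bound_comp[OF this insert.IH] show ?case using insert.hyps by simp
qed

text \<open>
Chebyshev's inequality on the ball of radius \<open>\<theta>\<rho>\<close>: a point of this ball outside the erosion has a large value of
\<open>\<Sum> |\<xi>\<bullet>a\<^sub>i|\<close>, while the mean of \<open>(\<xi>\<bullet>a)\<^sup>2\<close> over the ball is only \<open>|a|\<^sup>2\<theta>\<^sup>2\<rho>\<^sup>2/(d+2)\<close>.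
\<close>

lemma measure_sine_erosion_lower_bound:
  fixes a :: "'i \<Rightarrow> 'a::euclidean_space"
  assumes I: "finite I" and \<rho>: "\<rho> > 0" and \<theta>: "0 < \<theta>" and a: "\<And>i. i \<in> I \<Longrightarrow> real (card I) * norm (a i) \<le> B * \<rho>"
    and B: "B \<ge> 0" and pos: "\<theta>\<^sup>2 + B\<^sup>2 < 1"
  shows "(1 - 4 * B\<^sup>2 * \<theta>\<^sup>2 / ((real DIM('a) + 2) * (1 - \<theta>\<^sup>2 - B\<^sup>2)\<^sup>2)) * \<theta> ^ DIM('a) * measure lborel (cball (0::'a) \<rho>)
    \<le> measure lborel (sine_erosion I a \<rho>)"
proof -
  let ?p = "real (card I)" and ?D = "real DIM('a) + 2" and ?E = "sine_erosion I a \<rho>"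
  define r where "r = \<theta> * \<rho>"
  define h where "h = \<rho>\<^sup>2 * (1 - \<theta>\<^sup>2 - B\<^sup>2) / 2"
  have r: "r > 0" using \<theta> \<rho> by (simp add: r_def)
  have h: "h > 0" using \<rho> pos by (simp add: h_def)
  let ?V = "measure lborel (cball (0::'a) r)"
  let ?C = "indicator (cball (0::'a) r) :: 'a \<Rightarrow> real"
  have V: "?V = \<theta> ^ DIM('a) * measure lborel (cball (0::'a) \<rho>)"
    using content_cball[of r "0::'a"] content_cball[of \<rho> "0::'a"] r \<rho> by (simp add: r_def power_mult_distrib)
  have ci: "integrable lborel (\<lambda>\<xi>. ?C \<xi> * f \<xi>)" if "continuous_on UNIV f" for f :: "'a \<Rightarrow> real"
    using integrable_ball_continuous[OF that, of r] by simp
  have c1: "integrable lborel ?C" using ci[of "\<lambda>_. 1"] by simp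
  have i2: "integrable lborel (\<lambda>\<xi>. ?C \<xi> * (\<xi> \<bullet> a i)\<^sup>2)" for i by (intro ci continuous_intros)
  have A: "(\<Sum>i\<in>I. norm (a i))\<^sup>2 \<le> (B * \<rho>)\<^sup>2"
  proof (cases "I = {}")
    case False
    have "(\<Sum>i\<in>I. norm (a i)) \<le> (\<Sum>i\<in>I. B * \<rho> / ?p)"
      using a I False by (intro sum_mono) (simp add: pos_le_divide_eq card_gt_0_iff mult.commute)
    also have "\<dots> = B * \<rho>" using I False by simp
    finally show ?thesis by (intro power_mono) (auto simp: sum_nonneg)
  qed simp
  have sum_a: "?p * (\<Sum>i\<in>I. (norm (a i))\<^sup>2) \<le> B\<^sup>2 * \<rho>\<^sup>2"
  proof (cases "I = {}")
    case False
    then have p: "?p > 0" using I by (simp add: card_gt_0_iff)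
    have "(norm (a i))\<^sup>2 \<le> (B * \<rho> / ?p)\<^sup>2" if "i \<in> I" for i
      using a[OF that] p by (intro power_mono) (simp_all add: pos_le_divide_eq mult.commute)
    then have "(\<Sum>i\<in>I. (norm (a i))\<^sup>2) \<le> ?p * (B * \<rho> / ?p)\<^sup>2" by (rule sum_bounded_above)
    from mult_left_mono[OF this, of ?p] show ?thesis using p by (simp add: power2_eq_square field_simps)
  qed simp
  have point: "?C \<xi> * (1 - ?p / h\<^sup>2 * (\<Sum>i\<in>I. (\<xi> \<bullet> a i)\<^sup>2)) \<le> indicator ?E \<xi>" for \<xi>
  proof (cases "\<xi> \<in> cball 0 r \<and> \<xi> \<notin> ?E")
    case True
    let ?Z = "\<Sum>i\<in>I. \<bar>\<xi> \<bullet> a i\<bar>"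
    have "(norm \<xi>)\<^sup>2 \<le> (\<theta> * \<rho>)\<^sup>2" using True by (intro power_mono) (auto simp: r_def)
    moreover have "\<rho>\<^sup>2 < (norm \<xi>)\<^sup>2 + 2 * ?Z + (\<Sum>i\<in>I. norm (a i))\<^sup>2" using True by (simp add: sine_erosion_def)
    ultimately have "\<rho>\<^sup>2 - (\<theta> * \<rho>)\<^sup>2 - (B * \<rho>)\<^sup>2 < 2 * ?Z" using A by linarith
    then have "h < ?Z" by (simp add: h_def power_mult_distrib algebra_simps)
    then have "h\<^sup>2 \<le> ?Z\<^sup>2" using h by (intro power_mono) auto
    also have "\<dots> \<le> ?p * (\<Sum>i\<in>I. \<bar>\<xi> \<bullet> a i\<bar>\<^sup>2)"
      using sum_squared_le_sum_of_squares[of "\<lambda>i. \<bar>\<xi> \<bullet> a i\<bar>" I] by (simp add: mult.commute)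
    finally have "1 \<le> ?p / h\<^sup>2 * (\<Sum>i\<in>I. (\<xi> \<bullet> a i)\<^sup>2)" using h by (simp add: field_simps)
    then show ?thesis using True by simp
  next
    case False
    have "0 \<le> ?p / h\<^sup>2 * (\<Sum>i\<in>I. (\<xi> \<bullet> a i)\<^sup>2)" by (intro mult_nonneg_nonneg sum_nonneg) auto
    then show ?thesis using False by (auto simp: indicator_def)
  qed
  have "1 - 4 * B\<^sup>2 * \<theta>\<^sup>2 / (?D * (1 - \<theta>\<^sup>2 - B\<^sup>2)\<^sup>2) \<le> 1 - ?p / h\<^sup>2 * (\<Sum>i\<in>I. (norm (a i))\<^sup>2) * (r\<^sup>2 / ?D)"
  proof -
    have "?p * (\<Sum>i\<in>I. (norm (a i))\<^sup>2) * (r\<^sup>2 / (h\<^sup>2 * ?D)) \<le> B\<^sup>2 * \<rho>\<^sup>2 * (r\<^sup>2 / (h\<^sup>2 * ?D))"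
      using sum_a by (intro mult_right_mono) auto
    also have "\<dots> = 4 * B\<^sup>2 * \<theta>\<^sup>2 / (?D * (1 - \<theta>\<^sup>2 - B\<^sup>2)\<^sup>2)"
    proof -
      define H where "H = 1 - \<theta>\<^sup>2 - B\<^sup>2"
      have "H > 0" using pos by (simp add: H_def)
      moreover define D where "D = ?D"
      moreover have "D > 0" by (simp add: D_def add_nonneg_pos)
      ultimately show ?thesis
        unfolding h_def r_def H_def[symmetric] D_def[symmetric] using \<rho> by (simp add: power_mult_distrib power_divide field_simps power2_eq_square)
    qed
    finally show ?thesis by (simp add: mult_ac)
  qed
  from mult_right_mono[OF this, of ?V]
  have "(1 - 4 * B\<^sup>2 * \<theta>\<^sup>2 / (?D * (1 - \<theta>\<^sup>2 - B\<^sup>2)\<^sup>2)) * ?V \<le> ?V - ?p / h\<^sup>2 * (\<Sum>i\<in>I. (norm (a i))\<^sup>2) * (r\<^sup>2 / ?D) * ?V"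
    by (simp add: left_diff_distrib)
  also have "\<dots> = ?V - ?p / h\<^sup>2 * (\<Sum>i\<in>I. \<integral>\<xi>. ?C \<xi> * (\<xi> \<bullet> a i)\<^sup>2 \<partial>lborel)"
    using integral_ball_inner_squared[of r "a i" for i] r by (simp add: sum_distrib_right sum_distrib_left mult_ac)
  also have "\<dots> = (\<integral>\<xi>. ?C \<xi> - ?p / h\<^sup>2 * (\<Sum>i\<in>I. ?C \<xi> * (\<xi> \<bullet> a i)\<^sup>2) \<partial>lborel)"
  proof -
    have "(\<integral>\<xi>. ?C \<xi> \<partial>lborel) = ?V" using c1 by simp
    then show ?thesis
      using Bochner_Integration.integral_diff[OF c1 integrable_mult_right[OF Bochner_Integration.integrable_sum[where I=I, OF i2], of "?p / h\<^sup>2"]]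
        Bochner_Integration.integral_sum[where I=I, OF i2]
      by (simp only: integral_mult_right_zero)
  qed
  also have "\<dots> = (\<integral>\<xi>. ?C \<xi> * (1 - ?p / h\<^sup>2 * (\<Sum>i\<in>I. (\<xi> \<bullet> a i)\<^sup>2)) \<partial>lborel)"
    by (simp add: sum_distrib_left[symmetric] right_diff_distrib mult_ac)
  also have "\<dots> \<le> (\<integral>\<xi>. indicator ?E \<xi> \<partial>lborel)"
    using point emeasure_bounded_finite[OF compact_imp_bounded[OF compact_sine_erosion[of I a \<rho>]]] compact_sine_erosion[of I a \<rho>]
    by (intro integral_mono ci integrable_real_indicator continuous_intros) (auto simp: compact_imp_closed borel_closed)
  also have "\<dots> = measure lborel ?E"
    using emeasure_bounded_finite[OF compact_imp_bounded[OF compact_sine_erosion[of I a \<rho>]]] compact_sine_erosion[of I a \<rho>]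
    by (auto simp: compact_imp_closed borel_closed)
  finally show ?thesis unfolding V by (simp add: mult.assoc)
qed

section \<open>Choice of the sine factors\<close>

text \<open>
There is equality for \<open>\<nu> = 2\<close>. From \<open>\<nu> = 5\<close> on, already \<open>(7/8)\<^sup>5 < (3/4)\<^sup>2\<close>.
\<close>

lemma seven_eighths_power_le:
  assumes "\<nu> \<ge> (1::nat)"
  shows "(7 / 8) ^ \<nu> \<le> (3 / 4 + 1 / (4 * real \<nu>))\<^sup>2"
proof (cases "\<nu> \<le> 4")
  case True
  then have "\<nu> \<in> {1, 2, 3, 4}" using assms by auto
  then show ?thesis by (elim insertE; simp add: power_divide)
next
  case False
  then have "(7 / 8 :: real) ^ \<nu> \<le> (7 / 8) ^ 5" by (intro power_decreasing) auto
  also have "\<dots> \<le> (3 / 4)\<^sup>2" by (simp add: power_divide)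
  also have "\<dots> \<le> (3 / 4 + 1 / (4 * real \<nu>))\<^sup>2" by (intro power_mono) auto
  finally show ?thesis .
qed

text \<open>
Each of the \<open>p < \<nu>\<close> intermediate points gets a sine factor with value \<open>sin(\<pi>\<kappa>/2)\<close> at \<open>x\<^sub>k\<close> and a shift of length at
most \<open>\<kappa>m/(4\<nu>)\<close>. Of the radius \<open>m/2\<close>, the hyperplanes leave \<open>\<rho>\<close>. The loss must be covered by \<open>2\<^sup>\<nu>\<^sup>-\<^sup>1 A\<^sup>\<nu>\<close>, where
\<open>A\<close> stands for \<open>(d+2)/2\<close> times the quotient of lattice points and volume.

With \<open>\<kappa> = 1/2\<close> the sines lose at most \<open>2\<^sup>\<nu>\<^sup>-\<^sup>1\<close>, and the shifts take at most \<open>m/8\<close>. If \<open>r \<ge> 1\<close>, this radius is free.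
If \<open>r = 0\<close>, the ball shrinks by the factor \<open>3/4 + 1/(4\<nu>)\<close>, and \<open>A\<^sup>\<nu>\<close> makes up for the loss of volume in dimensions up
to \<open>19\<close>. In higher dimensions the loss would be exponential in \<open>d\<close>; there \<open>\<kappa>\<close> is of order \<open>1/\<surd>d\<close>, each squared
sine loses a factor of order \<open>d\<close> covered by \<open>2A\<close>, and a fixed fraction of the ball survives the erosion.
\<close>

lemma intermediate_budget:
  fixes m A :: real and d r \<nu> p :: nat
  defines "d \<equiv> DIM('a::euclidean_space)"
  defines "\<rho> \<equiv> m / 2 - real r * (m / (4 * (real r + 1)))"
  assumes d2: "2 \<le> d" and p: "p < \<nu>" and m: "m > 0" and A0: "A > 0"
    and small: "d \<le> 19 \<Longrightarrow> (8 / 7) ^ d \<le> A\<^sup>2" and large: "20 \<le> d \<Longrightarrow> 9 / 40 * (real d + 2) \<le> A"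
  shows "\<exists>\<kappa>>0. \<kappa> \<le> 1 / 2 \<and> (\<forall>(I :: 'i set) (b :: 'i \<Rightarrow> 'a). finite I \<longrightarrow> card I = p \<longrightarrow>
      (\<forall>i\<in>I. norm (b i) \<le> \<kappa> * m / (4 * real \<nu>)) \<longrightarrow>
      measure lborel (cball (0::'a) (m / (2 * real r + 2)))
        \<le> sin (pi * (\<kappa> / 2)) ^ (2 * p) * (2 ^ (\<nu> - 1) * A ^ \<nu>) * measure lborel (sine_erosion I b \<rho>))"
proof -
  let ?V = "\<lambda>r. measure lborel (cball (0::'a) r)"
  have V: "?V t = unit_ball_vol d * t ^ d" if "t \<ge> 0" for t
    using content_cball[OF that, of "0::'a"] by (simp add: d_def)
  have nu: "real \<nu> > 0" using p by simp
  have A1: "A \<ge> 1"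
  proof (cases "d \<le> 19")
    case True
    have "1 \<le> (8 / 7 :: real) ^ d" by (intro one_le_power) simp
    from order_trans[OF this small[OF True]] have "1\<^sup>2 \<le> A\<^sup>2" by simp
    then show ?thesis by (rule power2_le_imp_le) (use A0 in simp)
  qed (use large in auto)
  have norms: "(\<Sum>i\<in>I. norm (b i)) \<le> real p * (\<kappa> * m / (4 * real \<nu>))"
    if "finite I" "card I = p" "\<forall>i\<in>I. norm (b i) \<le> \<kappa> * m / (4 * real \<nu>)" for I :: "'i set" and b :: "'i \<Rightarrow> 'a" and \<kappa>
    using sum_bounded_above[of I "\<lambda>i. norm (b i)" "\<kappa> * m / (4 * real \<nu>)"] that by simp
  have half: "sin (pi * (1 / 2 / 2)) ^ (2 * p) * 2 ^ (\<nu> - 1) \<ge> 1"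
  proof -
    have "sin (pi * (1 / 2 / 2)) = sqrt 2 / 2" using sin_45 by simp
    then have "(sin (pi * (1 / 2 / 2)))\<^sup>2 = 1 / 2" by (simp only: power_divide) simp
    then have eq: "sin (pi * (1 / 2 / 2)) ^ (2 * p) = (1 / 2) ^ p" by (simp only: power_mult)
    have "(1::real) = (1 / 2) ^ p * 2 ^ p" by (simp add: power_one_over)
    also have "\<dots> \<le> (1 / 2) ^ p * 2 ^ (\<nu> - 1)" using p by (intro mult_left_mono power_increasing) auto
    finally show ?thesis unfolding eq .
  qed
  have erosion_mono: "?V \<sigma> \<le> measure lborel (sine_erosion I b \<rho>)"
    if "\<sigma> \<ge> 0" "\<sigma> + (\<Sum>i\<in>I. norm (b i)) \<le> \<rho>" for \<sigma> and I :: "'i set" and b :: "'i \<Rightarrow> 'a"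
    using cball_subset_sine_erosion[OF that]
    by (intro measure_mono_fmeasurable) (auto intro!: fmeasurable_compact compact_sine_erosion)
  consider "r \<ge> 1" | "r = 0" "d \<le> 19" | "r = 0" "20 \<le> d" by linarith
  then show ?thesis
  proof cases
    case 1
    show ?thesis
    proof (intro exI[of _ "1 / 2"] conjI allI impI)
      fix I :: "'i set" and b :: "'i \<Rightarrow> 'a"
      assume I: "finite I" "card I = p" "\<forall>i\<in>I. norm (b i) \<le> 1 / 2 * m / (4 * real \<nu>)"
      have "real p * (1 / 2 * m / (4 * real \<nu>)) = real p / real \<nu> * (m / 8)" by simp
      also have "\<dots> \<le> 1 * (m / 8)" using p m by (intro mult_right_mono) auto
      finally have "real p * (1 / 2 * m / (4 * real \<nu>)) \<le> 1 * (m / 8)" .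
      from order_trans[OF norms[OF I] this] have "(\<Sum>i\<in>I. norm (b i)) \<le> m / 8" by simp
      moreover have "m / (2 * real r + 2) + m / 8 \<le> \<rho>"
      proof -
        have "\<rho> = m * ((real r + 2) / (4 * (real r + 1)))" by (simp add: \<rho>_def field_simps)
        moreover have "m / (2 * real r + 2) + m / 8 = m * ((real r + 5) / (8 * (real r + 1)))" by (simp add: field_simps)
        moreover have "(real r + 5) / (8 * (real r + 1)) \<le> (real r + 2) / (4 * (real r + 1))"
          using 1 mult_mono[of 1 "real r" 1 "real r"] by (simp add: field_simps)
        ultimately show ?thesis using m by (simp only: mult_left_mono less_imp_le)
      qed
      ultimately have "?V (m / (2 * real r + 2)) \<le> measure lborel (sine_erosion I b \<rho>)"
        using m by (intro erosion_mono) auto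
      moreover have "1 * 1 \<le> sin (pi * (1 / 2 / 2)) ^ (2 * p) * 2 ^ (\<nu> - 1) * A ^ \<nu>"
        using half A1 by (intro mult_mono one_le_power) auto
      ultimately have "1 * ?V (m / (2 * real r + 2)) \<le> (sin (pi * (1 / 2 / 2)) ^ (2 * p) * 2 ^ (\<nu> - 1) * A ^ \<nu>) * measure lborel (sine_erosion I b \<rho>)"
        by (intro mult_mono) auto
      then show "?V (m / (2 * real r + 2)) \<le> sin (pi * (1 / 2 / 2)) ^ (2 * p) * (2 ^ (\<nu> - 1) * A ^ \<nu>) * measure lborel (sine_erosion I b \<rho>)"
        by (simp add: mult.assoc)
    qed auto
  next
    case 2
    define f where "f = 3 / 4 + 1 / (4 * real \<nu>)"
    have f: "f > 0" by (simp add: f_def add_pos_nonneg)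
    have fA: "1 \<le> f ^ d * A ^ \<nu>"
    proof -
      have "1 = (7 / 8 * (8 / 7 :: real)) ^ (\<nu> * d)" by simp
      also have "\<dots> = ((7 / 8) ^ \<nu>) ^ d * ((8 / 7) ^ d) ^ \<nu>"
        unfolding power_mult_distrib power_mult[symmetric] by (simp add: mult.commute)
      also have "\<dots> \<le> (f\<^sup>2) ^ d * (A\<^sup>2) ^ \<nu>"
        using seven_eighths_power_le[of \<nu>] p small[OF 2(2)] by (intro mult_mono power_mono) (auto simp: f_def)
      also have "\<dots> = (f ^ d * A ^ \<nu>)\<^sup>2" by (simp add: power_mult_distrib power_mult[symmetric] mult.commute)
      finally have "1\<^sup>2 \<le> (f ^ d * A ^ \<nu>)\<^sup>2" by simp
      then show ?thesis by (rule power2_le_imp_le) (use f A0 in simp)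
    qed
    show ?thesis
    proof (intro exI[of _ "1 / 2"] conjI allI impI)
      fix I :: "'i set" and b :: "'i \<Rightarrow> 'a"
      assume I: "finite I" "card I = p" "\<forall>i\<in>I. norm (b i) \<le> 1 / 2 * m / (4 * real \<nu>)"
      have "real p * (1 / 2 * m / (4 * real \<nu>)) \<le> (real \<nu> - 1) * (1 / 2 * m / (4 * real \<nu>))"
        using p m by (intro mult_right_mono) auto
      also have "\<dots> = m / 2 - f * (m / 2)" using nu by (simp add: f_def field_simps)
      finally have "f * (m / 2) + (\<Sum>i\<in>I. norm (b i)) \<le> \<rho>" using norms[OF I] 2(1) by (simp add: \<rho>_def)
      then have E: "?V (f * (m / 2)) \<le> measure lborel (sine_erosion I b \<rho>)" using f m by (intro erosion_mono) auto
      have "?V (m / (2 * real r + 2)) = 1 * 1 * ?V (m / 2)" using 2(1) by simp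
      also have "\<dots> \<le> (sin (pi * (1 / 2 / 2)) ^ (2 * p) * 2 ^ (\<nu> - 1)) * (f ^ d * A ^ \<nu>) * ?V (m / 2)"
        using half fA by (intro mult_right_mono mult_mono) auto
      also have "\<dots> = (sin (pi * (1 / 2 / 2)) ^ (2 * p) * (2 ^ (\<nu> - 1) * A ^ \<nu>)) * ?V (f * (m / 2))"
      proof -
        have "?V (f * (m / 2)) = unit_ball_vol d * (f * (m / 2)) ^ d" "?V (m / 2) = unit_ball_vol d * (m / 2) ^ d"
          using f m by (intro V; simp)+
        then have "?V (f * (m / 2)) = f ^ d * ?V (m / 2)" by (simp only: power_mult_distrib mult.left_commute)
        then show ?thesis by (simp only: mult_ac)
      qed
      also have "\<dots> \<le> (sin (pi * (1 / 2 / 2)) ^ (2 * p) * (2 ^ (\<nu> - 1) * A ^ \<nu>)) * measure lborel (sine_erosion I b \<rho>)"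
        using half E A0 by (intro mult_left_mono) (auto simp: zero_le_mult_iff)
      finally show "?V (m / (2 * real r + 2)) \<le> sin (pi * (1 / 2 / 2)) ^ (2 * p) * (2 ^ (\<nu> - 1) * A ^ \<nu>) * measure lborel (sine_erosion I b \<rho>)" .
    qed auto
  next
    case 3
    \<comment> \<open>The value of \<open>\<kappa>\<close> is the smallest with \<open>2\<kappa>\<^sup>2 \<ge> 1/(2A)\<close> for \<open>A = 9D/40\<close>; the total shift is at most \<open>B\<rho>\<close>, and the choice of \<open>\<theta>\<close> keeps \<open>\<theta>\<^sup>d\<close> above \<open>1/3\<close>.\<close>
    define D where "D = real d + 2"
    have D: "D \<ge> 22" using 3 by (simp add: D_def)
    define \<kappa> where "\<kappa> = sqrt (10 / 9 / D)"
    define \<theta> where "\<theta> = sqrt (real d / D)"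
    define B where "B = \<kappa> / 2"
    have k2: "\<kappa>\<^sup>2 = 10 / 9 / D" and k0: "\<kappa> > 0" using D by (auto simp: \<kappa>_def)
    have "\<kappa>\<^sup>2 \<le> (1 / 2)\<^sup>2" unfolding k2 using D by (simp add: power2_eq_square field_simps)
    then have k1: "\<kappa> \<le> 1 / 2" by (rule power2_le_imp_le) simp
    have t2: "\<theta>\<^sup>2 = real d / D" and t0: "\<theta> > 0" using D 3 by (auto simp: \<theta>_def)
    have B2: "B\<^sup>2 = 5 / 18 / D" using k2 D by (simp add: B_def power_divide)
    have dD: "real d / D = 1 - 2 / D" using D by (simp add: D_def field_simps)
    have gap: "1 - \<theta>\<^sup>2 - B\<^sup>2 = 31 / 18 / D" unfolding t2 B2 dD using D by (simp add: field_simps)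
    have theta_pow: "1 / 3 \<le> \<theta> ^ d"
    proof -
      have "(D / real d) ^ d \<le> exp (2 / real d) ^ d"
      proof (rule power_mono)
        have "D / real d = 1 + 2 / real d" using 3 by (simp add: D_def field_simps)
        then show "D / real d \<le> exp (2 / real d)" using exp_ge_add_one_self[of "2 / real d"] by simp
      qed (use D in auto)
      also have "\<dots> = exp 2" using 3 by (simp flip: exp_of_nat_mult)
      also have "exp (2::real) = (exp 1)\<^sup>2" by (simp flip: exp_of_nat_mult)
      also have "\<dots> \<le> 3\<^sup>2" using exp_le by (intro power_mono) auto
      finally have "(D / real d) ^ d \<le> 9" by simp
      then have le: "(D / real d) ^ d * (\<theta> ^ d)\<^sup>2 \<le> 9 * (\<theta> ^ d)\<^sup>2" by (intro mult_right_mono) auto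
      have one: "(D / real d) ^ d * (\<theta> ^ d)\<^sup>2 = 1"
      proof -
        have "(\<theta> ^ d)\<^sup>2 = (real d / D) ^ d" unfolding t2[symmetric] by (simp add: power_mult[symmetric] mult.commute)
        then show ?thesis using D 3 by (simp add: power_mult_distrib[symmetric])
      qed
      have "(1 / 3 :: real)\<^sup>2 = 1 / 9" by (simp add: power_divide)
      then have "(1 / 3)\<^sup>2 \<le> (\<theta> ^ d)\<^sup>2" using le unfolding one by linarith
      then show ?thesis by (rule power2_le_imp_le) (use t0 in simp)
    qed
    define S where "S = sin (pi * (\<kappa> / 2))"
    have S: "20 / 9 / D \<le> S\<^sup>2"
    proof -
      have "2 * sqrt 2 * (\<kappa> / 2) \<le> S" unfolding S_def using k0 k1 by (intro sin_lower_bound_quarter) auto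
      then have "(2 * sqrt 2 * (\<kappa> / 2))\<^sup>2 \<le> S\<^sup>2" using k0 by (intro power_mono) auto
      then show ?thesis by (simp add: power_mult_distrib power_divide k2)
    qed
    have A: "9 / 40 * D \<le> A" using large 3 by (simp add: D_def)
    have SA: "1 \<le> S\<^sup>2 * (2 * A)"
    proof -
      have "1 = 20 / 9 / D * (2 * (9 / 40 * D))" using D by simp
      also have "\<dots> \<le> S\<^sup>2 * (2 * A)" using S A D by (intro mult_mono) auto
      finally show ?thesis .
    qed
    have main: "A \<le> S ^ (2 * p) * (2 ^ (\<nu> - 1) * A ^ \<nu>)"
    proof -
      have "1 * 1 \<le> (S\<^sup>2 * (2 * A)) ^ p * (2 * A) ^ (\<nu> - 1 - p)"
        using SA A1 by (intro mult_mono one_le_power) auto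
      also have "\<dots> = S ^ (2 * p) * (2 * A) ^ (\<nu> - 1)"
      proof -
        have "p + (\<nu> - 1 - p) = \<nu> - 1" using p by simp
        then have "(2 * A) ^ p * (2 * A) ^ (\<nu> - 1 - p) = (2 * A) ^ (\<nu> - 1)" by (simp only: power_add[symmetric])
        then show ?thesis unfolding power_mult_distrib[of "S\<^sup>2"] power_mult mult.assoc by (simp only:)
      qed
      finally have "A * 1 \<le> A * (S ^ (2 * p) * (2 * A) ^ (\<nu> - 1))" using A0 by (intro mult_left_mono) auto
      also have "\<dots> = S ^ (2 * p) * (2 ^ (\<nu> - 1) * A ^ \<nu>)"
        using p by (cases \<nu>) (auto simp: power_mult_distrib)
      finally show ?thesis by simp
    qed
    show ?thesis
    proof (intro exI[of _ \<kappa>] conjI allI impI k0 k1)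
      fix I :: "'i set" and b :: "'i \<Rightarrow> 'a"
      assume I: "finite I" "card I = p" "\<forall>i\<in>I. norm (b i) \<le> \<kappa> * m / (4 * real \<nu>)"
      have \<rho>: "\<rho> = m / 2" using 3 by (simp add: \<rho>_def)
      have "(1 - 4 * B\<^sup>2 * \<theta>\<^sup>2 / ((real DIM('a) + 2) * (1 - \<theta>\<^sup>2 - B\<^sup>2)\<^sup>2)) * \<theta> ^ DIM('a) * ?V \<rho>
          \<le> measure lborel (sine_erosion I b \<rho>)"
      proof (rule measure_sine_erosion_lower_bound[OF I(1)])
        fix i assume i: "i \<in> I"
        have "real (card I) * norm (b i) \<le> real p * (\<kappa> * m / (4 * real \<nu>))"
          using I i by (intro mult_mono) auto
        also have "\<dots> = real p / real \<nu> * (\<kappa> * m / 4)" by simp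
        also have "\<dots> \<le> 1 * (\<kappa> * m / 4)" using p m k0 by (intro mult_right_mono) auto
        also have "\<dots> = B * \<rho>" by (simp add: B_def \<rho>)
        finally show "real (card I) * norm (b i) \<le> B * \<rho>" .
      next
        have "0 < 31 / 18 / D" using D by simp
        then show "\<theta>\<^sup>2 + B\<^sup>2 < 1" using gap by linarith
      qed (use m t0 k0 \<rho> in \<open>auto simp: B_def\<close>)
      moreover have "5 / 8 \<le> 1 - 4 * B\<^sup>2 * \<theta>\<^sup>2 / ((real DIM('a) + 2) * (1 - \<theta>\<^sup>2 - B\<^sup>2)\<^sup>2)"
      proof -
        have "4 * B\<^sup>2 * \<theta>\<^sup>2 / (D * (1 - \<theta>\<^sup>2 - B\<^sup>2)\<^sup>2) = 10 / 9 * (18 / 31)\<^sup>2 * (real d / D)"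
          unfolding gap unfolding B2 t2 using D by (simp add: power_divide power2_eq_square field_simps)
        also have "\<dots> \<le> 10 / 9 * (18 / 31)\<^sup>2 * 1" unfolding dD using D by (intro mult_left_mono) auto
        also have "\<dots> \<le> 3 / 8" by (simp add: power_divide)
        finally show ?thesis by (simp add: D_def d_def)
      qed
      moreover have "5 / 8 * (1 / 3) * ?V \<rho> \<le> (1 - 4 * B\<^sup>2 * \<theta>\<^sup>2 / ((real DIM('a) + 2) * (1 - \<theta>\<^sup>2 - B\<^sup>2)\<^sup>2)) * \<theta> ^ DIM('a) * ?V \<rho>"
        using calculation(2) theta_pow by (intro mult_right_mono mult_mono) (auto simp: d_def)
      ultimately have E: "5 / 24 * ?V \<rho> \<le> measure lborel (sine_erosion I b \<rho>)" by simp
      have "?V (m / (2 * real r + 2)) = 1 * ?V \<rho>" using 3 by (simp add: \<rho>)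
      also have "\<dots> \<le> A * (5 / 24) * ?V \<rho>" using A D by (intro mult_right_mono) auto
      also have "\<dots> = A * (5 / 24 * ?V \<rho>)" by simp
      also have "\<dots> \<le> S ^ (2 * p) * (2 ^ (\<nu> - 1) * A ^ \<nu>) * measure lborel (sine_erosion I b \<rho>)"
        using main E A0 by (intro mult_mono) auto
      finally show "?V (m / (2 * real r + 2)) \<le> sin (pi * (\<kappa> / 2)) ^ (2 * p) * (2 ^ (\<nu> - 1) * A ^ \<nu>) * measure lborel (sine_erosion I b \<rho>)"
        unfolding S_def .
    qed
  qed
qed

section \<open>The bound for one coefficient and the theorem\<close>

lemma energy_single:
  fixes x :: "'s::finite \<Rightarrow> 'a::euclidean_space"
  assumes "\<And>j. j \<noteq> k \<Longrightarrow> u j = 0"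
  shows "energy x E u = (norm (u k))\<^sup>2 * measure lborel E"
proof -
  have "trig_sum x u \<xi> = u k * cis (- 2 * pi * (\<xi> \<bullet> x k))" for \<xi>
    unfolding trig_sum_def using assms by (subst sum.remove[of _ k]) auto
  then have "energy x E u = (\<integral>\<xi>. indicator E \<xi> * (norm (u k))\<^sup>2 \<partial>lborel)"
    by (simp add: energy_def norm_mult)
  then show ?thesis by simp
qed

lemma multiplier_bound_subset:
  assumes "multiplier_bound x E E' \<kappa> \<mu>" "compact E0" "compact E" "E0 \<subseteq> E"
  shows "multiplier_bound x E0 E' \<kappa> \<mu>"
  using assms energy_mono[OF assms(2-4), of x] by (auto simp: multiplier_bound_def intro: order_trans)

lemma multiplier_bound_iterate:
  assumes \<mu>: "\<And>c \<rho>. c < n \<Longrightarrow> multiplier_bound x (cball 0 \<rho>) (cball 0 (\<rho> + R)) \<kappa> (\<mu> c)" and \<kappa>: "\<kappa> \<ge> 0"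
  shows "multiplier_bound x (cball 0 \<rho>) (cball 0 (\<rho> + real n * R)) (\<kappa> ^ n) (\<lambda>k. \<Prod>c<n. \<mu> c k)"
  using \<mu>
proof (induction n)
  case 0
  then show ?case using multiplier_bound_mono[of "cball 0 \<rho>" "cball 0 \<rho>" x] by simp
next
  case (Suc n)
  have "multiplier_bound x (cball 0 \<rho>) (cball 0 (\<rho> + real n * R)) (\<kappa> ^ n) (\<lambda>k. \<Prod>c<n. \<mu> c k)"
    using Suc by simp
  from multiplier_bound_comp[OF this Suc.prems[of n "\<rho> + real n * R"]] \<kappa>
  show ?case by (simp add: algebra_simps)
qed

text \<open>
The normal vector \<open>v\<close> is scaled so that the phase at \<open>z\<close> is exactly \<open>1\<close>; its length is then the reciprocal of the distance
from \<open>z\<close> to the hyperplane.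
\<close>

lemma hyperplane_normal_form:
  fixes H :: "'a::euclidean_space set"
  assumes "affine_hyperplane H" "z \<notin> H" "infdist z H \<ge> \<eta>" "\<eta> > 0"
  shows "\<exists>v y. norm v \<le> 1 / \<eta> \<and> v \<bullet> (z - y) = 1 \<and> (\<forall>h\<in>H. v \<bullet> (h - y) = 0)"
proof -
  obtain a b where a: "a \<noteq> 0" and H: "H = {y. a \<bullet> y = b}" using assms(1) by (auto simp: affine_hyperplane_def)
  define s where "s = a \<bullet> z - b"
  have s: "s \<noteq> 0" using assms(2) by (simp add: H s_def)
  have aa: "a \<bullet> a \<noteq> 0" using a by simp
  define y where "y = z - (s / (a \<bullet> a)) *\<^sub>R a"
  have y: "a \<bullet> y = b" using aa by (simp add: y_def s_def inner_diff_right)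
  have "\<eta> \<le> dist z y" using assms(3) infdist_le[of y H z] y by (simp add: H)
  also have "dist z y = \<bar>s\<bar> / norm a"
    using a by (simp add: y_def dist_norm power2_norm_eq_inner[symmetric] power2_eq_square)
  finally have "\<eta> * norm a \<le> \<bar>s\<bar>" using a by (simp add: pos_le_divide_eq)
  then have "norm ((1 / s) *\<^sub>R a) \<le> 1 / \<eta>" using s assms(4) by (simp add: field_simps)
  moreover have "((1 / s) *\<^sub>R a) \<bullet> (z - y) = 1"
  proof -
    have "a \<bullet> (z - y) = s" by (simp add: inner_diff_right y s_def)
    then show ?thesis using s by (simp only: inner_scaleR_left) simp
  qed
  moreover have "((1 / s) *\<^sub>R a) \<bullet> (h - y) = 0" if "h \<in> H" for h using that y by (simp add: inner_diff_right H)
  ultimately show ?thesis by (intro exI[of _ "(1 / s) *\<^sub>R a"] exI[of _ y] conjI ballI)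
qed

text \<open>
As \<open>\<tau> \<le> 1/(4\<surd>d)\<close> and \<open>\<alpha> \<ge> (d+2)/(2\<pi>)\<close>, half the diameter of a unit cube is a small part of the radius \<open>\<alpha>/\<tau>\<close>.
\<close>

lemma lattice_ratio_bounds:
  fixes \<alpha> \<tau> :: real
  defines "d \<equiv> CARD('n::finite)"
  defines "A \<equiv> (real d + 2) / 2 * (real (lattice_count (cball (0 :: real ^ 'n) (\<alpha> / \<tau>))) / lebesgue_vol (cball (0 :: real ^ 'n) (\<alpha> / \<tau>)))"
  assumes d2: "2 \<le> d" and alpha: "\<alpha> > bessel_zero (real d / 2 - 1) 1 / pi"
    and tau: "0 < \<tau>" "\<tau> \<le> 1 / (4 * sqrt (real d))"
  shows "A > 0" "d \<le> 19 \<Longrightarrow> (8 / 7) ^ d \<le> A\<^sup>2" "20 \<le> d \<Longrightarrow> 9 / 40 * (real d + 2) \<le> A"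
proof -
  define R where "R = \<alpha> / \<tau>"
  define y where "y = 63 / (80 * (real d + 2))"
  have dpos: "real d > 0" using d2 by simp
  have y: "0 < y" "y < 1" by (auto simp: y_def field_simps)
  have "real d + 2 \<le> 2 * pi * \<alpha>"
  proof -
    have "((real d + 2) / 2)\<^sup>2 \<le> real d / 2 * (real d / 2 + 4)"
      using d2 by (simp add: power2_eq_square field_simps)
    then have "(real d + 2) / 2 \<le> sqrt (real d / 2 * (real d / 2 + 4))" by (rule real_le_rsqrt)
    also have "\<dots> \<le> bessel_zero (real d / 2 - 1) 1" using bessel_zero_lower_bound[of "real d / 2"] dpos by simp
    also have "\<dots> < pi * \<alpha>" using alpha by (simp add: field_simps)
    finally show ?thesis by simp
  qed
  moreover have "2 * pi * \<alpha> \<le> 63 / 10 * \<alpha>"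
  proof -
    have "\<alpha> > 0" using \<open>real d + 2 \<le> 2 * pi * \<alpha>\<close> by (smt (verit) dpos mult_nonneg_nonpos pi_gt_zero)
    then show ?thesis using pi_less_315 by simp
  qed
  ultimately have al: "real d + 2 \<le> 63 / 10 * \<alpha>" by simp
  then have al0: "\<alpha> > 0" using dpos by simp
  have R0: "R > 0" using al0 tau by (simp add: R_def)
  have shrink: "sqrt (real d) / 2 \<le> R * y"
  proof -
    have "4 * sqrt (real d) * \<alpha> * \<tau> \<le> \<alpha>" using tau al0 dpos by (simp add: field_simps)
    then have "4 * sqrt (real d) * \<alpha> \<le> R" using tau by (simp add: R_def field_simps)
    then have "4 * sqrt (real d) * \<alpha> * y \<le> R * y" using y by (intro mult_right_mono) auto
    moreover have "1 / 8 \<le> \<alpha> * y" using al by (simp add: y_def field_simps)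
    then have "4 * sqrt (real d) * (1 / 8) \<le> 4 * sqrt (real d) * (\<alpha> * y)" by (intro mult_left_mono) auto
    ultimately show ?thesis by simp
  qed
  have "R * y \<le> R" using R0 y by simp
  then have Rd: "sqrt (real d) / 2 \<le> R" using shrink by simp
  have "unit_ball_vol d * (R * (1 - y)) ^ d \<le> unit_ball_vol d * (R - sqrt (real d) / 2) ^ d"
    using shrink R0 y by (intro mult_left_mono power_mono) (auto simp: algebra_simps)
  also have "\<dots> \<le> real (lattice_count (cball (0 :: real ^ 'n) R))"
    using lattice_count_lower_bound[where 'n='n, of R] Rd
    by (simp add: d_def[symmetric] lebesgue_vol_cball)
  finally have "(1 - y) ^ d \<le> real (lattice_count (cball (0 :: real ^ 'n) R)) / lebesgue_vol (cball (0 :: real ^ 'n) R)"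
    using R0 by (simp add: lebesgue_vol_cball d_def[symmetric] pos_le_divide_eq power_mult_distrib mult_ac)
  then have ge: "(real d + 2) / 2 * (1 - y) ^ d \<le> A"
    unfolding A_def R_def by (intro mult_left_mono) auto
  have pos: "0 < (real d + 2) / 2 * (1 - y) ^ d" using y by (intro mult_pos_pos) auto
  show "A > 0" using ge pos by simp
  show "(8 / 7) ^ d \<le> A\<^sup>2" if "d \<le> 19"
    using lattice_shrink_small[OF d2 that] power_mono[OF ge, of 2] pos by (simp add: y_def)
  show "9 / 40 * (real d + 2) \<le> A" if "20 \<le> d"
  proof -
    have "9 / 40 * (real d + 2) = (real d + 2) / 2 * (9 / 20)" by simp
    also have "\<dots> \<le> (real d + 2) / 2 * (1 - y) ^ d"
      using lattice_shrink_large[of d] d2 by (intro mult_left_mono) (auto simp: y_def)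
    finally show ?thesis using ge by simp
  qed
qed

text \<open>
All multipliers are combined: the \<open>\<nu>\<close> kernels take the ball of radius \<open>m/2\<close> to that of radius \<open>m\<close>, the sine factors of
the hyperplanes take the ball of radius \<open>\<rho>\<close> to that of radius \<open>m/2\<close>, and those of the intermediate points take the
erosion to the ball of radius \<open>\<rho>\<close>.
\<close>

lemma coefficient_bound:
  fixes x :: "'s::finite \<Rightarrow> real ^ 'n::finite"
    and \<alpha> m \<tau> \<eta> :: real and r \<nu> :: nat
  defines "K \<equiv> lebesgue_vol (cball (0 :: real ^ 'n) 1) / c_const TYPE('n) \<alpha>"
    and "L \<equiv> real (lattice_count (cball (0 :: real ^ 'n) (\<alpha> / \<tau>))) / lebesgue_vol (cball (0 :: real ^ 'n) (\<alpha> / \<tau>))"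
  assumes d2: "CARD('n) \<ge> 2"
    and alpha: "\<alpha> > bessel_zero (real CARD('n) / 2 - 1) 1 / pi"
    and inj: "inj x" and m: "m > 0"
    and tau: "0 < \<tau>" "\<tau> \<le> 1 / (4 * sqrt (real CARD('n)))"
    and nu: "\<nu> = local_sparsity 2 \<tau> (range x)" and far: "2 * \<alpha> * real \<nu> / \<tau> \<le> m"
    and hyp: "locally_consists_of_hyperplanes (range x) 2 (real \<nu> / m) r \<eta>"
    and eta: "\<eta> \<le> (real r + 1) / (2 * m)"
  shows "c_const TYPE('n) \<alpha> > 0" and "L > 0" and "\<nu> \<ge> 1" and "\<eta> > 0"
    and "(norm (u k))\<^sup>2 * ((2 * m * \<eta> / (real r + 1))\<^sup>2 / 2) ^ r * lebesgue_vol (cball (0 :: real ^ 'n) (m / (2 * real r + 2)))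
      \<le> 2 ^ (\<nu> - 1) * (K * L) ^ \<nu> * energy x (cball 0 m) u"
proof -
  define d where "d = CARD('n)"
  have nb: "neighborhood 2 z t (range x) = x ` {j. norm (x j - z) \<le> t}" for z t
    by (auto simp: neighborhood_def lp_norm_2)
  have card_nb: "card (neighborhood 2 z t (range x)) = card {j. norm (x j - z) \<le> t}" for z t
    unfolding nb by (rule card_image[OF inj_on_subset[OF inj subset_UNIV]])
  have ball_card: "card {j. norm (x j - x i) \<le> \<tau>} \<le> \<nu>" for i
  proof -
    have "card (neighborhood 2 (x i) \<tau> (range x)) \<le> Max ((\<lambda>z. card (neighborhood 2 z \<tau> (range x))) ` range x)"
      by (rule Max_ge) auto
    then show ?thesis by (simp only: card_nb nu[unfolded local_sparsity_def])
  qed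
  have neighbours: "card {j. j \<noteq> i \<and> norm (x j - x i) \<le> \<tau>} < \<nu>" for i
  proof -
    have "{j. j \<noteq> i \<and> norm (x j - x i) \<le> \<tau>} = {j. norm (x j - x i) \<le> \<tau>} - {i}" by blast
    moreover have "card ({j. norm (x j - x i) \<le> \<tau>} - {i}) < card {j. norm (x j - x i) \<le> \<tau>}"
      using tau(1) by (intro card_Diff1_less) simp_all
    ultimately show ?thesis using ball_card[of i] by simp
  qed
  show nu1: "\<nu> \<ge> 1" using neighbours[of undefined] by simp
  show eta0: "\<eta> > 0" using hyp by (simp add: locally_consists_of_hyperplanes_def)
  note A_bounds = lattice_ratio_bounds[where 'n='n, OF d2 alpha tau, folded L_def]
  define A where "A = (real d + 2) / 2 * L"
  have A0: "A > 0" using A_bounds(1) by (simp add: A_def d_def)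
  have "real d + 2 > 0" by (simp add: add_nonneg_pos)
  then show L0: "L > 0" using A0 by (simp add: A_def zero_less_mult_iff)
  have d0: "real d + 2 > 0" by (simp add: add_nonneg_pos)

  obtain col :: "'s \<Rightarrow> nat" where col: "\<And>i. col i < \<nu>"
    "\<And>i j. i \<noteq> j \<Longrightarrow> norm (x j - x i) \<le> \<tau> \<Longrightarrow> col i \<noteq> col j"
  proof -
    have "\<exists>col :: 's \<Rightarrow> nat. (\<forall>i\<in>UNIV. col i < \<nu>) \<and> (\<forall>i\<in>UNIV. \<forall>j\<in>UNIV. i \<noteq> j \<and> norm (x j - x i) \<le> \<tau> \<longrightarrow> col i \<noteq> col j)"
    proof (rule greedy_coloring[where X=UNIV and adj="\<lambda>i j. norm (x j - x i) \<le> \<tau>" and \<nu>=\<nu>])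
      show "norm (x i - x j) \<le> \<tau>" if "norm (x j - x i) \<le> \<tau>" for i j
        using that by (simp only: norm_minus_commute[of "x i"])
      show "card {j \<in> UNIV. j \<noteq> i \<and> norm (x j - x i) \<le> \<tau>} < \<nu>" for i
        using neighbours[of i] by simp
    qed simp
    then obtain c :: "'s \<Rightarrow> nat" where "\<forall>i\<in>UNIV. c i < \<nu>" "\<forall>i\<in>UNIV. \<forall>j\<in>UNIV. i \<noteq> j \<and> norm (x j - x i) \<le> \<tau> \<longrightarrow> c i \<noteq> c j"
      by (elim exE conjE)
    then show ?thesis by (intro that[of c]) simp_all
  qed
  \<comment> \<open>Only points farther than \<open>\<tau>\<close> enter, so \<open>x k\<close> can be added to every colour class.\<close>
  define U where "U c = insert k {j. norm (x j - x k) > \<tau> \<and> col j = c}" for c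
  have sep: "dist (x i) (x j) > \<tau>" if "i \<in> U c" "j \<in> U c" "i \<noteq> j" for i j c
  proof (rule ccontr)
    assume "\<not> dist (x i) (x j) > \<tau>"
    then have close: "norm (x j - x i) \<le> \<tau>" by (simp add: dist_norm norm_minus_commute[of "x j"])
    have close': "norm (x i - x j) \<le> \<tau>" using close by (simp only: norm_minus_commute[of "x i"])
    have "i \<noteq> k" using that close by (auto simp: U_def)
    moreover have "j \<noteq> k" using that close' by (auto simp: U_def)
    ultimately show False using that col(2)[OF that(3) close] by (simp add: U_def)
  qed
  have kU: "k \<in> U c" for c by (simp add: U_def)
  show c0: "c_const TYPE('n) \<alpha> > 0" by (rule separated_multiplier(1)[OF alpha tau(1) kU sep])
  define \<kappa>2 where "\<kappa>2 = 2 / (real d + 2) * K"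
  have K0: "K > 0" using c0 by (simp add: K_def lebesgue_vol_cball)
  have k20: "\<kappa>2 > 0" using K0 d0 by (simp add: \<kappa>2_def)
  have "\<exists>\<mu>. \<mu> k = 1 \<and> (\<forall>j\<in>U c - {k}. \<mu> j = 0) \<and> (\<forall>\<rho>. multiplier_bound x (cball 0 \<rho>) (cball 0 (\<rho> + \<alpha> / \<tau>)) \<kappa>2 \<mu>)" for c
    unfolding \<kappa>2_def K_def d_def by (rule separated_multiplier(2)[OF alpha tau(1) kU sep])
  then obtain \<mu> where \<mu>: "\<And>c. \<mu> c k = 1" "\<And>c j. j \<in> U c - {k} \<Longrightarrow> \<mu> c j = 0"
    "\<And>c \<rho>. multiplier_bound x (cball 0 \<rho>) (cball 0 (\<rho> + \<alpha> / \<tau>)) \<kappa>2 (\<mu> c)"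
  proof -
    assume ex: "\<And>c. \<exists>\<mu>. \<mu> k = 1 \<and> (\<forall>j\<in>U c - {k}. \<mu> j = 0) \<and> (\<forall>\<rho>. multiplier_bound x (cball 0 \<rho>) (cball 0 (\<rho> + \<alpha> / \<tau>)) \<kappa>2 \<mu>)"
    then have "\<exists>\<mu>. \<forall>c. \<mu> c k = 1 \<and> (\<forall>j\<in>U c - {k}. \<mu> c j = 0) \<and> (\<forall>\<rho>. multiplier_bound x (cball 0 \<rho>) (cball 0 (\<rho> + \<alpha> / \<tau>)) \<kappa>2 (\<mu> c))"
      by (intro choice allI)
    then show thesis using that by blast
  qed
  define \<mu>F where "\<mu>F j = (\<Prod>c<\<nu>. \<mu> c j)" for j
  have far_mult: "multiplier_bound x (cball 0 (m / 2)) (cball 0 m) (\<kappa>2 ^ \<nu>) \<mu>F"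
    unfolding \<mu>F_def
  proof (rule multiplier_bound_weaken[OF multiplier_bound_iterate[OF \<mu>(3)]])
    have "2 * \<alpha> * real \<nu> / \<tau> = 2 * (real \<nu> * (\<alpha> / \<tau>))" by simp
    then have "m / 2 + real \<nu> * (\<alpha> / \<tau>) \<le> m" using far by linarith
    then show "cball 0 (m / 2 + real \<nu> * (\<alpha> / \<tau>)) \<subseteq> cball (0 :: real ^ 'n) m" by (rule subset_cball)
  qed (use k20 in auto)

  have "\<forall>z\<in>range x. \<exists>q\<le>r. \<exists>H. consists_of_hyperplanes (neighborhood 2 z (real \<nu> / m) (range x)) z q H \<and>
      (\<forall>i<q. infdist z (H i) \<ge> \<eta>)"
    using hyp unfolding locally_consists_of_hyperplanes_def by (rule conjunct2)
  from bspec[OF this rangeI[of x k]] obtain q H where q: "q \<le> r" and H: "consists_of_hyperplanes (neighborhood 2 (x k) (real \<nu> / m) (range x)) (x k) q H"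
    "\<And>i. i < q \<Longrightarrow> infdist (x k) (H i) \<ge> \<eta>"
    by (elim exE conjE) simp
  have "\<exists>v y. norm v \<le> 1 / \<eta> \<and> v \<bullet> (x k - y) = 1 \<and> (\<forall>h\<in>H i. v \<bullet> (h - y) = 0)" if i: "i < q" for i
  proof -
    have Hi: "affine_hyperplane (H i)" "x k \<notin> H i"
      using H(1) i unfolding consists_of_hyperplanes_def by simp_all
    show ?thesis by (rule hyperplane_normal_form[OF Hi H(2)[OF i] eta0])
  qed
  then have "\<forall>i. \<exists>w. i < q \<longrightarrow> norm (fst w) \<le> 1 / \<eta> \<and> fst w \<bullet> (x k - snd w) = 1 \<and> (\<forall>h\<in>H i. fst w \<bullet> (h - snd w) = 0)"
    by simp
  from choice[OF this] obtain w where w: "\<And>i. i < q \<Longrightarrow> norm (fst (w i)) \<le> 1 / \<eta> \<and> fst (w i) \<bullet> (x k - snd (w i)) = 1 \<and> (\<forall>h\<in>H i. fst (w i) \<bullet> (h - snd (w i)) = 0)"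
    by blast
  obtain v y where vy: "\<And>i. i < q \<Longrightarrow> norm (v i) \<le> 1 / \<eta>" "\<And>i. i < q \<Longrightarrow> v i \<bullet> (x k - y i) = 1"
    "\<And>i h. i < q \<Longrightarrow> h \<in> H i \<Longrightarrow> v i \<bullet> (h - y i) = 0"
    using w by (intro that[of "\<lambda>i. fst (w i)" "\<lambda>i. snd (w i)"]) auto
  define \<psi> where "\<psi> = m * \<eta> / (2 * (real r + 1))"
  have psi: "0 < \<psi>" "\<psi> \<le> 1 / 4"
    using m eta0 eta by (auto simp: \<psi>_def field_simps)
  \<comment> \<open>Scaled so that every hyperplane gives the same value \<open>sin (\<pi>\<psi>)\<close> at \<open>x k\<close>, whatever its distance.\<close>
  define vh where "vh i = (\<psi> / 2) *\<^sub>R v i" for i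
  define \<mu>H where "\<mu>H j = (\<Prod>i\<in>{..<q}. sin (2 * pi * (vh i \<bullet> (x j - y i))))" for j
  define \<rho> where "\<rho> = m / 2 - real r * (m / (4 * (real r + 1)))"
  have rho0: "\<rho> \<ge> 0"
  proof -
    have "real r * (m / (4 * (real r + 1))) = m / 4 * (real r / (real r + 1))" by simp
    also have "\<dots> \<le> m / 4 * 1" using m by (intro mult_left_mono) auto
    finally have "real r * (m / (4 * (real r + 1))) \<le> m / 4 * 1" .
    then show ?thesis using m unfolding \<rho>_def by linarith
  qed
  have near_mult: "multiplier_bound x (cball 0 \<rho>) (cball 0 (m / 2)) 1 (\<lambda>j. of_real (\<mu>H j))"
    unfolding \<mu>H_def
  proof (rule multiplier_bound_subset[OF multiplier_bound_sines])
    have "norm (vh i) \<le> m / (4 * (real r + 1))" if "i < q" for i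
    proof -
      have "norm (vh i) \<le> \<psi> / 2 * (1 / \<eta>)" using mult_left_mono[OF vy(1)[OF that], of "\<psi> / 2"] psi(1) by (simp add: vh_def)
      also have "\<dots> = m / (4 * (real r + 1))" using eta0 by (simp add: \<psi>_def)
      finally show ?thesis .
    qed
    then have "(\<Sum>i<q. norm (vh i)) \<le> real q * (m / (4 * (real r + 1)))"
      using sum_bounded_above[of "{..<q}" "\<lambda>i. norm (vh i)" "m / (4 * (real r + 1))"] by simp
    also have "\<dots> \<le> real r * (m / (4 * (real r + 1)))" using q m by (intro mult_right_mono) auto
    finally have "\<rho> + (\<Sum>i<q. norm (vh i)) \<le> m / 2" unfolding \<rho>_def by linarith
    then show "cball 0 \<rho> \<subseteq> sine_erosion {..<q} vh (m / 2)"
      by (rule cball_subset_sine_erosion[OF rho0])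
  qed (use m in \<open>auto simp: compact_sine_erosion\<close>)
  have near_zero: "\<mu>H j = 0" if j: "j \<noteq> k" "norm (x j - x k) \<le> real \<nu> / m" for j
  proof -
    have "x j \<in> neighborhood 2 (x k) (real \<nu> / m) (range x) - {x k}"
      using j inj by (auto simp: nb inj_eq)
    then obtain i where i: "i < q" "x j \<in> H i" using H(1) by (auto simp: consists_of_hyperplanes_def)
    then have "sin (2 * pi * (vh i \<bullet> (x j - y i))) = 0" using vy(3)[of i "x j"] by (simp add: vh_def)
    then show ?thesis unfolding \<mu>H_def using i(1) by (intro prod_zero bexI[of _ i]) auto
  qed
  define h where "h = (2 * m * \<eta> / (real r + 1))\<^sup>2 / 2"
  have "2 * m * \<eta> / (real r + 1) = 4 * \<psi>"
    unfolding \<psi>_def times_divide_eq_right by (subst frac_eq_eq) auto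
  then have h: "h = 8 * \<psi>\<^sup>2" by (simp add: h_def power_mult_distrib)
  \<comment> \<open>There may be fewer than \<open>r\<close> hyperplanes; the power \<open>r\<close> is still a lower bound, since the upper bound on \<open>\<eta>\<close> gives \<open>h \<le> 1\<close>.\<close>
  have near_k: "h ^ r \<le> (\<mu>H k)\<^sup>2"
  proof -
    have h01: "0 \<le> h" "h \<le> 1"
    proof -
      have "\<psi>\<^sup>2 \<le> (1 / 4)\<^sup>2" using psi by (intro power_mono) auto
      then show "0 \<le> h" "h \<le> 1" by (auto simp: h power_divide)
    qed
    have "2 * sqrt 2 * \<psi> \<le> sin (pi * \<psi>)" using psi by (intro sin_lower_bound_quarter) auto
    then have "(2 * sqrt 2 * \<psi>)\<^sup>2 \<le> (sin (pi * \<psi>))\<^sup>2" using psi by (intro power_mono) auto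
    then have "h \<le> (sin (pi * \<psi>))\<^sup>2" by (simp add: h power_mult_distrib)
    then have "h ^ q \<le> ((sin (pi * \<psi>))\<^sup>2) ^ q" using h01 by (intro power_mono) auto
    moreover have "\<mu>H k = sin (pi * \<psi>) ^ q"
    proof -
      have "sin (2 * pi * (vh i \<bullet> (x k - y i))) = sin (pi * \<psi>)" if "i < q" for i
        using vy(2)[OF that] by (simp add: vh_def)
      then show ?thesis by (simp add: \<mu>H_def)
    qed
    moreover have "h ^ r \<le> h ^ q" using q h01 by (intro power_decreasing) auto
    ultimately show ?thesis by (simp add: power_mult[symmetric] mult.commute)
  qed

  define P where "P = {j. real \<nu> / m < norm (x j - x k) \<and> norm (x j - x k) \<le> \<tau>}"
  have P: "card P < \<nu>"
  proof -
    have "P \<subseteq> {j. j \<noteq> k \<and> norm (x j - x k) \<le> \<tau>}" using m by (auto simp: P_def divide_less_0_iff)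
    then have "card P \<le> card {j. j \<noteq> k \<and> norm (x j - x k) \<le> \<tau>}" by (intro card_mono) auto
    then show ?thesis using neighbours[of k] by simp
  qed
  obtain \<kappa> where kap: "\<kappa> > 0" "\<kappa> \<le> 1 / 2" and budget:
    "\<And>b :: 's \<Rightarrow> real ^ 'n. (\<forall>j\<in>P. norm (b j) \<le> \<kappa> * m / (4 * real \<nu>)) \<Longrightarrow>
      measure lborel (cball (0 :: real ^ 'n) (m / (2 * real r + 2)))
        \<le> sin (pi * (\<kappa> / 2)) ^ (2 * card P) * (2 ^ (\<nu> - 1) * A ^ \<nu>) * measure lborel (sine_erosion P b \<rho>)"
  proof -
    have "\<exists>\<kappa>>0. \<kappa> \<le> 1 / 2 \<and> (\<forall>(I :: 's set) (b :: 's \<Rightarrow> real ^ 'n). finite I \<longrightarrow> card I = card P \<longrightarrow>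
      (\<forall>i\<in>I. norm (b i) \<le> \<kappa> * m / (4 * real \<nu>)) \<longrightarrow>
      measure lborel (cball (0 :: real ^ 'n) (m / (2 * real r + 2)))
        \<le> sin (pi * (\<kappa> / 2)) ^ (2 * card P) * (2 ^ (\<nu> - 1) * A ^ \<nu>) * measure lborel (sine_erosion I b \<rho>))"
      unfolding \<rho>_def
      using intermediate_budget[where 'a="real ^ 'n" and 'i='s and p="card P" and r=r and A=A, OF _ P m A0] A_bounds d2
      by (simp add: A_def d_def)
    then obtain \<kappa> where "\<kappa> > 0" "\<kappa> \<le> 1 / 2" and all: "\<forall>(I :: 's set) (b :: 's \<Rightarrow> real ^ 'n). finite I \<longrightarrow> card I = card P \<longrightarrow>
      (\<forall>i\<in>I. norm (b i) \<le> \<kappa> * m / (4 * real \<nu>)) \<longrightarrow>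
      measure lborel (cball (0 :: real ^ 'n) (m / (2 * real r + 2)))
        \<le> sin (pi * (\<kappa> / 2)) ^ (2 * card P) * (2 ^ (\<nu> - 1) * A ^ \<nu>) * measure lborel (sine_erosion I b \<rho>)"
      by (elim exE conjE)
    then show ?thesis using all[rule_format, of P] by (intro that) auto
  qed
  \<comment> \<open>The shift in direction \<open>x k - x j\<close> whose sine factor has the value \<open>sin (\<pi>\<kappa>/2)\<close> at \<open>x k\<close>; it is short because \<open>x j\<close> is farther than \<open>\<nu>/m\<close>.\<close>
  define b where "b j = (\<kappa> / (4 * (norm (x k - x j))\<^sup>2)) *\<^sub>R (x k - x j)" for j
  have b: "norm (b j) \<le> \<kappa> * m / (4 * real \<nu>)" "b j \<bullet> (x k - x j) = \<kappa> / 4" if j: "j \<in> P" for j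
  proof -
    define z where "z = norm (x k - x j)"
    have z: "real \<nu> / m < z" using j by (simp add: P_def z_def norm_minus_commute)
    have nu0: "real \<nu> > 0" using nu1 by simp
    then have z0: "z > 0" using z m by (meson divide_pos_pos less_trans)
    have "norm (b j) = \<kappa> / (4 * z)"
      using kap z0 by (simp add: b_def z_def[symmetric] power2_eq_square)
    also have "\<dots> \<le> \<kappa> * m / (4 * real \<nu>)" using z z0 kap nu0 m by (simp add: field_simps)
    finally show "norm (b j) \<le> \<kappa> * m / (4 * real \<nu>)" .
    show "b j \<bullet> (x k - x j) = \<kappa> / 4"
      using z0 by (simp add: b_def z_def power2_norm_eq_inner[symmetric])
  qed
  define \<mu>M where "\<mu>M j = (\<Prod>i\<in>P. sin (2 * pi * (b i \<bullet> (x j - x i))))" for j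
  have mid_mult: "multiplier_bound x (sine_erosion P b \<rho>) (cball 0 \<rho>) 1 (\<lambda>j. of_real (\<mu>M j))"
    unfolding \<mu>M_def by (rule multiplier_bound_sines) (use rho0 in auto)
  have mid_zero: "\<mu>M j = 0" if "j \<in> P" for j
    unfolding \<mu>M_def using that by (intro prod_zero bexI[of _ j]) auto
  have mid_k: "(\<mu>M k)\<^sup>2 = sin (pi * (\<kappa> / 2)) ^ (2 * card P)"
  proof -
    have "\<mu>M k = (\<Prod>i\<in>P. sin (pi * (\<kappa> / 2)))"
      unfolding \<mu>M_def
    proof (rule prod.cong)
      fix i assume "i \<in> P"
      then have "2 * pi * (b i \<bullet> (x k - x i)) = pi * (\<kappa> / 2)" by (simp add: b(2))
      then show "sin (2 * pi * (b i \<bullet> (x k - x i))) = sin (pi * (\<kappa> / 2))" by (simp only:)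
    qed simp
    then show ?thesis by (simp add: power_mult[symmetric] mult.commute)
  qed

  define E where "E = sine_erosion P b \<rho>"
  define \<mu>A where "\<mu>A = (\<lambda>j. of_real (\<mu>M j) * (of_real (\<mu>H j) * \<mu>F j))"
  have all_mult: "multiplier_bound x E (cball 0 m) (\<kappa>2 ^ \<nu>) \<mu>A"
    using multiplier_bound_comp[OF mid_mult multiplier_bound_comp[OF near_mult far_mult]]
    by (simp add: E_def \<mu>A_def)
  have zero: "\<mu>A j = 0" if j: "j \<noteq> k" for j
  proof -
    consider "norm (x j - x k) \<le> real \<nu> / m" | "j \<in> P" | "norm (x j - x k) > \<tau>" unfolding P_def by force
    then show ?thesis
    proof cases
      case 1
      then show ?thesis using near_zero[OF j] by (simp add: \<mu>A_def)
    next
      case 2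
      then show ?thesis using mid_zero by (simp add: \<mu>A_def)
    next
      case 3
      then have "\<mu> (col j) j = 0" using j by (intro \<mu>(2)) (auto simp: U_def)
      then have "\<mu>F j = 0" using col(1)[of j] by (auto simp: \<mu>F_def)
      then show ?thesis by (simp add: \<mu>A_def)
    qed
  qed
  have "(norm (\<mu>A k * u k))\<^sup>2 * measure lborel E = energy x E (\<lambda>j. \<mu>A j * u j)"
    using zero by (intro energy_single[symmetric]) auto
  also have "\<dots> \<le> \<kappa>2 ^ \<nu> * energy x (cball 0 m) u"
    using all_mult by (simp add: multiplier_bound_def)
  finally have main: "(norm (\<mu>A k * u k))\<^sup>2 * measure lborel E \<le> \<kappa>2 ^ \<nu> * energy x (cball 0 m) u" .
  have norm_k: "(norm (\<mu>A k * u k))\<^sup>2 = (\<mu>M k)\<^sup>2 * (\<mu>H k)\<^sup>2 * (norm (u k))\<^sup>2"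
    by (simp add: \<mu>A_def \<mu>F_def \<mu>(1) norm_mult power_mult_distrib)
  have "(norm (u k))\<^sup>2 * h ^ r * measure lborel (cball (0 :: real ^ 'n) (m / (2 * real r + 2)))
      \<le> (norm (u k))\<^sup>2 * (\<mu>H k)\<^sup>2 * ((\<mu>M k)\<^sup>2 * (2 ^ (\<nu> - 1) * A ^ \<nu>) * measure lborel E)"
    using near_k budget[of b] b(1) unfolding mid_k E_def
    by (intro mult_mono mult_left_mono) (auto simp: h_def)
  also have "\<dots> = (2 ^ (\<nu> - 1) * A ^ \<nu>) * ((norm (\<mu>A k * u k))\<^sup>2 * measure lborel E)"
    unfolding norm_k by (simp add: mult_ac)
  also have "\<dots> \<le> (2 ^ (\<nu> - 1) * A ^ \<nu>) * (\<kappa>2 ^ \<nu> * energy x (cball 0 m) u)"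
    using main A0 by (intro mult_left_mono) auto
  also have "\<dots> = 2 ^ (\<nu> - 1) * (A * \<kappa>2) ^ \<nu> * energy x (cball 0 m) u" by (simp add: power_mult_distrib)
  also have "A * \<kappa>2 = K * L" using d0 by (simp add: A_def \<kappa>2_def)
  finally show "(norm (u k))\<^sup>2 * ((2 * m * \<eta> / (real r + 1))\<^sup>2 / 2) ^ r * lebesgue_vol (cball (0 :: real ^ 'n) (m / (2 * real r + 2)))
      \<le> 2 ^ (\<nu> - 1) * (K * L) ^ \<nu> * energy x (cball 0 m) u"
    by (simp add: h_def lebesgue_vol_def)
qed

lemma L2_norm_on_fourier_op:
  fixes x :: "'s::finite \<Rightarrow> real ^ 'n::finite"
  assumes "compact E"
  shows "L2_norm_on E (fourier_op x u) = sqrt (energy x E (\<lambda>k. u $ k))"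
proof -
  have "fourier_op x u = trig_sum x (\<lambda>k. u $ k)"
    by (auto simp: fun_eq_iff fourier_op_def trig_sum_def cis_conv_exp mult_ac)
  then show ?thesis
    using borel_measurable_integrable[OF integrable_energy[OF assms, of x "\<lambda>k. u $ k"]]
    by (simp add: L2_norm_on_def energy_def set_lebesgue_integral_def integral_completion)
qed

theorem theorem4p2:
  fixes x :: "'s::finite \<Rightarrow> real ^ 'n::finite"
    and \<alpha> m \<tau> \<eta> :: real
    and r \<nu> :: nat
  assumes "CARD('n) \<ge> 2"
    and "\<alpha> > bessel_zero (real CARD('n) / 2 - 1) 1 / pi"
    and "inj x"
    and "\<forall>k i. - 1 / 2 \<le> x k $ i \<and> x k $ i < 1 / 2"
    and "m \<ge> 4 * real CARD('s) * sqrt (real CARD('n))"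
    and "0 < \<tau>" and "\<tau> \<le> 1 / (4 * sqrt (real CARD('n)))"
    and "\<nu> = local_sparsity 2 \<tau> (range x)"
    and "2 * \<alpha> * real \<nu> / \<tau> \<le> m"
    and "locally_consists_of_hyperplanes (range x) 2 (real \<nu> / m) r \<eta>"
    and "\<eta> \<le> (real r + 1) / (2 * m)"
  shows "sigma_min (cball 0 m) x
    \<ge> 1 / sqrt (2 powr (real \<nu> - 1) * real CARD('s))
      * (c_const TYPE('n) \<alpha> / lebesgue_vol (cball (0 :: real ^ 'n) 1)) powr (real \<nu> / 2)
      * (lebesgue_vol (cball (0 :: real ^ 'n) (\<alpha> / \<tau>)) / real (lattice_count (cball (0 :: real ^ 'n) (\<alpha> / \<tau>))))
          powr (real \<nu> / 2)
      * sqrt (lebesgue_vol (cball (0 :: real ^ 'n) (m / (2 * real r + 2))))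
      * (1 / 2 powr (real r / 2))
      * (2 * m * \<eta> / (real r + 1)) ^ r"
proof -
  have m: "m > 0"
  proof -
    have "0 < 4 * real CARD('s) * sqrt (real CARD('n))" by simp
    then show ?thesis using assms(5) by linarith
  qed
  define K where "K = lebesgue_vol (cball (0 :: real ^ 'n) 1) / c_const TYPE('n) \<alpha>"
  define L where "L = real (lattice_count (cball (0 :: real ^ 'n) (\<alpha> / \<tau>))) / lebesgue_vol (cball (0 :: real ^ 'n) (\<alpha> / \<tau>))"
  define V where "V = lebesgue_vol (cball (0 :: real ^ 'n) (m / (2 * real r + 2)))"
  define g where "g = 2 * m * \<eta> / (real r + 1)"
  define s where "s = real CARD('s)"
  note cb = coefficient_bound[OF assms(1,2,3) m assms(6-11), folded K_def L_def, folded V_def g_def]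
  have c0: "c_const TYPE('n) \<alpha> > 0" and L0: "L > 0" and nu1: "\<nu> \<ge> 1" and eta0: "\<eta> > 0" by (fact cb(1-4))+
  have K0: "K > 0" using c0 by (simp add: K_def lebesgue_vol_cball)
  have V0: "V \<ge> 0" by (simp add: V_def lebesgue_vol_def)
  have g0: "g \<ge> 0" using m eta0 by (simp add: g_def)
  have s0: "s > 0" by (simp add: s_def)
  have half: "(t powr (real n / 2))\<^sup>2 = t ^ n" if "t > 0" for t :: real and n :: nat
  proof -
    have "(t powr (real n / 2))\<^sup>2 = t powr (real n / 2 + real n / 2)" by (simp only: power2_eq_square powr_add)
    then show ?thesis using that by (simp add: powr_realpow)
  qed
  let ?rhs = "1 / sqrt (2 powr (real \<nu> - 1) * s) * (1 / K) powr (real \<nu> / 2) * (1 / L) powr (real \<nu> / 2) * sqrt V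
      * (1 / 2 powr (real r / 2)) * g ^ r"
  have rhs0: "?rhs \<ge> 0" using V0 g0 s0 by (intro mult_nonneg_nonneg) auto
  have rhs2: "2 ^ (\<nu> - 1) * (K * L) ^ \<nu> * ?rhs\<^sup>2 = 1 / s * (g\<^sup>2 / 2) ^ r * V"
  proof -
    have p2: "2 powr (real \<nu> - 1) = (2::real) ^ (\<nu> - 1)"
      using nu1 by (simp add: powr_realpow[symmetric] of_nat_diff)
    have "(1 / sqrt (2 powr (real \<nu> - 1) * s))\<^sup>2 = 1 / (2 ^ (\<nu> - 1) * s)"
      unfolding p2 power_divide using s0 by simp
    moreover have "((1 / K) powr (real \<nu> / 2))\<^sup>2 = 1 / K ^ \<nu>" "((1 / L) powr (real \<nu> / 2))\<^sup>2 = 1 / L ^ \<nu>"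
      using K0 L0 by (simp_all add: half power_one_over)
    moreover have "(1 / 2 powr (real r / 2))\<^sup>2 = 1 / (2::real) ^ r" by (simp add: half power_divide)
    ultimately have "?rhs\<^sup>2 = 1 / (2 ^ (\<nu> - 1) * s) * (1 / K ^ \<nu>) * (1 / L ^ \<nu>) * V * (1 / 2 ^ r) * (g ^ r)\<^sup>2"
      unfolding power_mult_distrib using V0 by simp
    then show ?thesis
      using K0 L0 by (simp add: power_mult_distrib power_divide power_mult[symmetric] mult.commute)
  qed
  have "?rhs \<le> L2_norm_on (cball 0 m) (fourier_op x u)" if u: "norm u = 1" for u :: "complex ^ 's"
  proof -
    have "\<exists>k. 1 / s \<le> (norm (u $ k))\<^sup>2"
    proof (rule ccontr)
      assume "\<not> ?thesis"
      then have "(norm (u $ k))\<^sup>2 < 1 / s" for k by (simp add: not_le)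
      then have "(\<Sum>k\<in>UNIV. (norm (u $ k))\<^sup>2) < (\<Sum>k\<in>(UNIV :: 's set). 1 / s)" by (intro sum_strict_mono) auto
      also have "\<dots> = 1" using s0 by (simp add: s_def)
      finally show False using u by (simp add: norm_vec_def L2_set_def)
    qed
    then obtain k where k: "1 / s \<le> (norm (u $ k))\<^sup>2" ..
    let ?e = "energy x (cball 0 m) (\<lambda>k. u $ k)"
    have "2 ^ (\<nu> - 1) * (K * L) ^ \<nu> * ?rhs\<^sup>2 \<le> (norm (u $ k))\<^sup>2 * (g\<^sup>2 / 2) ^ r * V"
      unfolding rhs2 using k V0 by (intro mult_right_mono) auto
    also have "\<dots> \<le> 2 ^ (\<nu> - 1) * (K * L) ^ \<nu> * ?e" using cb(5)[of "\<lambda>k. u $ k" k] .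
    finally have "?rhs\<^sup>2 \<le> ?e" using K0 L0 by simp
    then have "?rhs \<le> sqrt ?e" by (rule real_le_rsqrt)
    then show ?thesis by (simp add: L2_norm_on_fourier_op)
  qed
  moreover have "{u :: complex ^ 's. norm u = 1} \<noteq> {}"
    using vector_choose_size[of 1] by auto
  ultimately have "?rhs \<le> sigma_min (cball 0 m) x"
    unfolding sigma_min_def by (intro cINF_greatest) auto
  then show ?thesis by (simp add: K_def L_def V_def g_def s_def)
qed

end
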